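(* Let $\alpha>0$, $0<\gamma<\frac1{4\alpha}$, $\delta>\frac1{2\gamma\alpha}$, and view $(\mathbb{CP}^2,\alpha\omega_{FS})$ as the symplectic reduction of $\mathbb{C}^3$ at level $\alpha$ by $N=\frac12(|z_1|^2+|z_2|^2+|z_3|^2)$. Let $F_t=(J,H_t)$ with $J=\frac12(|z_1|^2-|z_2|^2)$ and $$H_t=2\gamma\delta t\alpha^2+(1-2t)\frac{|z_3|^2}{2}+2\gamma t\left(\Re(z_1z_2\bar z_3^2)-\delta R^2\right),\qquad R=\tfrac12(|z_1|^2+|z_2|^2),$$ and let $t^+=\frac{1}{2(1-2\gamma\alpha)}$ and $B=[0,0,\sqrt{2\alpha}]$. For $t\in(t^+,1]$, $F_t$ has exactly one triangular flap, with two parabolic corners, with first coordinates $x_1(t)>0$ and $-x_1(t)$, and elliptic-elliptic corner $F_t(B)=(0,2\gamma\delta t\alpha^2+(1-2t)\alpha)$. Moreover, $$x_1(t)\le j_t\le j_1=\frac{(\delta-2)(1-8\gamma\alpha)+\sqrt{16\gamma\alpha\left(1+\gamma\alpha(\delta^2-4\delta+1)\right)-1}}{4\gamma(\delta^2-4\delta+5)},$$ where $$j_t=\frac{(\delta-2)(2(1-4\gamma\alpha)t-1)+\sqrt{16\gamma\alpha t\left(2t-1+\gamma\alpha t(\delta^2-4\delta+1)\right)-(2t-1)^2}}{4\gamma t(\delta^2-4\delta+5)} .$$ In particular, when $\delta\to+\infty$, the size of the flap goes to zero (i.e. $x_1(t)\to0$).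
   Context: $\omega_{FS}$ is the Fubini–Study form normalized so that $\mathbb{CP}^2$ has Liouville volume $2\pi^2$. Functions on $\mathbb{C}^3$ (with form $\frac i2\sum dz_j\wedge d\bar z_j$) invariant under the flow of $N$ are identified with functions on the reduced space; $[z_1,z_2,z_3]$ is the class of a point of the level set. A singular point of $F=(f_1,f_2)$ is a point where $df_1,df_2$ are linearly dependent; non-degenerate singular points and their types (elliptic-regular, hyperbolic-regular, elliptic-elliptic, ...) are in the standard Williamson–Eliasson sense. Parabolic point $p$: for some local diffeomorphism $g$ near $F(p)$, with $(f_1,f_2)=g\circ F$, one has $df_1(p)\ne0$ and, with $\tilde f_2$ the restriction of $f_2$ to $f_1^{-1}(f_1(p))$: $p$ is a critical point of $\tilde f_2$ (so $df_2(p)=k\,df_1(p)$ for some $k$); $\operatorname{rank}d^2\tilde f_2(p)=1$; for some $v\in\ker d^2\tilde f_2(p)$ the third derivative at $0$ of $\tilde f_2$ along a curve through $p$ with velocity $v$ is nonzero; $\operatorname{rank}d^2(f_2-kf_1)(p)=3$. A parabolic value is the image of a parabolic point. Triangular flap: a curved triangular region in the interior of $F(M)$ whose corners are two parabolic values (the parabolic corners) and one elliptic-elliptic value (the elliptic corner), and whose sides are a curve of hyperbolic-regular values joining the two parabolic values and two curves of elliptic-regular values joining each parabolic value to the elliptic-elliptic value. *)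

theory Defs
  imports "HOL-Analysis.Analysis"
begin

text \<open>
  A symplectic 4-manifold is presented by an atlas of Darboux parametrizations: pairs of an
  open subset of \<open>complex^2\<close> (with its standard symplectic form) and an injective map of it
  into the manifold, with symplectic changes of coordinates.
  Every local notion below is invariant under such changes; it is therefore stated in some
  parametrization around the point.
\<close>


section \<open>Calculus\<close>

text \<open>Only used on open sets, where \<^const>\<open>differentiable_on\<close> is differentiability at each point.\<close>

primrec Ck_on :: "nat \<Rightarrow> 'a::real_normed_vector set \<Rightarrow> ('a \<Rightarrow> 'b::real_normed_vector) \<Rightarrow> bool" where
  "Ck_on 0 U f \<longleftrightarrow> continuous_on U f"
| "Ck_on (Suc k) U f \<longleftrightarrow>
     f differentiable_on U \<and> (\<forall>v. Ck_on k U (\<lambda>x. frechet_derivative f (at x) v))"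

definition smooth_on :: "'a::real_normed_vector set \<Rightarrow> ('a \<Rightarrow> 'b::real_normed_vector) \<Rightarrow> bool" where
  "smooth_on U f \<longleftrightarrow> (\<forall>k. Ck_on k U f)"

definition smooth_at :: "'a::real_normed_vector \<Rightarrow> ('a \<Rightarrow> 'b::real_normed_vector) \<Rightarrow> bool" where
  "smooth_at x f \<longleftrightarrow> (\<exists>U. open U \<and> x \<in> U \<and> smooth_on U f)"

definition local_diffeo_at :: "'a::real_normed_vector \<Rightarrow> ('a \<Rightarrow> 'a) \<Rightarrow> bool" where
  "local_diffeo_at y g \<longleftrightarrow>
     (\<exists>V W h. open V \<and> y \<in> V \<and> open W \<and> homeomorphism V W g h \<and> smooth_on V g \<and> smooth_on W h)"

definition differential :: "('a::real_normed_vector \<Rightarrow> real) \<Rightarrow> 'a \<Rightarrow> 'a \<Rightarrow> real" where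
  "differential f x v = frechet_derivative f (at x) v"

definition hessian :: "('a::real_normed_vector \<Rightarrow> real) \<Rightarrow> 'a \<Rightarrow> 'a \<Rightarrow> 'a \<Rightarrow> real" where
  "hessian f x v w = differential (\<lambda>y. differential f y v) x w"

definition form_kernel :: "('a \<Rightarrow> 'a \<Rightarrow> real) \<Rightarrow> 'a set" where
  "form_kernel b = {v. \<forall>w. b v w = 0}"

definition form_rank :: "('a::euclidean_space \<Rightarrow> 'a \<Rightarrow> real) \<Rightarrow> nat" where
  "form_rank b = DIM('a) - dim (form_kernel b)"


section \<open>Linear symplectic algebra\<close>

text \<open>The form \<open>(i/2) \<Sum>\<^sub>j dz\<^sub>j \<and> d(cnj z\<^sub>j) = \<Sum>\<^sub>j dx\<^sub>j \<and> dy\<^sub>j\<close>.\<close>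

definition omega :: "complex^'n \<Rightarrow> complex^'n \<Rightarrow> real" where
  "omega u v = (\<Sum>j\<in>UNIV. Im (cnj (u $ j) * v $ j))"

definition symplectic_map :: "(complex^'n \<Rightarrow> complex^'n) \<Rightarrow> bool" where
  "symplectic_map S \<longleftrightarrow> linear S \<and> (\<forall>u v. omega (S u) (S v) = omega u v)"

text \<open>
  Quadratic forms under the Poisson bracket are identified with the Lie algebra \<open>sp\<close> of
  their linear Hamiltonian vector fields: the form with polarization \<open>b\<close> corresponds to the
  map \<open>A\<close> with \<open>omega (A u) v = b u v\<close>.
\<close>

definition sp_algebra :: "(complex^'n \<Rightarrow> complex^'n) set" where
  "sp_algebra = {A. linear A \<and> (\<forall>u v. omega (A u) v + omega u (A v) = 0)}"

definition lie_bracket :: "('a::ab_group_add \<Rightarrow> 'a) \<Rightarrow> ('a \<Rightarrow> 'a) \<Rightarrow> 'a \<Rightarrow> 'a" where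
  "lie_bracket A B = (\<lambda>u. A (B u) - B (A u))"

definition hamiltonian_span ::
  "(complex^'n \<Rightarrow> complex^'n \<Rightarrow> real) \<Rightarrow> (complex^'n \<Rightarrow> complex^'n \<Rightarrow> real) \<Rightarrow>
   (complex^'n \<Rightarrow> complex^'n) set" where
  "hamiltonian_span b1 b2 =
     {A. linear A \<and> (\<exists>a c. \<forall>u v. omega (A u) v = a * b1 u v + c * b2 u v)}"

text \<open>A nilpotent, self-normalizing subalgebra; nilpotency says that all sufficiently long
  iterated brackets vanish.\<close>

definition cartan_subalgebra :: "(complex^'n \<Rightarrow> complex^'n) set \<Rightarrow> bool" where
  "cartan_subalgebra h \<longleftrightarrow>
     h \<subseteq> sp_algebra \<and>
     (\<lambda>_. 0) \<in> h \<and>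
     (\<forall>A\<in>h. \<forall>B\<in>h. (\<lambda>u. A u + B u) \<in> h) \<and>
     (\<forall>A\<in>h. \<forall>r. (\<lambda>u. r *\<^sub>R A u) \<in> h) \<and>
     (\<forall>A\<in>h. \<forall>B\<in>h. lie_bracket A B \<in> h) \<and>
     (\<exists>n. \<forall>As B. set As \<subseteq> h \<and> length As = n \<and> B \<in> h \<longrightarrow> foldr lie_bracket As B = (\<lambda>_. 0)) \<and>
     {A \<in> sp_algebra. \<forall>B\<in>h. lie_bracket A B \<in> h} = h"


section \<open>Singular points\<close>

text \<open>Here \<open>f1\<close>, \<open>f2\<close> are the components of \<open>F\<close> read in Darboux coordinates.\<close>

definition singular_at :: "(complex^2 \<Rightarrow> real) \<Rightarrow> (complex^2 \<Rightarrow> real) \<Rightarrow> complex^2 \<Rightarrow> bool" where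
  "singular_at f1 f2 x \<longleftrightarrow>
     (\<exists>a b. (a, b) \<noteq> (0, 0) \<and> (\<forall>v. a * differential f1 x v + b * differential f2 x v = 0))"

definition rank_zero_at :: "(complex^2 \<Rightarrow> real) \<Rightarrow> (complex^2 \<Rightarrow> real) \<Rightarrow> complex^2 \<Rightarrow> bool" where
  "rank_zero_at f1 f2 x \<longleftrightarrow> (\<forall>v. differential f1 x v = 0) \<and> (\<forall>v. differential f2 x v = 0)"

definition rank_one_at :: "(complex^2 \<Rightarrow> real) \<Rightarrow> (complex^2 \<Rightarrow> real) \<Rightarrow> complex^2 \<Rightarrow> bool" where
  "rank_one_at f1 f2 x \<longleftrightarrow> singular_at f1 f2 x \<and> \<not> rank_zero_at f1 f2 x"

definition nondegenerate_zero_at :: "(complex^2 \<Rightarrow> real) \<Rightarrow> (complex^2 \<Rightarrow> real) \<Rightarrow> complex^2 \<Rightarrow> bool" where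
  "nondegenerate_zero_at f1 f2 x \<longleftrightarrow>
     rank_zero_at f1 f2 x \<and> cartan_subalgebra (hamiltonian_span (hessian f1 x) (hessian f2 x))"

text \<open>In the linear symplectic coordinates \<open>S\<close>, the Cartan subalgebra is spanned by the two
  elliptic blocks \<open>x\<^sub>j\<^sup>2 + y\<^sub>j\<^sup>2\<close> of Williamson's theorem.\<close>

definition elliptic_elliptic_at :: "(complex^2 \<Rightarrow> real) \<Rightarrow> (complex^2 \<Rightarrow> real) \<Rightarrow> complex^2 \<Rightarrow> bool" where
  "elliptic_elliptic_at f1 f2 x \<longleftrightarrow>
     nondegenerate_zero_at f1 f2 x \<and>
     (\<exists>S. symplectic_map S \<and>
        {\<lambda>u. a * hessian f1 x (S u) (S u) + b * hessian f2 x (S u) (S u) | a b. True} =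
        {\<lambda>u. a * (cmod (u $ 1))\<^sup>2 + b * (cmod (u $ 2))\<^sup>2 | a b. True})"

text \<open>The line spanned by the Hamiltonian vectors of \<open>f1\<close> and \<open>f2\<close> at a rank one point, and its
  symplectic orthogonal.\<close>

definition orbit_tangent :: "(complex^2 \<Rightarrow> real) \<Rightarrow> (complex^2 \<Rightarrow> real) \<Rightarrow> complex^2 \<Rightarrow> (complex^2) set" where
  "orbit_tangent f1 f2 x =
     {w. \<exists>a b. \<forall>v. omega w v = a * differential f1 x v + b * differential f2 x v}"

definition symplectic_orthogonal :: "(complex^2) set \<Rightarrow> (complex^2) set" where
  "symplectic_orthogonal L = {v. \<forall>w\<in>L. omega w v = 0}"

text \<open>The combination \<open>a f1 + b f2\<close> critical at \<open>x\<close> has a Hessian which descends to the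
  symplectic plane (orthogonal of \<open>L\<close>)\<open>/L\<close>, where \<open>L\<close> is the orbit tangent; non-degeneracy is
  invertibility on that plane.\<close>

definition transverse_hessian ::
  "(complex^2 \<Rightarrow> real) \<Rightarrow> (complex^2 \<Rightarrow> real) \<Rightarrow> complex^2 \<Rightarrow> (complex^2 \<Rightarrow> complex^2 \<Rightarrow> real) \<Rightarrow> bool" where
  "transverse_hessian f1 f2 x Q \<longleftrightarrow>
     (\<exists>a b. (a, b) \<noteq> (0, 0) \<and>
        (\<forall>v. a * differential f1 x v + b * differential f2 x v = 0) \<and>
        Q = hessian (\<lambda>y. a * f1 y + b * f2 y) x)"

definition nondegenerate_transverse ::
  "(complex^2) set \<Rightarrow> (complex^2 \<Rightarrow> complex^2 \<Rightarrow> real) \<Rightarrow> bool" where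
  "nondegenerate_transverse L Q \<longleftrightarrow>
     (\<forall>v\<in>symplectic_orthogonal L. \<forall>w\<in>L. Q v w = 0) \<and>
     (\<forall>v\<in>symplectic_orthogonal L. (\<forall>w\<in>symplectic_orthogonal L. Q v w = 0) \<longrightarrow> v \<in> L)"

text \<open>In the following \<open>e, f\<close> represent a symplectic basis of the transverse plane in which the
  descended form is a non-zero multiple of the block \<open>x\<^sup>2 + y\<^sup>2\<close>, respectively \<open>x y\<close>.\<close>

definition elliptic_regular_at :: "(complex^2 \<Rightarrow> real) \<Rightarrow> (complex^2 \<Rightarrow> real) \<Rightarrow> complex^2 \<Rightarrow> bool" where
  "elliptic_regular_at f1 f2 x \<longleftrightarrow>
     rank_one_at f1 f2 x \<and>
     (\<exists>Q. transverse_hessian f1 f2 x Q \<and>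
        nondegenerate_transverse (orbit_tangent f1 f2 x) Q \<and>
        (\<exists>e\<in>symplectic_orthogonal (orbit_tangent f1 f2 x).
         \<exists>f\<in>symplectic_orthogonal (orbit_tangent f1 f2 x). \<exists>c. c \<noteq> 0 \<and>
           omega e f = 1 \<and> Q e e = c \<and> Q f f = c \<and> Q e f = 0))"

definition hyperbolic_regular_at :: "(complex^2 \<Rightarrow> real) \<Rightarrow> (complex^2 \<Rightarrow> real) \<Rightarrow> complex^2 \<Rightarrow> bool" where
  "hyperbolic_regular_at f1 f2 x \<longleftrightarrow>
     rank_one_at f1 f2 x \<and>
     (\<exists>Q. transverse_hessian f1 f2 x Q \<and>
        nondegenerate_transverse (orbit_tangent f1 f2 x) Q \<and>
        (\<exists>e\<in>symplectic_orthogonal (orbit_tangent f1 f2 x).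
         \<exists>f\<in>symplectic_orthogonal (orbit_tangent f1 f2 x). \<exists>c. c \<noteq> 0 \<and>
           omega e f = 1 \<and> Q e e = 0 \<and> Q f f = 0 \<and> Q e f = c))"

text \<open>The map \<open>\<psi>\<close> is a local parametrization of the 3-dimensional submanifold
  \<open>f1 = f1 x\<close> around \<open>x\<close>, so \<open>f2 \<circ> \<psi>\<close> is the restriction of \<open>f2\<close> to it read in coordinates, and
  \<open>c\<close> is a curve in these coordinates. Since its velocity \<open>v\<close> is in the kernel of the Hessian, the
  third derivative depends on \<open>c\<close> only through \<open>v\<close>.\<close>

definition parabolic_normal_at :: "(complex^2 \<Rightarrow> real) \<Rightarrow> (complex^2 \<Rightarrow> real) \<Rightarrow> complex^2 \<Rightarrow> bool" where
  "parabolic_normal_at f1 f2 x \<longleftrightarrow>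
     (\<exists>v. differential f1 x v \<noteq> 0) \<and>
     (\<exists>V (\<psi> :: real^3 \<Rightarrow> complex^2).
        open V \<and> 0 \<in> V \<and> smooth_on V \<psi> \<and> \<psi> 0 = x \<and>
        inj (frechet_derivative \<psi> (at 0)) \<and> (\<forall>s\<in>V. f1 (\<psi> s) = f1 x) \<and>
        (\<forall>v. differential (f2 \<circ> \<psi>) 0 v = 0) \<and>
        form_rank (hessian (f2 \<circ> \<psi>) 0) = 1 \<and>
        (\<exists>v\<in>form_kernel (hessian (f2 \<circ> \<psi>) 0). \<exists>c :: real \<Rightarrow> real^3.
           smooth_at 0 c \<and> c 0 = 0 \<and> (c has_vector_derivative v) (at 0) \<and>
           (deriv ^^ 3) (\<lambda>s. f2 (\<psi> (c s))) 0 \<noteq> 0)) \<and>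
     (\<exists>k. (\<forall>v. differential f2 x v = k * differential f1 x v) \<and>
        form_rank (hessian (\<lambda>y. f2 y - k * f1 y) x) = 3)"

definition parabolic_at :: "(complex^2 \<Rightarrow> real) \<Rightarrow> (complex^2 \<Rightarrow> real) \<Rightarrow> complex^2 \<Rightarrow> bool" where
  "parabolic_at f1 f2 x \<longleftrightarrow>
     (\<exists>g. local_diffeo_at (f1 x, f2 x) g \<and>
        parabolic_normal_at (\<lambda>y. fst (g (f1 y, f2 y))) (\<lambda>y. snd (g (f1 y, f2 y))) x)"


section \<open>Values and triangular flaps\<close>

type_synonym 'm atlas = "((complex^2) set \<times> (complex^2 \<Rightarrow> 'm)) set"

definition atlas_space :: "'m atlas \<Rightarrow> 'm set" where
  "atlas_space \<A> = (\<Union>(D, \<phi>)\<in>\<A>. \<phi> ` D)"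

definition points_of_type ::
  "((complex^2 \<Rightarrow> real) \<Rightarrow> (complex^2 \<Rightarrow> real) \<Rightarrow> complex^2 \<Rightarrow> bool) \<Rightarrow>
   'm atlas \<Rightarrow> ('m \<Rightarrow> real \<times> real) \<Rightarrow> 'm set" where
  "points_of_type P \<A> F =
     {p. \<exists>(D, \<phi>)\<in>\<A>. \<exists>x\<in>D. \<phi> x = p \<and> P (\<lambda>y. fst (F (\<phi> y))) (\<lambda>y. snd (F (\<phi> y))) x}"

definition elliptic_elliptic_values :: "'m atlas \<Rightarrow> ('m \<Rightarrow> real \<times> real) \<Rightarrow> (real \<times> real) set" where
  "elliptic_elliptic_values \<A> F = F ` points_of_type elliptic_elliptic_at \<A> F"

definition elliptic_regular_values :: "'m atlas \<Rightarrow> ('m \<Rightarrow> real \<times> real) \<Rightarrow> (real \<times> real) set" where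
  "elliptic_regular_values \<A> F = F ` points_of_type elliptic_regular_at \<A> F"

definition hyperbolic_regular_values :: "'m atlas \<Rightarrow> ('m \<Rightarrow> real \<times> real) \<Rightarrow> (real \<times> real) set" where
  "hyperbolic_regular_values \<A> F = F ` points_of_type hyperbolic_regular_at \<A> F"

definition parabolic_values :: "'m atlas \<Rightarrow> ('m \<Rightarrow> real \<times> real) \<Rightarrow> (real \<times> real) set" where
  "parabolic_values \<A> F = F ` points_of_type parabolic_at \<A> F"

text \<open>The set \<open>T\<close> is a triangular flap with parabolic corners \<open>p\<close>, \<open>q\<close> and elliptic corner \<open>c\<close>:
  the sides are arcs meeting only at the corners, and \<open>T\<close> is the closed region bounded by the
  Jordan curve which they form.\<close>

definition triangular_flap ::
  "'m atlas \<Rightarrow> ('m \<Rightarrow> real \<times> real) \<Rightarrow> (real \<times> real) set \<Rightarrow>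
   real \<times> real \<Rightarrow> real \<times> real \<Rightarrow> real \<times> real \<Rightarrow> bool" where
  "triangular_flap \<A> F T p q c \<longleftrightarrow>
     p \<in> parabolic_values \<A> F \<and> q \<in> parabolic_values \<A> F \<and> c \<in> elliptic_elliptic_values \<A> F \<and>
     (\<exists>h e1 e2.
        arc h \<and> pathstart h = p \<and> pathfinish h = q \<and>
        arc e1 \<and> pathstart e1 = p \<and> pathfinish e1 = c \<and>
        arc e2 \<and> pathstart e2 = q \<and> pathfinish e2 = c \<and>
        path_image h \<inter> path_image e1 = {p} \<and>
        path_image h \<inter> path_image e2 = {q} \<and>
        path_image e1 \<inter> path_image e2 = {c} \<and>
        path_image h - {p, q} \<subseteq> hyperbolic_regular_values \<A> F \<and>
        path_image e1 - {p, c} \<subseteq> elliptic_regular_values \<A> F \<and>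
        path_image e2 - {q, c} \<subseteq> elliptic_regular_values \<A> F \<and>
        T = (path_image h \<union> path_image e1 \<union> path_image e2) \<union>
            inside (path_image h \<union> path_image e1 \<union> path_image e2)) \<and>
     T \<subseteq> interior (F ` atlas_space \<A>)"


section \<open>The projective plane as a symplectic reduction\<close>

definition N_ham :: "complex^3 \<Rightarrow> real" where
  "N_ham z = ((cmod (z $ 1))\<^sup>2 + (cmod (z $ 2))\<^sup>2 + (cmod (z $ 3))\<^sup>2) / 2"

text \<open>The class of a point modulo the flow of \<^const>\<open>N_ham\<close>, which is the diagonal rotation.\<close>

definition hopf_class :: "complex^3 \<Rightarrow> (complex^3) set" where
  "hopf_class z = range (\<lambda>\<theta>. cis \<theta> *s z)"

definition CP2 :: "real \<Rightarrow> (complex^3) set set" where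
  "CP2 \<alpha> = hopf_class ` {z. N_ham z = \<alpha>}"

text \<open>The function on classes induced by a function invariant under the flow of \<^const>\<open>N_ham\<close>.\<close>

definition reduced :: "(complex^3 \<Rightarrow> 'b) \<Rightarrow> (complex^3) set \<Rightarrow> 'b" where
  "reduced f p = the_elem (f ` p)"

text \<open>On the part of the reduced space where \<open>z\<^sub>k \<noteq> 0\<close>, the two other coordinates of the
  representative with \<open>z\<^sub>k > 0\<close> are Darboux coordinates. The domain is a ball of volume
  \<open>2 \<pi>\<^sup>2 \<alpha>\<^sup>2\<close>.\<close>

definition affine_lift :: "real \<Rightarrow> 3 \<Rightarrow> complex^2 \<Rightarrow> complex^3" where
  "affine_lift \<alpha> k u =
     (let r = complex_of_real (sqrt (2 * \<alpha> - (norm u)\<^sup>2)) in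
      if k = 1 then vector [r, u $ 1, u $ 2]
      else if k = 2 then vector [u $ 1, r, u $ 2]
      else vector [u $ 1, u $ 2, r])"

definition CP2_atlas :: "real \<Rightarrow> (complex^3) set atlas" where
  "CP2_atlas \<alpha> = range (\<lambda>k. (ball 0 (sqrt (2 * \<alpha>)), \<lambda>u. hopf_class (affine_lift \<alpha> k u)))"

lemma norm_sq_2: "(norm (u::complex^2))\<^sup>2 = (cmod (u $ 1))\<^sup>2 + (cmod (u $ 2))\<^sup>2"
  by (simp add: norm_vec_def L2_set_def UNIV_2)

lemma atlas_space_CP2_atlas:
  assumes "0 < \<alpha>"
  shows "atlas_space (CP2_atlas \<alpha>) = CP2 \<alpha>"
proof (intro equalityI subsetI)
  fix p assume "p \<in> atlas_space (CP2_atlas \<alpha>)"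
  then obtain k u where u: "norm u < sqrt (2 * \<alpha>)" and p: "p = hopf_class (affine_lift \<alpha> k u)"
    by (auto simp: atlas_space_def CP2_atlas_def)
  have "(norm u)\<^sup>2 < 2 * \<alpha>"
    using u assms by (metis norm_ge_zero real_less_rsqrt real_sqrt_abs2 real_sqrt_less_iff power2_eq_square abs_of_nonneg)
  then have "N_ham (affine_lift \<alpha> k u) = \<alpha>"
    using exhaust_3[of k] by (auto simp: N_ham_def affine_lift_def Let_def norm_sq_2)
  then show "p \<in> CP2 \<alpha>" by (auto simp: p CP2_def)
next
  fix p assume "p \<in> CP2 \<alpha>"
  then obtain z where z: "N_ham z = \<alpha>" and p: "p = hopf_class z" by (auto simp: CP2_def)
  have "\<exists>k. z $ k \<noteq> 0"
  proof (rule ccontr)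
    assume "\<nexists>k. z $ k \<noteq> 0"
    then have "N_ham z = 0" by (simp add: N_ham_def)
    with z assms show False by simp
  qed
  then obtain k where k: "z $ k \<noteq> 0" by blast
  define \<theta> where "\<theta> = - Arg (z $ k)"
  define w where "w = cis \<theta> *s z"
  have wk: "w $ k = of_real (cmod (z $ k))"
  proof -
    have "w $ k = cis \<theta> * (of_real (cmod (z $ k)) * cis (Arg (z $ k)))"
      using rcis_cmod_Arg[of "z $ k"] by (simp add: w_def rcis_def)
    also have "\<dots> = of_real (cmod (z $ k)) * (cis \<theta> * cis (Arg (z $ k)))" by (simp only: mult_ac)
    also have "\<dots> = of_real (cmod (z $ k))" by (simp add: cis_mult \<theta>_def)
    finally show ?thesis .
  qed
  have Nw: "N_ham w = \<alpha>" using z by (simp add: N_ham_def w_def norm_mult)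
  have hw: "hopf_class w = hopf_class z"
  proof -
    have *: "cis a *s w = cis (a + \<theta>) *s z" for a
      by (simp add: w_def cis_mult[symmetric])
    have "range (\<lambda>a. cis (a + \<theta>) *s z) = (\<lambda>a. cis a *s z) ` range (\<lambda>a. a + \<theta>)"
      by (simp only: image_image)
    moreover have "range (\<lambda>a. a + \<theta>) = UNIV" by (metis diff_add_cancel surjI)
    ultimately have "range (\<lambda>a. cis (a + \<theta>) *s z) = range (\<lambda>a. cis a *s z)" by simp
    then show ?thesis by (simp add: hopf_class_def *)
  qed
  define u :: "complex^2" where
    "u = (if k = 1 then vector [w $ 2, w $ 3] else if k = 2 then vector [w $ 1, w $ 3]
          else vector [w $ 1, w $ 2])"
  have nu: "2 * \<alpha> - (norm u)\<^sup>2 = (cmod (w $ k))\<^sup>2"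
    using Nw exhaust_3[of k] by (auto simp: N_ham_def u_def norm_sq_2)
  have cw: "cmod (w $ k) = cmod (z $ k)" by (simp add: wk)
  have "sqrt (2 * \<alpha> - (norm u)\<^sup>2) = cmod (z $ k)" by (simp add: nu cw)
  then have "affine_lift \<alpha> k u = w"
    using exhaust_3[of k] wk
    by (auto simp: affine_lift_def Let_def vec_eq_iff forall_3 u_def)
  moreover have "norm u < sqrt (2 * \<alpha>)"
  proof (rule real_less_rsqrt)
    have "0 < (cmod (w $ k))\<^sup>2" using k cw by simp
    then show "(norm u)\<^sup>2 < 2 * \<alpha>" using nu by linarith
  qed
  ultimately show "p \<in> atlas_space (CP2_atlas \<alpha>)"
    using hw p by (force simp: atlas_space_def CP2_atlas_def)
qed

lemma affine_lift_darboux: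
  assumes "norm u < sqrt (2 * \<alpha>)"
  shows "\<exists>D. (affine_lift \<alpha> k has_derivative D) (at u) \<and> (\<forall>v w. omega (D v) (D w) = omega v w)"
proof -
  have pos: "0 < 2 * \<alpha> - u \<bullet> u"
  proof -
    have "0 \<le> norm u" by simp
    then have "0 < sqrt (2 * \<alpha>)" using assms by linarith
    then have "(norm u)\<^sup>2 < 2 * \<alpha>"
      using assms real_sqrt_pow2[of "2 * \<alpha>"] power_strict_mono[of "norm u" "sqrt (2 * \<alpha>)" 2]
      by simp
    then show ?thesis by (simp add: power2_norm_eq_inner)
  qed
  have "\<exists>\<rho>. ((\<lambda>u :: complex^2. sqrt (2 * \<alpha> - (norm u)\<^sup>2)) has_derivative \<rho>) (at u)"
    unfolding power2_norm_eq_inner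
    using pos by (intro exI) (rule derivative_intros | simp)+
  then obtain \<rho> where \<rho>: "((\<lambda>u :: complex^2. sqrt (2 * \<alpha> - (norm u)\<^sup>2)) has_derivative \<rho>) (at u)"
    by blast
  define D :: "complex^2 \<Rightarrow> complex^3" where
    "D v = (let r = complex_of_real (\<rho> v) in
      if k = 1 then vector [r, v $ 1, v $ 2]
      else if k = 2 then vector [v $ 1, r, v $ 2]
      else vector [v $ 1, v $ 2, r])" for v
  have \<rho>': "((\<lambda>u :: complex^2. complex_of_real (sqrt (2 * \<alpha> - (norm u)\<^sup>2)))
             has_derivative (\<lambda>v. of_real (\<rho> v))) (at u)"
    by (rule has_derivative_of_real[OF \<rho>])
  have pr: "((\<lambda>u :: complex^2. u $ i) has_derivative (\<lambda>v. v $ i)) (at u)" for i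
    by (rule bounded_linear_imp_has_derivative[OF bounded_linear_vec_nth])
  have "((\<lambda>u. affine_lift \<alpha> k u $ i) has_derivative (\<lambda>v. D v $ i)) (at u)" for i
    using exhaust_3[of i] exhaust_3[of k] \<rho>' pr[of 1] pr[of 2]
    by (auto simp: affine_lift_def D_def Let_def)
  then have "(affine_lift \<alpha> k has_derivative D) (at u)"
    by (subst has_derivative_componentwise_within)
       (auto simp: Basis_vec_def inner_axis intro!: has_derivative_inner_left)
  moreover have "omega (D v) (D w) = omega v w" for v w
    using exhaust_3[of k] by (auto simp: omega_def D_def Let_def sum_2 sum_3)
  ultimately show ?thesis by blast
qed


section \<open>The system\<close>

definition J_ham :: "complex^3 \<Rightarrow> real" where
  "J_ham z = ((cmod (z $ 1))\<^sup>2 - (cmod (z $ 2))\<^sup>2) / 2"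

definition R_ham :: "complex^3 \<Rightarrow> real" where
  "R_ham z = ((cmod (z $ 1))\<^sup>2 + (cmod (z $ 2))\<^sup>2) / 2"

definition H_ham :: "real \<Rightarrow> real \<Rightarrow> real \<Rightarrow> real \<Rightarrow> complex^3 \<Rightarrow> real" where
  "H_ham \<alpha> \<gamma> \<delta> t z =
     2 * \<gamma> * \<delta> * t * \<alpha>\<^sup>2 + (1 - 2 * t) * ((cmod (z $ 3))\<^sup>2 / 2)
     + 2 * \<gamma> * t * (Re (z $ 1 * z $ 2 * (cnj (z $ 3))\<^sup>2) - \<delta> * (R_ham z)\<^sup>2)"

definition F_sys :: "real \<Rightarrow> real \<Rightarrow> real \<Rightarrow> real \<Rightarrow> (complex^3) set \<Rightarrow> real \<times> real" where
  "F_sys \<alpha> \<gamma> \<delta> t = reduced (\<lambda>z. (J_ham z, H_ham \<alpha> \<gamma> \<delta> t z))"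

lemma F_sys_hopf_class: "F_sys \<alpha> \<gamma> \<delta> t (hopf_class z) = (J_ham z, H_ham \<alpha> \<gamma> \<delta> t z)"
proof -
  have c: "cis \<theta> * cnj (cis \<theta>) = 1" for \<theta>
    by (simp add: cis_cnj cis_mult)
  have "cis \<theta> * z $ 1 * (cis \<theta> * z $ 2) * (cnj (cis \<theta> * z $ 3))\<^sup>2 =
        (cis \<theta> * cnj (cis \<theta>))\<^sup>2 * (z $ 1 * z $ 2 * (cnj (z $ 3))\<^sup>2)" for \<theta>
    by (simp only: complex_cnj_mult power2_eq_square mult_ac)
  then have m: "cis \<theta> * z $ 1 * (cis \<theta> * z $ 2) * (cnj (cis \<theta> * z $ 3))\<^sup>2 =
        z $ 1 * z $ 2 * (cnj (z $ 3))\<^sup>2" for \<theta>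
    by (simp only: c power_one mult_1)
  have "(J_ham (cis \<theta> *s z), H_ham \<alpha> \<gamma> \<delta> t (cis \<theta> *s z)) = (J_ham z, H_ham \<alpha> \<gamma> \<delta> t z)" for \<theta>
    unfolding J_ham_def H_ham_def R_ham_def vector_smult_component m
    by (simp add: norm_mult)
  then have "(\<lambda>z. (J_ham z, H_ham \<alpha> \<gamma> \<delta> t z)) ` hopf_class z = {(J_ham z, H_ham \<alpha> \<gamma> \<delta> t z)}"
    unfolding hopf_class_def image_image by simp
  then show ?thesis by (simp add: F_sys_def reduced_def)
qed

definition B_pt :: "real \<Rightarrow> (complex^3) set" where
  "B_pt \<alpha> = hopf_class (vector [0, 0, complex_of_real (sqrt (2 * \<alpha>))])"

definition t_plus :: "real \<Rightarrow> real \<Rightarrow> real" where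
  "t_plus \<alpha> \<gamma> = 1 / (2 * (1 - 2 * \<gamma> * \<alpha>))"

definition j_bound :: "real \<Rightarrow> real \<Rightarrow> real \<Rightarrow> real \<Rightarrow> real" where
  "j_bound \<alpha> \<gamma> \<delta> t =
     ((\<delta> - 2) * (2 * (1 - 4 * \<gamma> * \<alpha>) * t - 1)
      + sqrt (16 * \<gamma> * \<alpha> * t * (2 * t - 1 + \<gamma> * \<alpha> * t * (\<delta>\<^sup>2 - 4 * \<delta> + 1)) - (2 * t - 1)\<^sup>2))
     / (4 * \<gamma> * t * (\<delta>\<^sup>2 - 4 * \<delta> + 5))"

end

theory Submission
  imports Defs
begin

text \<open>
  On the level \<open>J = j\<close> the reduced space is a sphere of revolution over \<open>\<bar>j\<bar> \<le> R \<le> \<alpha>\<close>. Up to an affine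
  change with positive slope, the extreme values of \<open>H\<close> on the circle \<open>R = r\<close> are
  \<open>\<kappa> r \<plusminus> (\<alpha> - r) s - \<delta> r\<^sup>2/2\<close>, where \<open>s = sqrt (r\<^sup>2 - j\<^sup>2)\<close> and \<open>\<kappa> = (2 t - 1) / (4 \<gamma> t)\<close>; the hypotheses
  give \<open>\<alpha> < \<kappa>\<close> and \<open>2 \<kappa> < \<alpha> \<delta>\<close>. The critical points of the upper profile, and those with \<open>z\<^sub>3 = 0\<close>, lie over the
  boundary of the image. With \<open>x = r / s\<close>, the critical points of the lower profile are the solutions of
  \<open>s (\<delta> x - x\<^sup>2 - 1) = \<kappa> - \<alpha> x\<close>, one for each \<open>x \<in> [1, \<kappa>/\<alpha>)\<close>, and its second derivative there is a positive
  multiple of an increasing function of \<open>x\<close>. Hence \<open>\<bar>j\<bar>\<close> increases along the curve up to the parabolic value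
  (local maxima, hyperbolic) and then decreases to \<open>0\<close>, at \<open>B\<close> (local minima, elliptic). Together with the
  reflection \<open>j \<mapsto> -j\<close> this gives a Jordan curve, which contains every singular value in the interior of the image.
  The sides of any flap form a Jordan curve contained in this one, hence equal to it.
\<close>

section \<open>Smooth maps\<close>

text \<open>In r alone the critical equation of a profile contains a square root, and squaring gives
  a quartic. With r = x s it is linear in s; hence the closed formula \<open>sx\<close>, with no
  roots to select. Existence needs only the chart z_3 > 0, where H is a polynomial and the test
  points are real. Uniqueness concerns all three charts and is treated on the level set N = \<alpha>
  of C^3. There the obstacle is that a parabolic point may be normalized by any local diffeomorphism
  of the plane. What survives such a change is that, on a suitable hypersurface, (J, H) moves to
  second order along a fixed vector, by a form of rank one. The equation of the reduced space
  equates a multiple of this form with a form that has rank two unless \<open>psi\<close> vanishes,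
  and this comparison no longer involves the diffeomorphism. The bound j_t is the larger root of a
  quadratic equation. It comes from an inequality valid at every point of the curve, so
  \<open>xpar\<close>, a root of the cubic \<open>Psi\<close>, is never computed.\<close>

lemma Ck_on_cong:
  assumes "open U" "\<And>x. x \<in> U \<Longrightarrow> f x = g x"
  shows "Ck_on k U f \<longleftrightarrow> Ck_on k U g"
  using assms(2)
proof (induction k arbitrary: f g)
  case 0 then show ?case by (auto intro: continuous_on_cong)
next
  case (Suc k)
  have d: "(f has_derivative D) (at x) \<longleftrightarrow> (g has_derivative D) (at x)" if "x \<in> U" for x D
    using that assms(1) Suc.prems
    by (metis has_derivative_transform_within_open)
  have "f differentiable_on U \<longleftrightarrow> g differentiable_on U"
    using d assms(1) by (auto simp: differentiable_on_eq_differentiable_at differentiable_def)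
  moreover have "frechet_derivative f (at x) = frechet_derivative g (at x)" if "x \<in> U" for x
    using d[OF that] by (simp add: frechet_derivative_def)
  then have "Ck_on k U (\<lambda>x. frechet_derivative f (at x) v) \<longleftrightarrow> Ck_on k U (\<lambda>x. frechet_derivative g (at x) v)" for v
    by (intro Suc.IH) auto
  ultimately show ?case by simp
qed

lemma Ck_on_subset:
  assumes "Ck_on k U f" "V \<subseteq> U" shows "Ck_on k V f"
  using assms(1)
proof (induction k arbitrary: f)
  case 0 then show ?case using assms(2) by (auto intro: continuous_on_subset)
next
  case (Suc k) then show ?case using assms(2) by (auto intro: differentiable_on_subset)
qed

lemma Ck_on_SucI:
  assumes "open U" "\<And>x. x \<in> U \<Longrightarrow> (f has_derivative f' x) (at x)"
    "\<And>v. Ck_on k U (\<lambda>x. f' x v)"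
  shows "Ck_on (Suc k) U f"
proof -
  have "frechet_derivative f (at x) = f' x" if "x \<in> U" for x
    using frechet_derivative_at[OF assms(2)[OF that]] by simp
  then have "Ck_on k U (\<lambda>x. frechet_derivative f (at x) v)" for v
    using assms(3)[of v] Ck_on_cong[OF assms(1), of "\<lambda>x. frechet_derivative f (at x) v" "\<lambda>x. f' x v"] by simp
  moreover have "f differentiable_on U"
    using assms(1,2) by (auto simp: differentiable_on_eq_differentiable_at differentiable_def)
  ultimately show ?thesis by simp
qed

lemma Ck_on_Suc_has_derivative:
  assumes "open U" "Ck_on (Suc k) U f" "x \<in> U"
  shows "(f has_derivative frechet_derivative f (at x)) (at x)"
  using assms by (auto simp: differentiable_on_eq_differentiable_at frechet_derivative_works)

lemma Ck_on_Suc_imp: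
  "Ck_on (Suc k) U f \<Longrightarrow> Ck_on k U f"
proof (induction k arbitrary: f)
  case 0 then show ?case by (auto intro: differentiable_imp_continuous_on)
next
  case (Suc k) then show ?case by simp
qed

lemma Ck_on_const: "open U \<Longrightarrow> Ck_on k U (\<lambda>x. c)"
proof (induction k arbitrary: c)
  case (Suc k) then show ?case by (intro Ck_on_SucI[where f' = "\<lambda>x v. 0"]) auto
qed simp

lemma Ck_on_linear: 
  assumes "open U" "bounded_linear f" shows "Ck_on k U f"
proof (cases k)
  case 0 then show ?thesis using assms by (simp add: linear_continuous_on)
next
  case (Suc m)
  show ?thesis unfolding Suc using assms
    by (intro Ck_on_SucI[where f' = "\<lambda>x. f"] bounded_linear_imp_has_derivative Ck_on_const)
qed

lemma Ck_on_linear_compose: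
  assumes "open U" "bounded_linear L" "Ck_on k U f" shows "Ck_on k U (\<lambda>x. L (f x))"
  using assms(3)
proof (induction k arbitrary: f)
  case 0 then show ?case using assms by (auto intro: bounded_linear.continuous_on)
next
  case (Suc k)
  have "Ck_on k U (\<lambda>x. frechet_derivative f (at x) v)" for v using Suc.prems by simp
  then show ?case
    by (intro Ck_on_SucI[where f' = "\<lambda>x v. L (frechet_derivative f (at x) v)"] assms(1)
        bounded_linear.has_derivative[OF assms(2)] Ck_on_Suc_has_derivative[OF assms(1) Suc.prems] Suc.IH)
qed

lemma Ck_on_add:
  assumes "open U" "Ck_on k U f" "Ck_on k U g" shows "Ck_on k U (\<lambda>x. f x + g x)"
  using assms(2,3)
proof (induction k arbitrary: f g)
  case 0 then show ?case by (auto intro: continuous_intros)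
next
  case (Suc k)
  have "Ck_on k U (\<lambda>x. frechet_derivative f (at x) v)" "Ck_on k U (\<lambda>x. frechet_derivative g (at x) v)" for v
    using Suc.prems by simp_all
  then show ?case
    by (intro Ck_on_SucI[where f' = "\<lambda>x v. frechet_derivative f (at x) v + frechet_derivative g (at x) v"] assms(1)
        has_derivative_add Ck_on_Suc_has_derivative[OF assms(1) Suc.prems(1)]
        Ck_on_Suc_has_derivative[OF assms(1) Suc.prems(2)] Suc.IH)
qed

lemma Ck_on_sum:
  assumes "open U" "\<And>i. i \<in> I \<Longrightarrow> Ck_on k U (f i)" shows "Ck_on k U (\<lambda>x. \<Sum>i\<in>I. f i x)"
proof (cases "finite I")
  case True
  then show ?thesis using assms(2)
    by (induction I rule: finite_induct) (auto simp: Ck_on_const[OF assms(1)] intro!: Ck_on_add assms(1))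
qed (simp add: Ck_on_const assms(1))

lemma Ck_on_bilinear:
  assumes "open U" "bounded_bilinear B" "Ck_on k U f" "Ck_on k U g"
  shows "Ck_on k U (\<lambda>x. B (f x) (g x))"
  using assms(3,4)
proof (induction k arbitrary: f g)
  case 0 then show ?case using bounded_bilinear.continuous_on[OF assms(2)] by auto
next
  case (Suc k)
  have "Ck_on k U f" "Ck_on k U g"
    "Ck_on k U (\<lambda>x. frechet_derivative f (at x) v)" "Ck_on k U (\<lambda>x. frechet_derivative g (at x) v)" for v
    using Suc.prems Ck_on_Suc_imp[OF Suc.prems(1)] Ck_on_Suc_imp[OF Suc.prems(2)] by simp_all
  then show ?case
    by (intro Ck_on_SucI[where f' = "\<lambda>x v. B (f x) (frechet_derivative g (at x) v) + B (frechet_derivative f (at x) v) (g x)"]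
        bounded_bilinear.FDERIV[OF assms(2)] Ck_on_Suc_has_derivative[OF assms(1) Suc.prems(1)]
        Ck_on_Suc_has_derivative[OF assms(1) Suc.prems(2)] Ck_on_add assms(1) Suc.IH)
qed

lemmas Ck_on_mult = Ck_on_bilinear[OF _ bounded_bilinear_mult]
lemmas Ck_on_scaleR = Ck_on_bilinear[OF _ bounded_bilinear_scaleR]
lemmas Ck_on_minus = Ck_on_linear_compose[OF _ bounded_linear_minus[OF bounded_linear_ident]]

lemma Ck_on_diff:
  assumes "open U" "Ck_on k U f" "Ck_on k U g" shows "Ck_on k U (\<lambda>x. f x - g x)"
  using Ck_on_add[OF assms(1,2) Ck_on_minus[OF assms(1,3)]] by simp

lemma Ck_on_power:
  fixes f :: "'a::real_normed_vector \<Rightarrow> 'b::real_normed_algebra_1"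
  assumes "open U" "Ck_on k U f" shows "Ck_on k U (\<lambda>x. f x ^ n)"
  by (induction n) (auto intro!: Ck_on_mult Ck_on_const assms)

lemma Ck_on_compose:
  fixes f :: "'a::real_normed_vector \<Rightarrow> 'b::euclidean_space" and g :: "'b \<Rightarrow> 'c::real_normed_vector"
  assumes "open U" "open V" "Ck_on k U f" "Ck_on k V g" "f ` U \<subseteq> V"
  shows "Ck_on k U (\<lambda>x. g (f x))"
  using assms(3,4)
proof (induction k arbitrary: g)
  case 0 then show ?case using assms(5) by (auto intro: continuous_on_compose2)
next
  case (Suc k)
  let ?f' = "\<lambda>x. frechet_derivative f (at x)" and ?g' = "\<lambda>y. frechet_derivative g (at y)"
  have f: "(f has_derivative ?f' x) (at x)" if "x \<in> U" for x
    using Ck_on_Suc_has_derivative[OF assms(1) Suc.prems(1) that] .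
  have g: "(g has_derivative ?g' y) (at y)" if "y \<in> V" for y
    using Ck_on_Suc_has_derivative[OF assms(2) Suc.prems(2) that] .
  \<comment> \<open>\<open>Ck_on\<close> speaks of derivatives along fixed vectors only, so the
    moving argument \<open>?f' x v\<close> of \<open>?g' (f x)\<close> is expanded in the basis.
    Each summand is then a product to which the induction hypothesis applies.\<close>
  have *: "((\<lambda>x. g (f x)) has_derivative (\<lambda>v. \<Sum>b\<in>Basis. (?f' x v \<bullet> b) *\<^sub>R ?g' (f x) b)) (at x)"
    if "x \<in> U" for x
  proof -
    have fx: "f x \<in> V" using that assms(5) by auto
    have d: "((\<lambda>x. g (f x)) has_derivative (\<lambda>v. ?g' (f x) (?f' x v))) (at x)"
      using has_derivative_compose[OF f[OF that] g[OF fx]] by simp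
    have lin: "linear (?g' (f x))" using g[OF fx] has_derivative_linear by blast
    have rep: "?g' (f x) w = (\<Sum>b\<in>Basis. (w \<bullet> b) *\<^sub>R ?g' (f x) b)" for w
    proof -
      have "?g' (f x) w = ?g' (f x) (\<Sum>b\<in>Basis. (w \<bullet> b) *\<^sub>R b)" by (simp add: euclidean_representation)
      then show ?thesis using lin by (simp only: linear_sum linear_cmul)
    qed
    have "(\<lambda>v. ?g' (f x) (?f' x v)) = (\<lambda>v. \<Sum>b\<in>Basis. (?f' x v \<bullet> b) *\<^sub>R ?g' (f x) b)"
      by (rule ext) (rule rep)
    with d show ?thesis by metis
  qed
  show ?case
  proof (rule Ck_on_SucI[OF assms(1) *])
    fix v
    show "Ck_on k U (\<lambda>x. \<Sum>b\<in>Basis. (?f' x v \<bullet> b) *\<^sub>R ?g' (f x) b)"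
    proof (intro Ck_on_sum Ck_on_scaleR assms(1))
      fix b :: 'b
      show "Ck_on k U (\<lambda>x. ?f' x v \<bullet> b)"
        using Suc.prems(1) by (intro Ck_on_linear_compose[OF assms(1) bounded_linear_inner_left]) simp
      show "Ck_on k U (\<lambda>x. ?g' (f x) b)"
        using Suc.prems Ck_on_Suc_imp[OF Suc.prems(1)] by (intro Suc.IH) auto
    qed
  qed
qed

text \<open>Real powers are closed under differentiation up to constant factors, so one induction
  over all exponents at once succeeds; \<open>sqrt\<close> is the exponent 1/2.\<close>

lemma Ck_on_powr: "Ck_on k {0<..} (\<lambda>x::real. x powr p)"
proof (induction k arbitrary: p)
  case 0 then show ?case by (auto intro!: continuous_intros)
next
  case (Suc k)
  show ?case
  proof (rule Ck_on_SucI[where f' = "\<lambda>x v. (p * x powr (p - 1)) * v"])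
    fix x :: real assume "x \<in> {0<..}"
    then show "((\<lambda>x. x powr p) has_derivative (\<lambda>v. (p * x powr (p - 1)) * v)) (at x)"
      using has_real_derivative_powr[of x p] by (simp add: has_field_derivative_def)
  qed (auto intro!: Ck_on_mult Ck_on_const Suc)
qed

lemma Ck_on_sqrt: "Ck_on k {0<..} sqrt"
proof -
  have "Ck_on k {0<..} (\<lambda>x::real. x powr (1/2))" by (rule Ck_on_powr)
  then show ?thesis by (subst Ck_on_cong[where g = "\<lambda>x. x powr (1/2)"]) (auto simp: powr_half_sqrt)
qed

lemma Ck_on_sin_cos: "Ck_on k UNIV (sin :: real \<Rightarrow> real) \<and> Ck_on k UNIV (cos :: real \<Rightarrow> real)"
proof (induction k)
  case 0 then show ?case by (auto intro!: continuous_intros)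
next
  case (Suc k)
  have "((sin :: real \<Rightarrow> real) has_derivative (\<lambda>v. v * cos x)) (at x)"
    "((cos :: real \<Rightarrow> real) has_derivative (\<lambda>v. v * - sin x)) (at x)" for x
    by (auto intro!: derivative_eq_intros)
  then show ?case
    by (intro conjI Ck_on_SucI[where f = sin and f' = "\<lambda>x v. v * cos x"] Ck_on_SucI[where f = cos and f' = "\<lambda>x v. v * - sin x"])
       (auto intro!: Ck_on_mult[of UNIV] Ck_on_const Ck_on_minus Suc conjunct1[OF Suc] conjunct2[OF Suc])
qed

lemma Ck_on_real_compose:
  fixes f :: "'a::real_normed_vector \<Rightarrow> real"
  assumes "open U" "Ck_on k U f"
  shows "Ck_on k U (\<lambda>x. sin (f x))" "Ck_on k U (\<lambda>x. cos (f x))"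
    "(\<And>x. x \<in> U \<Longrightarrow> 0 < f x) \<Longrightarrow> Ck_on k U (\<lambda>x. sqrt (f x))"
  using Ck_on_compose[OF assms(1) _ assms(2), of UNIV sin] Ck_on_compose[OF assms(1) _ assms(2), of UNIV cos]
    Ck_on_compose[OF assms(1) _ assms(2), of "{0<..}" sqrt] Ck_on_sqrt Ck_on_sin_cos
  by auto

lemma Ck_on_cis:
  fixes f :: "'a::real_normed_vector \<Rightarrow> real"
  assumes "open U" "Ck_on k U f"
  shows "Ck_on k U (\<lambda>x. cis (f x))"
proof -
  have "Ck_on k U (\<lambda>x. of_real (cos (f x)) + \<i> * of_real (sin (f x)))"
    by (intro Ck_on_add Ck_on_mult Ck_on_const Ck_on_linear_compose[OF _ bounded_linear_of_real] Ck_on_real_compose assms)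
  then show ?thesis by (simp add: cis_conv_exp exp_Euler sin_of_real cos_of_real)
qed

lemma nth_has_derivative: "((\<lambda>u :: 'a::real_normed_vector ^ 'n. u $ i) has_derivative (\<lambda>v. v $ i)) (at u)"
  by (rule bounded_linear_imp_has_derivative[OF bounded_linear_vec_nth])

lemma has_derivative_vec:
  fixes f :: "'a::real_normed_vector \<Rightarrow> 'b::euclidean_space ^ 'n"
  assumes "\<And>i. ((\<lambda>x. f x $ i) has_derivative (\<lambda>v. D v $ i)) (at x)"
  shows "(f has_derivative D) (at x)"
  by (subst has_derivative_componentwise_within)
     (auto simp: Basis_vec_def inner_axis intro!: has_derivative_inner_left assms)

lemma Ck_on_vec:
  fixes f :: "'a::real_normed_vector \<Rightarrow> 'b::real_normed_vector ^ 'n"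
  assumes "open U" "\<And>i. Ck_on k U (\<lambda>x. f x $ i)" shows "Ck_on k U f"
proof -
  have chart_ball: "bounded_linear (axis i :: 'b \<Rightarrow> 'b ^ 'n)" for i
  proof (rule bounded_linear_intro[where K = 1])
    have "(norm (if j = i then x else 0))\<^sup>2 = (if j = i then (norm x)\<^sup>2 else 0)" for j and x :: 'b by simp
    then show "norm (axis i x :: 'b ^ 'n) \<le> norm x * 1" for x :: 'b
      by (simp add: norm_vec_def L2_set_def axis_def)
  qed (auto simp: vec_eq_iff axis_def)
  have "f x = (\<Sum>i\<in>UNIV. axis i (f x $ i))" for x
    by (simp add: vec_eq_iff axis_def if_distrib cong: if_cong)
  moreover have "Ck_on k U (\<lambda>x. \<Sum>i\<in>UNIV. axis i (f x $ i))"
    by (intro Ck_on_sum Ck_on_linear_compose[OF _ chart_ball] assms)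
  ultimately show ?thesis by simp
qed

lemma differential_eq: "(f has_derivative f') (at x) \<Longrightarrow> differential f x = f'"
  unfolding differential_def using frechet_derivative_at by metis

lemma hessian_eqI:
  assumes "open U" "x \<in> U" "\<And>y. y \<in> U \<Longrightarrow> (f has_derivative f' y) (at y)"
    "((\<lambda>y. f' y v) has_derivative B) (at x)"
  shows "hessian f x v = B"
proof -
  have "((\<lambda>y. differential f y v) has_derivative B) (at x)"
    by (rule has_derivative_transform_within_open[OF assms(4,1,2)]) (simp add: differential_eq[OF assms(3)])
  then show ?thesis by (auto simp: hessian_def differential_eq)
qed

section \<open>Second-order expansions and symmetry of the Hessian\<close>

lemma abs_diff_divide:
  fixes s :: real assumes "0 < s" shows "\<bar>A - s * h\<bar> / s = \<bar>A / s - h\<bar>"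
proof -
  have "A / s - h = (A - s * h) / s" using assms by (simp add: diff_divide_distrib)
  then show ?thesis using assms by (simp add: abs_divide)
qed

context
  fixes f :: "'a::real_normed_vector \<Rightarrow> real" and U x
  assumes C2: "Ck_on 2 U f" and U: "open U" "x \<in> U"
begin

lemma C2_differential: "y \<in> U \<Longrightarrow> (f has_derivative differential f y) (at y)"
  using Ck_on_Suc_has_derivative[OF U(1), of 1 f y] C2 by (simp add: differential_def[abs_def] numeral_2_eq_2)

lemma C2_hessian: "((\<lambda>y. differential f y v) has_derivative hessian f x v) (at x)"
  using Ck_on_Suc_has_derivative[OF U(1), of 0 "\<lambda>y. differential f y v" x] C2 U
  by (simp add: differential_def[abs_def] hessian_def[abs_def] numeral_2_eq_2)

lemma hessian_estimate:
  assumes "0 < e"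
  obtains d where "0 < d" "\<And>u. norm u < d \<Longrightarrow> x + u \<in> U"
    "\<And>u. norm u < d \<Longrightarrow> \<bar>differential f (x + u) v - differential f x v - hessian f x v u\<bar> \<le> e * norm u"
proof -
  from C2_hessian[of v] assms obtain d1 where d1: "0 < d1"
    "\<And>y. norm (y - x) < d1 \<Longrightarrow> \<bar>differential f y v - differential f x v - hessian f x v (y - x)\<bar> \<le> e * norm (y - x)"
    unfolding has_derivative_at_alt by (auto simp: real_norm_def)
  obtain d2 where d2: "0 < d2" "ball x d2 \<subseteq> U" using U open_contains_ball by blast
  show ?thesis
  proof (rule that[of "min d1 d2"])
    fix u :: 'a assume u: "norm u < min d1 d2"
    then have "x + u \<in> ball x d2" by (simp add: dist_norm)
    then show "x + u \<in> U" using d2 by blast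
    show "\<bar>differential f (x + u) v - differential f x v - hessian f x v u\<bar> \<le> e * norm u"
      using d1(2)[of "x + u"] u by simp
  qed (use d1 d2 in auto)
qed

lemma line_deriv:
  assumes "x + (b + t *\<^sub>R v) \<in> U"
  shows "((\<lambda>t. f (x + (b + t *\<^sub>R v))) has_real_derivative differential f (x + (b + t *\<^sub>R v)) v) (at t)"
proof -
  have 1: "((\<lambda>t. x + (b + t *\<^sub>R v)) has_derivative (\<lambda>s. s *\<^sub>R v)) (at t)"
    by (auto intro!: derivative_eq_intros)
  have "((\<lambda>t. f (x + (b + t *\<^sub>R v))) has_derivative (\<lambda>s. differential f (x + (b + t *\<^sub>R v)) (s *\<^sub>R v))) (at t)"
    using has_derivative_compose[OF 1 C2_differential[OF assms]] by simp
  moreover have "linear (differential f (x + (b + t *\<^sub>R v)))"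
    using C2_differential[OF assms] has_derivative_linear by blast
  ultimately show ?thesis by (simp add: has_field_derivative_def linear_cmul mult.commute[of _ "differential f _ _"])
qed

text \<open>The numerator is the variation along v of the increment of f under the shift by s w. The
  mean value theorem reduces it to the differential at two points near x, and differentiability of
  the differential at x finishes. The quotient is symmetric in v and w, which yields
  \<open>hessian_commute\<close>.\<close>

lemma second_difference_tendsto:
  "((\<lambda>s. (f (x + s *\<^sub>R (v + w)) - f (x + s *\<^sub>R v) - f (x + s *\<^sub>R w) + f x) / s\<^sup>2) \<longlongrightarrow> hessian f x v w) (at_right 0)"
proof (rule tendstoI)
  fix e :: real assume e: "0 < e"
  \<comment> \<open>Up to the factor s, this bounds the sum of the norms of the two displacements s
    w + t v and t v; the summand 1 keeps it positive.\<close>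
  define K where "K = 2 * norm v + norm w + 1"
  have K: "0 < K" by (simp add: K_def add_nonneg_pos)
  define e' where "e' = e / (2 * K)"
  have e': "0 < e'" using e K by (simp add: e'_def)
  obtain d where d: "0 < d" "\<And>u. norm u < d \<Longrightarrow> x + u \<in> U"
    "\<And>u. norm u < d \<Longrightarrow> \<bar>differential f (x + u) v - differential f x v - hessian f x v u\<bar> \<le> e' * norm u"
    using hessian_estimate[OF e', of v] by blast
  have lin: "linear (hessian f x v)" using C2_hessian has_derivative_linear by blast
  have "\<bar>(f (x + s *\<^sub>R (v + w)) - f (x + s *\<^sub>R v) - f (x + s *\<^sub>R w) + f x) / s\<^sup>2 - hessian f x v w\<bar> < e"
    if s: "0 < s" "s < d / K" for s
  proof -
    define g where "g t = f (x + (s *\<^sub>R w + t *\<^sub>R v)) - f (x + (0 + t *\<^sub>R v))" for t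
    have sK: "s * (norm v + norm w) < d" "s * K < d"
    proof -
      show "s * K < d" using s K by (simp add: field_simps)
      moreover have "s * (norm v + norm w) \<le> s * K" using s by (intro mult_left_mono) (auto simp: K_def)
      ultimately show "s * (norm v + norm w) < d" by linarith
    qed
    have n: "norm (s *\<^sub>R w + t *\<^sub>R v) \<le> s * (norm v + norm w)" "norm (t *\<^sub>R v) \<le> s * norm v" if "0 \<le> t" "t \<le> s" for t
    proof -
      have "norm (t *\<^sub>R v) \<le> s * norm v" using that by (simp add: mult_right_mono)
      then show "norm (t *\<^sub>R v) \<le> s * norm v" .
      then show "norm (s *\<^sub>R w + t *\<^sub>R v) \<le> s * (norm v + norm w)"
        using norm_triangle_ineq[of "s *\<^sub>R w" "t *\<^sub>R v"] s by (simp add: algebra_simps)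
    qed
    have vw: "s * norm v \<le> s * (norm v + norm w)" using s by (simp add: distrib_left)
    have n': "norm (s *\<^sub>R w + t *\<^sub>R v) < d" "norm (t *\<^sub>R v) < d" if "0 \<le> t" "t \<le> s" for t
      using n[OF that] sK vw by linarith+
    have gd: "(g has_real_derivative differential f (x + (s *\<^sub>R w + t *\<^sub>R v)) v - differential f (x + (0 + t *\<^sub>R v)) v) (at t)"
      if "0 \<le> t" "t \<le> s" for t
      unfolding g_def using that n' by (intro DERIV_diff line_deriv d(2)) auto
    from MVT2[OF s(1) gd] obtain t where t: "0 < t" "t < s" "g s - g 0 = (s - 0) * (differential f (x + (s *\<^sub>R w + t *\<^sub>R v)) v - differential f (x + (0 + t *\<^sub>R v)) v)"
      by blast
    have t': "0 \<le> t" "t \<le> s" using t by auto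
    have "g s - g 0 = f (x + s *\<^sub>R (v + w)) - f (x + s *\<^sub>R v) - f (x + s *\<^sub>R w) + f x"
      by (simp add: g_def algebra_simps)
    then have del: "f (x + s *\<^sub>R (v + w)) - f (x + s *\<^sub>R v) - f (x + s *\<^sub>R w) + f x
       = s * (differential f (x + (s *\<^sub>R w + t *\<^sub>R v)) v - differential f (x + t *\<^sub>R v) v)"
      using t(3) by simp
    have q: "(f (x + s *\<^sub>R (v + w)) - f (x + s *\<^sub>R v) - f (x + s *\<^sub>R w) + f x) / s\<^sup>2
       = (differential f (x + (s *\<^sub>R w + t *\<^sub>R v)) v - differential f (x + t *\<^sub>R v) v) / s"
      unfolding del using s by (simp add: power2_eq_square)
    have hl: "hessian f x v (s *\<^sub>R w + t *\<^sub>R v) - hessian f x v (t *\<^sub>R v) = s * hessian f x v w"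
      using lin by (simp add: linear_add linear_cmul)
    have "\<bar>differential f (x + (s *\<^sub>R w + t *\<^sub>R v)) v - differential f (x + t *\<^sub>R v) v - s * hessian f x v w\<bar>
       \<le> e' * norm (s *\<^sub>R w + t *\<^sub>R v) + e' * norm (t *\<^sub>R v)"
      using d(3)[OF n'(1)[OF t']] d(3)[OF n'(2)[OF t']] hl by linarith
    also have "\<dots> \<le> e' * (s * (norm v + norm w)) + e' * (s * norm v)"
      using n[OF t'] e' by (intro add_mono mult_left_mono) auto
    also have "\<dots> \<le> s * (e' * K)"
      using e' s by (simp add: K_def algebra_simps)
    also have "\<dots> = s * (e / 2)" using K by (simp add: e'_def)
    finally have "\<bar>differential f (x + (s *\<^sub>R w + t *\<^sub>R v)) v - differential f (x + t *\<^sub>R v) v - s * hessian f x v w\<bar> / s \<le> e / 2"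
      using s by (simp add: field_simps)
    moreover have "\<bar>differential f (x + (s *\<^sub>R w + t *\<^sub>R v)) v - differential f (x + t *\<^sub>R v) v - s * hessian f x v w\<bar> / s
       = \<bar>(differential f (x + (s *\<^sub>R w + t *\<^sub>R v)) v - differential f (x + t *\<^sub>R v) v) / s - hessian f x v w\<bar>"
      by (rule abs_diff_divide[OF s(1)])
    ultimately show ?thesis using q e by simp
  qed
  then show "\<forall>\<^sub>F s in at_right 0. dist ((f (x + s *\<^sub>R (v + w)) - f (x + s *\<^sub>R v) - f (x + s *\<^sub>R w) + f x) / s\<^sup>2) (hessian f x v w) < e"
    unfolding eventually_at_right_field dist_real_def using d(1) K by (intro exI[of _ "d / K"]) auto
qed

lemma hessian_commute: "hessian f x v w = hessian f x w v"
proof -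
  have "((\<lambda>s. (f (x + s *\<^sub>R (v + w)) - f (x + s *\<^sub>R v) - f (x + s *\<^sub>R w) + f x) / s\<^sup>2) \<longlongrightarrow> hessian f x w v) (at_right 0)"
    using second_difference_tendsto[of w v] by (simp add: algebra_simps)
  from tendsto_unique[OF _ second_difference_tendsto[of v w] this] show ?thesis by simp
qed

lemma second_order_tendsto:
  assumes "differential f x v = 0"
  shows "((\<lambda>s. (f (x + s *\<^sub>R v) - f x) / s\<^sup>2) \<longlongrightarrow> hessian f x v v / 2) (at_right 0)"
proof (rule tendstoI)
  fix e :: real assume e: "0 < e"
  define K where "K = norm v + 1"
  have K: "0 < K" by (simp add: K_def add_nonneg_pos)
  define e' where "e' = e / (2 * K)"
  have e': "0 < e'" using e K by (simp add: e'_def)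
  obtain d where d: "0 < d" "\<And>u. norm u < d \<Longrightarrow> x + u \<in> U"
    "\<And>u. norm u < d \<Longrightarrow> \<bar>differential f (x + u) v - differential f x v - hessian f x v u\<bar> \<le> e' * norm u"
    using hessian_estimate[OF e', of v] by blast
  have lin: "linear (hessian f x v)" using C2_hessian has_derivative_linear by blast
  have "\<bar>(f (x + s *\<^sub>R v) - f x) / s\<^sup>2 - hessian f x v v / 2\<bar> < e"
    if s: "0 < s" "s < d / K" for s
  proof -
    have sK: "s * norm v < d"
    proof -
      have "s * K < d" using s K by (simp add: field_simps)
      moreover have "s * norm v \<le> s * K" using s by (intro mult_left_mono) (auto simp: K_def)
      ultimately show ?thesis by linarith
    qed
    have n: "norm (t *\<^sub>R v) \<le> s * norm v" if "0 \<le> t" "t \<le> s" for t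
      using that by (simp add: mult_right_mono)
    define g where "g t = f (x + (0 + t *\<^sub>R v)) - t\<^sup>2 * (hessian f x v v / 2)" for t
    have gd: "(g has_real_derivative differential f (x + (0 + t *\<^sub>R v)) v - t * hessian f x v v) (at t)"
      if "0 \<le> t" "t \<le> s" for t
      unfolding g_def using that n[OF that] sK
      by (intro DERIV_diff line_deriv d(2)) (auto intro!: derivative_eq_intros)
    from MVT2[OF s(1) gd] obtain t where t: "0 < t" "t < s" "g s - g 0 = (s - 0) * (differential f (x + (0 + t *\<^sub>R v)) v - t * hessian f x v v)"
      by blast
    have tn: "norm (t *\<^sub>R v) \<le> s * norm v" using n[of t] t by auto
    have "\<bar>differential f (x + t *\<^sub>R v) v - t * hessian f x v v\<bar> \<le> e' * norm (t *\<^sub>R v)"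
      using d(3)[of "t *\<^sub>R v"] tn sK lin assms by (simp add: linear_cmul)
    also have "\<dots> \<le> e' * (s * norm v)" using tn e' by (intro mult_left_mono) auto
    also have "\<dots> \<le> s * (e' * K)" using e' s by (simp add: K_def algebra_simps)
    also have "\<dots> = s * (e / 2)" using K by (simp add: e'_def)
    finally have b: "\<bar>differential f (x + t *\<^sub>R v) v - t * hessian f x v v\<bar> \<le> s * (e / 2)" .
    have "f (x + s *\<^sub>R v) - f x - s\<^sup>2 * (hessian f x v v / 2) = s * (differential f (x + t *\<^sub>R v) v - t * hessian f x v v)"
      using t(3) by (simp add: g_def)
    then have "\<bar>f (x + s *\<^sub>R v) - f x - s\<^sup>2 * (hessian f x v v / 2)\<bar> \<le> s * (s * (e / 2))"
      using b s by (simp add: abs_mult)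
    then have "\<bar>f (x + s *\<^sub>R v) - f x - s\<^sup>2 * (hessian f x v v / 2)\<bar> / s\<^sup>2 \<le> e / 2"
      using s by (simp add: field_simps power2_eq_square)
    moreover have "\<bar>f (x + s *\<^sub>R v) - f x - s\<^sup>2 * (hessian f x v v / 2)\<bar> / s\<^sup>2 = \<bar>(f (x + s *\<^sub>R v) - f x) / s\<^sup>2 - hessian f x v v / 2\<bar>"
      by (rule abs_diff_divide) (use s in simp)
    ultimately show ?thesis using e by simp
  qed
  then show "\<forall>\<^sub>F s in at_right 0. dist ((f (x + s *\<^sub>R v) - f x) / s\<^sup>2) (hessian f x v v / 2) < e"
    unfolding eventually_at_right_field dist_real_def using d(1) K by (intro exI[of _ "d / K"]) auto
qed

end

section \<open>Jordan curves\<close>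

text \<open>The inside of c is connected and misses c', so it lies on one side of c'. Were it the
  outside, the open set inside c' would be contained in c, hence in the closure of the inside of c,
  which it does not meet. So each side of c lies in the corresponding side of c', and a point of c,
  in the closure of both sides of c, lies on c'.\<close>

lemma Jordan_curve_minimal:
  fixes c c' :: "real \<Rightarrow> complex"
  assumes c: "simple_path c" "pathfinish c = pathstart c"
    and c': "simple_path c'" "pathfinish c' = pathstart c'"
    and sub: "path_image c' \<subseteq> path_image c"
  shows "path_image c' = path_image c"
proof -
  let ?C = "path_image c" and ?C' = "path_image c'"
  note J = Jordan_inside_outside[OF c] and J' = Jordan_inside_outside[OF c']
  have out: "outside ?C \<subseteq> outside ?C'" using sub by (rule outside_mono)
  have cover: "inside ?C \<subseteq> inside ?C' \<union> outside ?C'"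
    using J' sub inside_no_overlap[of ?C] by blast
  have disj: "inside ?C' \<inter> outside ?C' = {}" using J' by simp
  have "inside ?C' \<inter> inside ?C = {} \<or> outside ?C' \<inter> inside ?C = {}"
  proof (rule connectedD)
    show "connected (inside ?C)" "open (inside ?C')" "open (outside ?C')" using J J' by simp_all
  qed (use cover disj in auto)
  moreover have False if dj: "inside ?C' \<inter> inside ?C = {}"
  proof -
    have "inside ?C \<union> outside ?C = - ?C" using J by simp
    then have "inside ?C' \<subseteq> ?C" using dj out disj by blast
    also have "?C \<subseteq> closure (inside ?C)" using J by (metis Diff_subset frontier_def)
    finally have "inside ?C' \<subseteq> closure (inside ?C)" .
    moreover have "inside ?C' \<inter> closure (inside ?C) = {}"
      using open_Int_closure_eq_empty[of "inside ?C'" "inside ?C"] J' dj by simp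
    moreover have "inside ?C' \<noteq> {}" using J' by simp
    ultimately show False by auto
  qed
  ultimately have "inside ?C \<subseteq> inside ?C'" using cover by blast
  then have "closure (inside ?C) \<subseteq> closure (inside ?C')" "closure (outside ?C) \<subseteq> closure (outside ?C')"
    using out by (auto intro!: closure_mono)
  moreover have "closure (inside ?C') = inside ?C' \<union> ?C'" "closure (outside ?C') = outside ?C' \<union> ?C'"
    using J' closure_Un_frontier[of "inside ?C'"] closure_Un_frontier[of "outside ?C'"] by simp_all
  moreover have "?C \<subseteq> closure (inside ?C)" "?C \<subseteq> closure (outside ?C)"
    using J by (metis Diff_subset frontier_def)+
  ultimately have "z \<in> inside ?C' \<union> ?C'" "z \<in> outside ?C' \<union> ?C'" if "z \<in> ?C" for z
    using that by (metis subsetD)+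
  then have "?C \<subseteq> ?C'" using disj by (metis Un_iff disjoint_iff subsetI)
  with sub show ?thesis by blast
qed

text \<open>Split off from \<open>triangular_flap\<close> so that the sides of a flap and the curve
  of critical values can be compared as Jordan curves.\<close>

definition arc_triangle :: "(real \<Rightarrow> 'a::topological_space) \<Rightarrow> (real \<Rightarrow> 'a) \<Rightarrow> (real \<Rightarrow> 'a) \<Rightarrow> 'a \<Rightarrow> 'a \<Rightarrow> 'a \<Rightarrow> bool" where
  "arc_triangle h e1 e2 p q c \<longleftrightarrow>
        arc h \<and> pathstart h = p \<and> pathfinish h = q \<and>
        arc e1 \<and> pathstart e1 = p \<and> pathfinish e1 = c \<and>
        arc e2 \<and> pathstart e2 = q \<and> pathfinish e2 = c \<and>
        path_image h \<inter> path_image e1 = {p} \<and>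
        path_image h \<inter> path_image e2 = {q} \<and>
        path_image e1 \<inter> path_image e2 = {c}"

lemma arc_triangle_loop:
  assumes "arc_triangle h e1 e2 p q c"
  defines "g \<equiv> (h +++ e2) +++ reversepath e1"
  shows "simple_path g" "pathfinish g = pathstart g"
    "path_image g = path_image h \<union> path_image e1 \<union> path_image e2"
proof -
  have a: "arc (h +++ e2)" using assms(1) by (auto simp: arc_triangle_def intro!: arc_join)
  have pim: "path_image (h +++ e2) = path_image h \<union> path_image e2"
    using assms(1) by (auto simp: arc_triangle_def path_image_join)
  show "simple_path g" unfolding g_def
    using assms(1) a by (intro simple_path_join_loop)
      (auto simp: arc_triangle_def arc_reversepath pim)
  show "pathfinish g = pathstart g" using assms(1) by (simp add: arc_triangle_def g_def)
  show "path_image g = path_image h \<union> path_image e1 \<union> path_image e2"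
    using assms(1) by (auto simp: arc_triangle_def g_def path_image_join)
qed

lemma arc_triangle_minimal:
  fixes p q c p' q' c' :: "real \<times> real"
  assumes t: "arc_triangle h e1 e2 p q c" and t': "arc_triangle h' e1' e2' p' q' c'"
    and sub: "path_image h' \<union> path_image e1' \<union> path_image e2' \<subseteq> path_image h \<union> path_image e1 \<union> path_image e2"
  shows "path_image h' \<union> path_image e1' \<union> path_image e2' = path_image h \<union> path_image e1 \<union> path_image e2"
proof -
  \<comment> \<open>\<open>Jordan_curve_minimal\<close> concerns paths in the complex plane; f is
    the identification with it.\<close>
  define f :: "real \<times> real \<Rightarrow> complex" where "f z = Complex (fst z) (snd z)" for z
  have f: "continuous_on S f" "inj f" for S
    by (auto simp: f_def[abs_def] complex_eq_iff prod_eq_iff Complex_eq intro!: injI continuous_intros)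
  have sp: "simple_path (f \<circ> g)" if "simple_path g" for g
    using that f by (meson inj_on_subset simple_path_continuous_image subset_UNIV)
  have "path_image (f \<circ> ((h' +++ e2') +++ reversepath e1')) = path_image (f \<circ> ((h +++ e2) +++ reversepath e1))"
    using sub arc_triangle_loop[OF t] arc_triangle_loop[OF t']
    by (intro Jordan_curve_minimal sp)
       (simp_all add: pathfinish_compose pathstart_compose path_image_compose image_mono)
  then show ?thesis
    using arc_triangle_loop[OF t] arc_triangle_loop[OF t'] f(2)
    by (simp only: path_image_compose inj_image_eq_iff)
qed

text \<open>The ray lies in the component of its origin, which is therefore unbounded.\<close>

lemma not_inside_ray:
  fixes x d :: "'a::real_normed_vector"
  assumes "d \<noteq> 0" and "\<And>s. 0 \<le> s \<Longrightarrow> x + s *\<^sub>R d \<notin> C"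
  shows "x \<notin> inside C"
proof
  assume x: "x \<in> inside C"
  define L where "L = (\<lambda>s. x + s *\<^sub>R d) ` {0..}"
  have "connected L" unfolding L_def
    by (intro connected_continuous_image continuous_intros) auto
  moreover have "x \<in> L" unfolding L_def by (rule image_eqI[of _ _ 0]) auto
  moreover have "L \<subseteq> - C" using assms(2) by (auto simp: L_def)
  ultimately have "L \<subseteq> connected_component_set (- C) x" by (intro connected_component_maximal)
  then have "bounded L" using x by (auto simp: inside_def intro: bounded_subset)
  then obtain B where B: "\<And>s. 0 \<le> s \<Longrightarrow> norm (x + s *\<^sub>R d) \<le> B"
    unfolding L_def bounded_iff by auto
  define s where "s = (\<bar>B\<bar> + norm x + 1) / norm d"
  have s: "0 \<le> s" "s * norm d = \<bar>B\<bar> + norm x + 1" using assms(1) by (auto simp: s_def)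
  have "norm (s *\<^sub>R d) \<le> norm (x + s *\<^sub>R d) + norm x"
    using norm_triangle_ineq4[of "x + s *\<^sub>R d" x] by simp
  then show False using B[of s] s by simp
qed

lemma arc_reparam:
  fixes g :: "real \<Rightarrow> 'a::topological_space"
  assumes "a \<noteq> b" "continuous_on (closed_segment a b) g" "inj_on g (closed_segment a b)"
  shows "arc (g \<circ> linepath a b)" "path_image (g \<circ> linepath a b) = g ` closed_segment a b"
    "pathstart (g \<circ> linepath a b) = g a" "pathfinish (g \<circ> linepath a b) = g b"
  using assms arc_linepath[of a b]
  by (auto simp: arc_def path_continuous_image path_image_compose pathstart_compose pathfinish_compose
      path_image_def[symmetric] intro: comp_inj_on)

section \<open>The curve of critical values\<close>

text \<open>After the affine change of H, the parameters \<gamma> and t enter only through \<kappa>.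
  The inequalities are what remains of their hypotheses and of that on \<delta>; see
  \<open>flap_data_kappa\<close>.\<close>

locale flap_data =
  fixes \<alpha> \<kappa> \<delta> :: real
  assumes alpha_pos: "0 < \<alpha>" and alpha_less: "\<alpha> < \<kappa>" and kappa_less: "2 * \<kappa> < \<alpha> * \<delta>"
begin

text \<open>Here s, r and j all vanish: the parameter represents B, which has no ratio r / s of its
  own.\<close>

definition xend :: real where "xend = \<kappa> / \<alpha>"
definition den :: "real \<Rightarrow> real" where "den x = \<delta> * x - x\<^sup>2 - 1"
definition sx :: "real \<Rightarrow> real" where "sx x = (\<kappa> - \<alpha> * x) / den x"
definition rx :: "real \<Rightarrow> real" where "rx x = x * sx x"
definition jx :: "real \<Rightarrow> real" where "jx x = sx x * sqrt (x\<^sup>2 - 1)"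
text \<open>The second derivative of the lower profile in r, at the critical point with parameter x.
  In terms of r, s and j it is given by \<open>psi_eq\<close>.\<close>

definition psi :: "real \<Rightarrow> real" where "psi x = 2 * x + (x\<^sup>2 - 1) * (\<alpha> - rx x) / sx x - \<delta>"

lemma xend: "1 < xend" "\<alpha> * xend = \<kappa>" "2 * xend < \<delta>" "2 < \<delta>"
proof -
  show "1 < xend" "\<alpha> * xend = \<kappa>" using alpha_pos alpha_less by (auto simp: xend_def)
  show "2 * xend < \<delta>" using alpha_pos kappa_less by (simp add: xend_def field_simps)
  then show "2 < \<delta>" using \<open>1 < xend\<close> by linarith
qed

lemma den_ge:
  assumes "1 \<le> x" "x \<le> xend" shows "\<delta> - 2 \<le> den x"
proof -
  have "0 \<le> (x - 1) * (\<delta> - 1 - x)" using assms xend by (intro mult_nonneg_nonneg) auto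
  then show ?thesis by (simp add: den_def algebra_simps power2_eq_square)
qed

lemma den_pos: "1 \<le> x \<Longrightarrow> x \<le> xend \<Longrightarrow> 0 < den x"
  using den_ge[of x] xend by linarith

lemma den_mono:
  assumes "1 \<le> x" "x < x'" "x' \<le> xend" shows "den x < den x'"
proof -
  have "0 < (x' - x) * (\<delta> - (x + x'))" using assms xend by (intro mult_pos_pos) auto
  then show ?thesis by (simp add: den_def algebra_simps power2_eq_square)
qed

lemma num_pos: "x < xend \<Longrightarrow> 0 < \<kappa> - \<alpha> * x"
  using xend(2) alpha_pos by (metis diff_gt_0_iff_gt mult_less_cancel_left_pos)

lemma num_nonneg: "x \<le> xend \<Longrightarrow> 0 \<le> \<kappa> - \<alpha> * x"
  using xend(2) alpha_pos by (metis diff_ge_0_iff_ge mult_le_cancel_left_pos)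

lemma sx_pos: "1 \<le> x \<Longrightarrow> x < xend \<Longrightarrow> 0 < sx x"
  using den_pos num_pos by (simp add: sx_def)

lemma sx_xend [simp]: "sx xend = 0"
  by (simp add: sx_def xend)

lemma sx_den: "1 \<le> x \<Longrightarrow> x \<le> xend \<Longrightarrow> sx x * den x = \<kappa> - \<alpha> * x"
  using den_pos[of x] by (simp add: sx_def)

lemma sx_antimono:
  assumes "1 \<le> x" "x < x'" "x' \<le> xend" shows "sx x' < sx x"
proof -
  have "(\<kappa> - \<alpha> * x') * den x < (\<kappa> - \<alpha> * x) * den x'"
  proof -
    have "(\<kappa> - \<alpha> * x') * den x \<le> (\<kappa> - \<alpha> * x') * den x'"
      using assms den_mono[of x x'] num_nonneg[of x'] by (intro mult_left_mono) auto
    also have "\<dots> < (\<kappa> - \<alpha> * x) * den x'"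
      using assms den_pos[of x'] alpha_pos by (intro mult_strict_right_mono) auto
    finally show ?thesis .
  qed
  then show ?thesis
    using den_pos[of x] den_pos[of x'] assms by (simp add: sx_def field_simps)
qed

lemma rx_antimono:
  assumes "1 \<le> x" "x < x'" "x' \<le> xend" shows "rx x' < rx x"
proof -
  \<comment> \<open>The cross-multiplied difference of the two fractions has the factor x' - x. The
    other factor is positive because x + x' \<le> x x' + 1, \<alpha> < \<kappa> and \<kappa> <
    \<alpha>\<delta> - \<kappa>.\<close>
  have "0 < (x' - x) * ((\<alpha> * \<delta> - \<kappa>) * (x * x') + \<kappa> - \<alpha> * (x + x'))"
  proof (intro mult_pos_pos)
    have "\<alpha> * (x + x') \<le> \<alpha> * (x * x' + 1)"
    proof -
      have "0 \<le> (x - 1) * (x' - 1)" using assms by simp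
      then have "x + x' \<le> x * x' + 1" by (simp add: algebra_simps)
      then show ?thesis using alpha_pos by simp
    qed
    also have "\<dots> < \<kappa> * (x * x' + 1)" using alpha_less assms
      by (intro mult_strict_right_mono) (auto intro!: add_nonneg_pos)
    also have "\<dots> \<le> (\<alpha> * \<delta> - \<kappa>) * (x * x') + \<kappa>"
    proof -
      have "\<kappa> * (x * x') \<le> (\<alpha> * \<delta> - \<kappa>) * (x * x')"
        using kappa_less assms by (intro mult_right_mono) auto
      then show ?thesis by (simp add: algebra_simps)
    qed
    finally show "0 < (\<alpha> * \<delta> - \<kappa>) * (x * x') + \<kappa> - \<alpha> * (x + x')" by simp
  qed (use assms in auto)
  also have "\<dots> = x * (\<kappa> - \<alpha> * x) * den x' - x' * (\<kappa> - \<alpha> * x') * den x"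
    by (simp add: den_def) algebra
  finally show ?thesis
    using den_pos[of x] den_pos[of x'] assms by (simp add: sx_def rx_def field_simps)
qed

lemma rx_less_alpha:
  assumes "1 \<le> x" "x \<le> xend" shows "rx x < \<alpha>"
proof -
  have "rx x \<le> rx 1" using rx_antimono[of 1 x] assms xend by (cases "x = 1") auto
  also have "rx 1 = (\<kappa> - \<alpha>) / (\<delta> - 2)" by (simp add: rx_def sx_def den_def)
  also have "\<dots> < \<alpha>" using xend alpha_less kappa_less by (simp add: field_simps)
  finally show ?thesis .
qed

text \<open>As x grows, r and s decrease, so every factor of the middle term of \<open>psi\<close>
  grows.\<close>

lemma psi_mono:
  assumes "1 \<le> x" "x < x'" "x' < xend" shows "psi x < psi x'"
proof -
  have s: "0 < sx x" "0 < sx x'" "sx x' < sx x" and r: "rx x' < rx x" "rx x < \<alpha>"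
    using sx_pos[of x] sx_pos[of x'] sx_antimono[of x x'] rx_antimono[of x x'] rx_less_alpha[of x] assms
    by auto
  have "(x\<^sup>2 - 1) * (\<alpha> - rx x) / sx x \<le> (x'\<^sup>2 - 1) * (\<alpha> - rx x') / sx x'"
    using s r assms one_le_power[of x 2] one_le_power[of x' 2] power_mono[of x x' 2]
    by (intro frac_le mult_mono mult_nonneg_nonneg) auto
  then show ?thesis using assms by (simp add: psi_def)
qed

text \<open>The polynomial \<open>psi x * (\<kappa> - \<alpha> * x)\<close>, which unlike \<^term>\<open>psi\<close> is continuous up to \<^term>\<open>xend\<close>.\<close>

definition Psi :: "real \<Rightarrow> real" where
  "Psi x = (3 * x - x ^ 3 - \<delta>) * (\<kappa> - \<alpha> * x) + \<alpha> * (x\<^sup>2 - 1) * den x"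

lemma Psi_psi:
  assumes "1 \<le> x" "x < xend" shows "Psi x = psi x * (\<kappa> - \<alpha> * x)"
proof -
  have "(\<alpha> - rx x) / sx x * (\<kappa> - \<alpha> * x) = \<alpha> * den x - x * (\<kappa> - \<alpha> * x)"
    using num_pos[of x] den_pos[of x] assms by (simp add: rx_def sx_def field_simps)
  then have "(x\<^sup>2 - 1) * ((\<alpha> - rx x) / sx x * (\<kappa> - \<alpha> * x)) = (x\<^sup>2 - 1) * (\<alpha> * den x - x * (\<kappa> - \<alpha> * x))"
    by simp
  then have "(x\<^sup>2 - 1) * (\<alpha> - rx x) / sx x * (\<kappa> - \<alpha> * x) = (x\<^sup>2 - 1) * (\<alpha> * den x - x * (\<kappa> - \<alpha> * x))"
    by simp
  then have "psi x * (\<kappa> - \<alpha> * x) = (2 * x - \<delta>) * (\<kappa> - \<alpha> * x) + (x\<^sup>2 - 1) * (\<alpha> * den x - x * (\<kappa> - \<alpha> * x))"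
    by (simp add: psi_def ring_distribs)
  then show ?thesis by (simp add: Psi_def algebra_simps power2_eq_square power3_eq_cube)
qed

lemma ex_xpar: "\<exists>x. 1 < x \<and> x < xend \<and> psi x = 0"
proof -
  have "Psi 1 < 0"
    using xend alpha_less by (simp add: Psi_def den_def mult_neg_pos)
  moreover have "0 < Psi xend"
    using xend alpha_pos den_pos[of xend] by (simp add: Psi_def)
  moreover have "continuous_on {1..xend} Psi"
    unfolding Psi_def den_def by (intro continuous_intros)
  ultimately obtain x where x: "1 \<le> x" "x \<le> xend" "Psi x = 0"
    using IVT'[of Psi 1 0 xend] xend by auto
  then have "x \<noteq> 1" "x \<noteq> xend" using \<open>Psi 1 < 0\<close> \<open>0 < Psi xend\<close> by auto
  with x have "1 < x" "x < xend" by auto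
  with x Psi_psi[of x] num_pos[of x] show ?thesis by auto
qed

definition xpar :: real where "xpar = (SOME x. 1 < x \<and> x < xend \<and> psi x = 0)"

lemma xpar: "1 < xpar" "xpar < xend" "psi xpar = 0"
  using someI_ex[OF ex_xpar] by (auto simp: xpar_def)

lemma psi_neg: "1 \<le> x \<Longrightarrow> x < xpar \<Longrightarrow> psi x < 0"
  using psi_mono[of x xpar] xpar by auto

lemma psi_pos: "xpar < x \<Longrightarrow> x < xend \<Longrightarrow> 0 < psi x"
  using psi_mono[of xpar x] xpar by auto

text \<open>The factor \<open>psi\<close> has a reason: differentiating the vanishing of the
  r-derivative of the profile along the curve expresses j' through r' times the second derivative.
  So j turns where the critical point degenerates. The proof itself is a direct computation.\<close>

lemma jx_deriv:
  assumes "1 < x" "x < xend"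
  shows "(jx has_real_derivative - (psi x * (\<kappa> - \<alpha> * x)) / ((den x)\<^sup>2 * sqrt (x\<^sup>2 - 1))) (at x)"
proof -
  have d: "den x \<noteq> 0" using den_pos[of x] assms by auto
  have "1 < x\<^sup>2" using assms by (simp add: one_less_power)
  then have q: "0 < x\<^sup>2 - 1" by simp
  define w where "w = sqrt (x\<^sup>2 - 1)"
  have w: "0 < w" "w\<^sup>2 = x\<^sup>2 - 1" using q by (auto simp: w_def)
  have dd: "(den has_real_derivative \<delta> - 2 * x) (at x)"
    unfolding den_def by (auto intro!: derivative_eq_intros)
  have "(jx has_real_derivative
      ((- \<alpha>) * den x - (\<kappa> - \<alpha> * x) * (\<delta> - 2 * x)) / (den x * den x) * sqrt (x\<^sup>2 - 1)
      + (2 * x * (inverse (sqrt (x\<^sup>2 - 1)) / 2)) * ((\<kappa> - \<alpha> * x) / den x)) (at x)"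
    unfolding jx_def sx_def
    using d q by (auto intro!: derivative_eq_intros dd simp: field_simps)
  moreover have "((- \<alpha>) * den x - (\<kappa> - \<alpha> * x) * (\<delta> - 2 * x)) / (den x * den x) * w
      + (2 * x * (inverse w / 2)) * ((\<kappa> - \<alpha> * x) / den x)
      = - Psi x / ((den x)\<^sup>2 * w)"
  proof -
    have "((- \<alpha>) * den x - (\<kappa> - \<alpha> * x) * (\<delta> - 2 * x)) / (den x * den x) * w
      + (2 * x * (inverse w / 2)) * ((\<kappa> - \<alpha> * x) / den x)
      = (((- \<alpha>) * den x - (\<kappa> - \<alpha> * x) * (\<delta> - 2 * x)) * w\<^sup>2 + x * (\<kappa> - \<alpha> * x) * den x) / ((den x)\<^sup>2 * w)"
      using d w(1) by (simp add: field_simps power2_eq_square)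
    also have "((- \<alpha>) * den x - (\<kappa> - \<alpha> * x) * (\<delta> - 2 * x)) * w\<^sup>2 + x * (\<kappa> - \<alpha> * x) * den x = - Psi x"
      unfolding w(2) Psi_def den_def by algebra
    finally show ?thesis .
  qed
  ultimately show ?thesis using Psi_psi[of x] assms by (simp add: w_def)
qed

lemma sx_continuous: "continuous_on {1..xend} sx"
  unfolding sx_def using den_pos by (intro continuous_intros) (force simp: den_def intro!: continuous_intros)+

lemma jx_continuous: "continuous_on {1..xend} jx"
  unfolding jx_def by (intro continuous_intros sx_continuous)

lemma jx_incr:
  assumes "1 \<le> x" "x < x'" "x' \<le> xpar" shows "jx x < jx x'"
proof (rule DERIV_pos_imp_increasing_open[OF assms(2)])
  fix z assume z: "x < z" "z < x'"
  then have z1: "1 < z" "z < xend" "z < xpar" using assms xpar by auto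
  then have "1 < z\<^sup>2" by (simp add: one_less_power)
  then have "0 < - (psi z * (\<kappa> - \<alpha> * z)) / ((den z)\<^sup>2 * sqrt (z\<^sup>2 - 1))"
    using z1 psi_neg[of z] num_pos[of z] den_pos[of z]
    by (intro divide_pos_pos mult_pos_pos) (auto simp: mult_neg_pos)
  then show "\<exists>y. (jx has_real_derivative y) (at z) \<and> 0 < y" using jx_deriv[of z] z1 by blast
next
  show "continuous_on {x..x'} jx" using jx_continuous assms xpar by (auto intro: continuous_on_subset)
qed

lemma jx_decr:
  assumes "xpar \<le> x" "x < x'" "x' \<le> xend" shows "jx x' < jx x"
proof -
  have "- jx x < - jx x'"
  proof (rule DERIV_pos_imp_increasing_open[OF assms(2)])
    fix z assume z: "x < z" "z < x'"
    then have z1: "1 < z" "z < xend" "xpar < z" using assms xpar by auto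
    then have "1 < z\<^sup>2" by (simp add: one_less_power)
    then have "0 < (psi z * (\<kappa> - \<alpha> * z)) / ((den z)\<^sup>2 * sqrt (z\<^sup>2 - 1))"
      using z1 psi_pos[of z] num_pos[of z] den_pos[of z]
      by (intro divide_pos_pos mult_pos_pos) auto
    moreover have "((\<lambda>x. - jx x) has_real_derivative (psi z * (\<kappa> - \<alpha> * z)) / ((den z)\<^sup>2 * sqrt (z\<^sup>2 - 1))) (at z)"
      using DERIV_minus[OF jx_deriv[of z]] z1 by simp
    ultimately show "\<exists>y. ((\<lambda>x. - jx x) has_real_derivative y) (at z) \<and> 0 < y" by blast
  next
    show "continuous_on {x..x'} (\<lambda>x. - jx x)" using jx_continuous assms xpar
      by (auto intro!: continuous_intros intro: continuous_on_subset)
  qed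
  then show ?thesis by simp
qed

definition prof :: "real \<Rightarrow> real \<Rightarrow> real" where
  "prof j r = \<kappa> * r - (\<alpha> - r) * sqrt (r\<^sup>2 - j\<^sup>2) - \<delta> * r\<^sup>2 / 2"

lemma prof_deriv:
  assumes "\<bar>j\<bar> < r"
  shows "(prof j has_real_derivative
    (\<kappa> - (\<alpha> - r) * r / sqrt (r\<^sup>2 - j\<^sup>2) + sqrt (r\<^sup>2 - j\<^sup>2) - \<delta> * r)) (at r)"
proof -
  have "j\<^sup>2 < r\<^sup>2" using assms by (metis abs_ge_zero abs_less_iff power2_abs power_strict_mono pos2)
  then show ?thesis unfolding prof_def
    by (auto intro!: derivative_eq_intros simp: field_simps)
qed

text \<open>For \<open>r\<close> between the two critical points, the point \<open>r / s\<close> lies where \<^term>\<open>jx\<close> exceeds \<open>j\<close>, so the derivative of the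
  profile is positive there.\<close>

lemma prof_less:
  assumes "1 \<le> x" "x < x'" "x' < xend" "jx x = jx x'" "0 < jx x"
  shows "prof (jx x) (rx x') < prof (jx x) (rx x)"
proof -
  define j where "j = jx x"
  have sq: "(rx z)\<^sup>2 - (jx z)\<^sup>2 = (sx z)\<^sup>2" if "1 \<le> z" for z
    using that one_le_power[of z 2] by (simp add: rx_def jx_def power_mult_distrib algebra_simps)
  have up: "j < jx z" if z: "x < z" "z < x'" for z
  proof (cases "z \<le> xpar")
    case True then show ?thesis using jx_incr[of x z] z assms by (simp add: j_def)
  next
    case False then show ?thesis using jx_decr[of z x'] z assms by (simp add: j_def)
  qed
  have jr: "\<bar>j\<bar> < rx x'"
  proof -
    have "0 < sx x'" using sx_pos assms by auto
    then have "j\<^sup>2 < (rx x')\<^sup>2" using sq[of x'] assms by (smt (verit) j_def zero_less_power2)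
    moreover have "0 \<le> rx x'" using \<open>0 < sx x'\<close> assms by (simp add: rx_def)
    ultimately show ?thesis using abs_le_square_iff[of "rx x'" j] by linarith
  qed
  have rr: "rx x' < rx x" using rx_antimono[of x x'] assms by auto
  show ?thesis unfolding j_def[symmetric]
  proof (rule DERIV_pos_imp_increasing_open[OF rr])
    fix r assume r: "rx x' < r" "r < rx x"
    then have jlr: "\<bar>j\<bar> < r" using jr by linarith
    define s where "s = sqrt (r\<^sup>2 - j\<^sup>2)"
    have jr2: "j\<^sup>2 < r\<^sup>2" using jlr by (metis abs_ge_zero power2_abs power_strict_mono pos2)
    then have s: "0 < s" "s\<^sup>2 = r\<^sup>2 - j\<^sup>2" by (auto simp: s_def)
    have j0: "0 < j" using assms by (simp add: j_def)
    define z where "z = r / s"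
    have z1: "s\<^sup>2 * (z\<^sup>2 - 1) = j\<^sup>2"
    proof -
      have "s\<^sup>2 * (z\<^sup>2 - 1) = r\<^sup>2 - s\<^sup>2" using s(1) by (simp add: z_def power_divide algebra_simps)
      then show ?thesis using s(2) by simp
    qed
    have ratio: "rx w / sx w = w" if "1 \<le> w" "w < xend" for w
      using sx_pos[of w] that by (simp add: rx_def)
    \<comment> \<open>At fixed j the ratio r / sqrt(r^2 - j^2) decreases in r; comparing squares
      avoids the quotients. The bound \<open>zx\<close> below is the same at the other end.\<close>
    have xz: "x < z"
    proof -
      have "(r * sx x)\<^sup>2 > (rx x * s)\<^sup>2"
      proof -
        have "(r * sx x)\<^sup>2 - (rx x * s)\<^sup>2 = j\<^sup>2 * ((rx x)\<^sup>2 - r\<^sup>2)"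
        proof -
          have "(rx x)\<^sup>2 - j\<^sup>2 = (sx x)\<^sup>2" using sq[of x] assms by (simp add: j_def)
          then show ?thesis using s(2) by algebra
        qed
        moreover have "r\<^sup>2 < (rx x)\<^sup>2" using r jlr by (intro power_strict_mono) auto
        ultimately show ?thesis using j0 by (smt (verit) mult_pos_pos zero_less_power)
      qed
      moreover have "0 \<le> r * sx x" using jlr sx_pos[of x] assms by auto
      ultimately have "rx x * s < r * sx x" by (meson power_less_imp_less_base)
      then have "rx x / sx x < z" using s sx_pos[of x] assms by (simp add: z_def field_simps)
      then show ?thesis using ratio[of x] assms by auto
    qed
    have zx: "z < x'"
    proof -
      have "(r * sx x')\<^sup>2 < (rx x' * s)\<^sup>2"
      proof -
        have "(r * sx x')\<^sup>2 - (rx x' * s)\<^sup>2 = j\<^sup>2 * ((rx x')\<^sup>2 - r\<^sup>2)"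
        proof -
          have "(rx x')\<^sup>2 - j\<^sup>2 = (sx x')\<^sup>2" using sq[of x'] assms by (simp add: j_def)
          then show ?thesis using s(2) by algebra
        qed
        moreover have "(rx x')\<^sup>2 < r\<^sup>2" using r jr by (intro power_strict_mono) auto
        ultimately show ?thesis using j0 by (smt (verit) mult_pos_neg zero_less_power)
      qed
      moreover have "0 \<le> rx x' * s" using jr s by auto
      ultimately have "r * sx x' < rx x' * s" by (meson power_less_imp_less_base)
      then have "z < rx x' / sx x'" using s sx_pos[of x'] assms by (simp add: z_def field_simps)
      then show ?thesis using ratio[of x'] assms by auto
    qed
    have z: "1 < z" "z < xend" using xz zx assms by auto
    have "1 < z\<^sup>2" using z by (simp add: one_less_power)
    \<comment> \<open>The points (z s, s) and (z \<open>sx z\<close>, \<open>sx z\<close>) have the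
      same ratio z. Multiplied by sqrt(z^2 - 1), their second entries give j and the larger number
      \<open>jx z\<close>.\<close>
    have "s < sx z"
    proof -
      have "s * sqrt (z\<^sup>2 - 1) = j"
      proof -
        have "s * sqrt (z\<^sup>2 - 1) = sqrt (s\<^sup>2 * (z\<^sup>2 - 1))" using s(1) by (simp add: real_sqrt_mult)
        then show ?thesis using z1 j0 by simp
      qed
      also have "\<dots> < sx z * sqrt (z\<^sup>2 - 1)" using up[OF xz zx] by (simp add: jx_def)
      finally show ?thesis using \<open>1 < z\<^sup>2\<close> by simp
    qed
    then have "s * den z < \<kappa> - \<alpha> * z"
      using sx_den[of z] den_pos[of z] z by (metis less_eq_real_def mult_strict_right_mono)
    moreover have "\<kappa> - (\<alpha> - r) * r / s + s - \<delta> * r = \<kappa> - \<alpha> * z - s * den z"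
      using s(1) by (simp add: z_def den_def field_simps power2_eq_square)
    ultimately have "0 < \<kappa> - (\<alpha> - r) * r / s + s - \<delta> * r" by simp
    then show "\<exists>y. (prof j has_real_derivative y) (at r) \<and> 0 < y"
      using prof_deriv[OF jlr] unfolding s_def by blast
  next
    have "isCont (prof j) r" if "rx x' \<le> r" for r
      using prof_deriv[of j r] that jr by (intro DERIV_isCont) auto
    then show "continuous_on {rx x'..rx x} (prof j)"
      by (auto intro!: continuous_at_imp_continuous_on)
  qed
qed

lemma crit_param:
  assumes s: "0 < s" "s\<^sup>2 = r\<^sup>2 - j\<^sup>2" and r: "0 < r" "r < \<alpha>"
    and crit: "\<kappa> * s = (\<alpha> - r) * r - s\<^sup>2 + \<delta> * r * s"
  shows "1 \<le> r / s" "r / s < xend" "sx (r / s) = s"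
proof -
  define x where "x = r / s"
  have rxs: "r = x * s" using s by (simp add: x_def)
  have "s\<^sup>2 \<le> r\<^sup>2" using s by simp
  then have "s \<le> r" using r by (simp add: abs_le_square_iff[symmetric] s(1) less_imp_le)
  then show x1: "1 \<le> r / s" using s by simp
  have eq: "s * den x = \<kappa> - \<alpha> * x"
  proof -
    have "s * (s * den x) = s * (\<kappa> - \<alpha> * x)"
      using crit unfolding rxs den_def by algebra
    then show ?thesis using s by simp
  qed
  \<comment> \<open>Beyond \<open>xend\<close> the equation \<open>eq\<close> could still hold with
    both sides nonpositive. There r < \<alpha> would give (\<alpha>\<delta> - \<kappa>) x \<le>
    \<alpha>, although \<alpha>\<delta> - \<kappa> > \<kappa> > \<alpha> and x \<ge> 1.\<close>
  show xl: "r / s < xend"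
  proof (rule ccontr)
    assume "\<not> ?thesis"
    then have xx: "xend \<le> x" by (simp add: x_def)
    have "\<kappa> \<le> \<alpha> * x" using xx xend(2) alpha_pos by (metis less_le mult_le_cancel_left_pos)
    then have "s * den x \<le> 0" using eq by simp
    then have dn: "den x \<le> 0" using s by (simp add: mult_le_0_iff)
    have "x * (\<alpha> * x - \<kappa>) = r * (- den x)" using eq rxs by algebra
    also have "\<dots> \<le> \<alpha> * (- den x)" using dn r by (intro mult_right_mono) auto
    finally have "(\<alpha> * \<delta> - \<kappa>) * x \<le> \<alpha>" by (simp add: den_def algebra_simps power2_eq_square)
    moreover have "\<kappa> * 1 \<le> (\<alpha> * \<delta> - \<kappa>) * x"
      using kappa_less alpha_less alpha_pos x1 by (intro mult_mono) (auto simp: x_def)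
    ultimately show False using alpha_less by simp
  qed
  show "sx (r / s) = s" using eq den_pos[of x] x1 xl by (simp add: sx_def x_def[symmetric] field_simps)
qed

text \<open>In the critical equation write den x = (\<delta> - 2) x - (x - 1)^2. Dropping (\<delta>
  - 2) s (x - y) \<ge> 0 and using s < \<alpha>/x bounds the left side by \<alpha>/x, and s <
  \<alpha>/x also makes the right side at least \<alpha>/x.\<close>

lemma jx_bound_aux:
  assumes x: "1 \<le> x" "x < xend"
  shows "(\<delta> - 2) * jx x - (\<kappa> - 2 * \<alpha>) \<le> sqrt (\<alpha>\<^sup>2 - (jx x)\<^sup>2)" and "0 \<le> jx x" "jx x < \<alpha>"
proof -
  define s j y where "s = sx x" and "j = jx x" and "y = sqrt (x\<^sup>2 - 1)"
  have x2: "1 \<le> x\<^sup>2" using x by simp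
  have y: "0 \<le> y" "y\<^sup>2 = x\<^sup>2 - 1" using x2 by (auto simp: y_def)
  have yx: "y < x" using y x by (smt (verit) power_mono)
  have s: "0 < s" using sx_pos x by (simp add: s_def)
  have j: "j = s * y" by (simp add: j_def s_def y_def jx_def)
  have sr: "s * x < \<alpha>" using rx_less_alpha[of x] x by (simp add: rx_def s_def mult.commute)
  show "0 \<le> jx x" using j s y by (simp add: j_def)
  have jr: "j \<le> s * x" using j s yx by simp
  then show "jx x < \<alpha>" using sr by (simp add: j_def)
  have crit: "\<kappa> = \<alpha> * x + s * den x" using sx_den[of x] x by (simp add: s_def)
  \<comment> \<open>This is \<open>r < \<alpha>\<close> in the form \<open>j / \<alpha> < y / x\<close>.\<close>
  have E: "\<alpha> / x \<le> sqrt (\<alpha>\<^sup>2 - j\<^sup>2)"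
  proof (rule real_le_rsqrt)
    have "(s * x)\<^sup>2 \<le> \<alpha>\<^sup>2" using sr s x by (intro power_mono) auto
    then have "(s * x)\<^sup>2 * y\<^sup>2 \<le> \<alpha>\<^sup>2 * (x\<^sup>2 - 1)" unfolding y using x2 by (intro mult_right_mono) auto
    then show "(\<alpha> / x)\<^sup>2 \<le> \<alpha>\<^sup>2 - j\<^sup>2" using x by (simp add: j field_simps power_mult_distrib)
  qed
  have "s * (x - 1)\<^sup>2 \<le> \<alpha> / x * (x - 1)\<^sup>2"
    using sr x by (intro mult_right_mono) (auto simp: field_simps)
  moreover have "0 \<le> (\<delta> - 2) * (s * (x - y))" using xend s yx by simp
  moreover have "\<alpha> / x * (x - 1)\<^sup>2 = \<alpha> * x - 2 * \<alpha> + \<alpha> / x"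
    using x by (simp add: field_simps power2_eq_square)
  ultimately have "(\<delta> - 2) * j - (\<kappa> - 2 * \<alpha>) \<le> \<alpha> / x"
    unfolding crit j den_def by (simp add: algebra_simps power2_eq_square)
  then show "(\<delta> - 2) * jx x - (\<kappa> - 2 * \<alpha>) \<le> sqrt (\<alpha>\<^sup>2 - (jx x)\<^sup>2)"
    using E by (simp add: j_def)
qed

text \<open>The larger root j of ((\<delta> - 2) j - (\<kappa> - 2\<alpha>))^2 + j^2 = \<alpha>^2,
  which is the equality case of \<open>jx_bound_aux\<close> after squaring. In the original
  parameters it is j_t (\<open>j_bound_jbd\<close>).\<close>

definition jbd :: real where
  "jbd = ((\<delta> - 2) * (\<kappa> - 2 * \<alpha>) + sqrt (\<alpha>\<^sup>2 * ((\<delta> - 2)\<^sup>2 + 1) - (\<kappa> - 2 * \<alpha>)\<^sup>2)) / ((\<delta> - 2)\<^sup>2 + 1)"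

text \<open>Both parts follow from -\<alpha> < b < \<alpha> m. The first makes the roots real; the
  second places b/m below the larger root and makes that root increase with \<kappa>.\<close>

lemma beta_bound:
  defines "m \<equiv> \<delta> - 2" and "b \<equiv> \<kappa> - 2 * \<alpha>"
  shows "0 < \<alpha>\<^sup>2 * (m\<^sup>2 + 1) - b\<^sup>2" "b \<le> m * sqrt (\<alpha>\<^sup>2 * (m\<^sup>2 + 1) - b\<^sup>2)"
proof -
  have m: "0 < m" using xend by (simp add: m_def)
  have b: "- \<alpha> < b" "b < \<alpha> * m"
    using alpha_less kappa_less alpha_pos xend(4) by (auto simp: b_def m_def algebra_simps)
  have am: "0 < \<alpha> * m" using alpha_pos m by simp
  show A: "0 < \<alpha>\<^sup>2 * (m\<^sup>2 + 1) - b\<^sup>2"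
  proof (cases "0 \<le> b")
    case True
    then have "b\<^sup>2 < (\<alpha> * m)\<^sup>2" using b by (intro power_strict_mono) auto
    then show ?thesis by (simp add: algebra_simps power_mult_distrib) (smt (verit) zero_le_power2)
  next
    case False
    then have "(- b)\<^sup>2 < \<alpha>\<^sup>2" using b by (intro power_strict_mono) auto
    then show ?thesis by (simp add: algebra_simps) (smt (verit) mult_nonneg_nonneg zero_le_power2)
  qed
  show "b \<le> m * sqrt (\<alpha>\<^sup>2 * (m\<^sup>2 + 1) - b\<^sup>2)"
  proof (cases "0 \<le> b")
    case True
    then have "b\<^sup>2 \<le> (\<alpha> * m)\<^sup>2" using b by (intro power_mono) auto
    then have "b\<^sup>2 * (m\<^sup>2 + 1) \<le> (\<alpha> * m)\<^sup>2 * (m\<^sup>2 + 1)" by (intro mult_right_mono) auto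
    then have "b\<^sup>2 \<le> m\<^sup>2 * (\<alpha>\<^sup>2 * (m\<^sup>2 + 1) - b\<^sup>2)" by (simp add: algebra_simps power_mult_distrib)
    then have "b \<le> sqrt (m\<^sup>2 * (\<alpha>\<^sup>2 * (m\<^sup>2 + 1) - b\<^sup>2))" by (rule real_le_rsqrt)
    then show ?thesis using m by (simp add: real_sqrt_mult)
  next
    case False
    then show ?thesis using m A by (smt (verit) mult_nonneg_nonneg real_sqrt_ge_zero)
  qed
qed

lemma le_jbd:
  assumes "(\<delta> - 2) * j - (\<kappa> - 2 * \<alpha>) \<le> sqrt (\<alpha>\<^sup>2 - j\<^sup>2)" and "0 \<le> j" "j < \<alpha>"
  shows "j \<le> jbd"
proof -
  define m b A where "m = \<delta> - 2" and "b = \<kappa> - 2 * \<alpha>" and "A = \<alpha>\<^sup>2 * (m\<^sup>2 + 1) - b\<^sup>2"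
  have m: "0 < m" using xend by (simp add: m_def)
  have A: "0 < A" "b \<le> m * sqrt A" using beta_bound by (simp_all add: A_def m_def b_def)
  have "(m\<^sup>2 + 1) * j \<le> m * b + sqrt A"
  \<comment> \<open>Squaring the hypothesis is legitimate only if m j \<ge> b; otherwise j < b/m,
    which is at most the larger root.\<close>
  proof (cases "0 \<le> m * j - b")
    case True
    have "j\<^sup>2 \<le> \<alpha>\<^sup>2" using assms by (intro power_mono) auto
    then have "(m * j - b)\<^sup>2 \<le> \<alpha>\<^sup>2 - j\<^sup>2"
      using assms(1) True power_mono[of "m * j - b" "sqrt (\<alpha>\<^sup>2 - j\<^sup>2)" 2] by (simp add: m_def b_def)
    then have "(m\<^sup>2 + 1) * ((m * j - b)\<^sup>2 + j\<^sup>2) \<le> (m\<^sup>2 + 1) * \<alpha>\<^sup>2"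
      by (intro mult_left_mono) auto
    moreover have "(m\<^sup>2 + 1) * ((m * j - b)\<^sup>2 + j\<^sup>2) = ((m\<^sup>2 + 1) * j - m * b)\<^sup>2 + b\<^sup>2" by algebra
    ultimately have "((m\<^sup>2 + 1) * j - m * b)\<^sup>2 \<le> A" by (simp add: A_def mult.commute)
    then have "(m\<^sup>2 + 1) * j - m * b \<le> sqrt A" by (rule real_le_rsqrt)
    then show ?thesis by simp
  next
    case False
    then have "j \<le> b / m" using m by (simp add: field_simps)
    then have "(m\<^sup>2 + 1) * j \<le> (m\<^sup>2 + 1) * (b / m)" by (intro mult_left_mono) auto
    also have "\<dots> = m * b + b / m" using m by (simp add: field_simps power2_eq_square)
    also have "\<dots> \<le> m * b + sqrt A" using A m by (simp add: field_simps)
    finally show ?thesis .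
  qed
  moreover have "0 < m\<^sup>2 + 1" by (simp add: add_nonneg_pos)
  ultimately show ?thesis unfolding jbd_def m_def[symmetric] b_def[symmetric] A_def[symmetric]
    by (simp add: field_simps)
qed

end

text \<open>The function b \<mapsto> m b + sqrt(a - b^2) has derivative m - b / sqrt(a - b^2), which
  is nonnegative by \<open>beta_bound\<close>. The proof is the finite-difference form of
  this.\<close>

lemma jbd_mono:
  assumes "flap_data \<alpha> \<kappa> \<delta>" "flap_data \<alpha> \<kappa>' \<delta>" "\<kappa> \<le> \<kappa>'"
  shows "flap_data.jbd \<alpha> \<kappa> \<delta> \<le> flap_data.jbd \<alpha> \<kappa>' \<delta>"
proof -
  interpret A: flap_data \<alpha> \<kappa> \<delta> by fact
  interpret B: flap_data \<alpha> \<kappa>' \<delta> by fact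
  define m b b' where "m = \<delta> - 2" and "b = \<kappa> - 2 * \<alpha>" and "b' = \<kappa>' - 2 * \<alpha>"
  define u v where "u = sqrt (\<alpha>\<^sup>2 * (m\<^sup>2 + 1) - b\<^sup>2)" and "v = sqrt (\<alpha>\<^sup>2 * (m\<^sup>2 + 1) - b'\<^sup>2)"
  have u: "0 < u" "u\<^sup>2 = \<alpha>\<^sup>2 * (m\<^sup>2 + 1) - b\<^sup>2" "b \<le> m * u"
    using A.beta_bound by (simp_all add: u_def m_def b_def)
  have v: "0 < v" "v\<^sup>2 = \<alpha>\<^sup>2 * (m\<^sup>2 + 1) - b'\<^sup>2" "b' \<le> m * v"
    using B.beta_bound by (simp_all add: v_def m_def b'_def)
  have "(u - v) * (u + v) = (b' - b) * (b + b')" using u(2) v(2) by algebra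
  also have "\<dots> \<le> (b' - b) * (m * (u + v))"
    using u v assms by (intro mult_left_mono) (auto simp: b_def b'_def algebra_simps)
  also have "\<dots> = (m * (b' - b)) * (u + v)" by simp
  finally have "u - v \<le> m * (b' - b)" using u v by (metis add_pos_pos mult_le_cancel_right_pos)
  then have "m * b + u \<le> m * b' + v" by (simp add: algebra_simps)
  then show ?thesis unfolding A.jbd_def B.jbd_def
    by (simp add: u_def v_def m_def b_def b'_def divide_right_mono)
qed

context flap_data
begin

text \<open>The signed parameter \<open>y = j / s\<close>, with \<open>x\<^sup>2 - y\<^sup>2 = 1\<close>, covers both signs of \<open>j\<close> and passes through \<open>j = 0\<close>.\<close>

definition xq :: "real \<Rightarrow> real" where "xq y = sqrt (1 + y\<^sup>2)"
definition sy :: "real \<Rightarrow> real" where "sy y = sx (xq y)"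
definition ry :: "real \<Rightarrow> real" where "ry y = xq y * sy y"
definition jy :: "real \<Rightarrow> real" where "jy y = y * sy y"
definition hy :: "real \<Rightarrow> real" where
  "hy y = \<kappa> * ry y - (\<alpha> - ry y) * sy y - \<delta> * (ry y)\<^sup>2 / 2"
definition yend :: real where "yend = sqrt (xend\<^sup>2 - 1)"
definition ypar :: real where "ypar = sqrt (xpar\<^sup>2 - 1)"

lemma xq_sq: "(xq y)\<^sup>2 = 1 + y\<^sup>2" by (simp add: xq_def)
lemma xq_ge: "1 \<le> xq y" by (simp add: xq_def)
lemma xq_minus [simp]: "xq (- y) = xq y" by (simp add: xq_def)
lemma xq_gt: "\<bar>y\<bar> < xq y" using xq_sq[of y] by (metis real_sqrt_abs real_sqrt_less_iff less_add_one add.commute xq_def)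

lemma xq_less: "xq y < xq y' \<longleftrightarrow> \<bar>y\<bar> < \<bar>y'\<bar>"
  by (simp add: xq_def flip: abs_square_less_1) (metis abs_ge_zero power2_abs power_less_imp_less_base power_strict_mono zero_less_numeral)

lemma xq_le: "xq y \<le> xq y' \<longleftrightarrow> \<bar>y\<bar> \<le> \<bar>y'\<bar>"
  using xq_less[of y' y] by linarith

lemma xq_yend: "xq yend = xend"
  using xend one_le_power[of xend 2] by (simp add: xq_def yend_def)

lemma xq_ypar: "xq ypar = xpar"
  using xpar one_le_power[of xpar 2] by (simp add: xq_def ypar_def)

lemma ypar: "0 < ypar" "ypar < yend"
proof -
  show "0 < ypar" using xpar one_less_power[of xpar 2] by (simp add: ypar_def)
  have "0 \<le> yend" using one_le_power[of xend 2] xend by (simp add: yend_def)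
  then show "ypar < yend" using xq_less[of ypar yend] xpar \<open>0 < ypar\<close>
    by (simp add: xq_yend xq_ypar)
qed

lemma xq_less_xend: "\<bar>y\<bar> < yend \<Longrightarrow> xq y < xend"
  using xq_less[of y yend] ypar by (simp add: xq_yend)

lemma xq_le_xend: "\<bar>y\<bar> \<le> yend \<Longrightarrow> xq y \<le> xend"
  using xq_le[of y yend] ypar by (simp add: xq_yend)

lemma sy_pos: "\<bar>y\<bar> < yend \<Longrightarrow> 0 < sy y"
  using sx_pos xq_ge xq_less_xend by (simp add: sy_def)

lemma sy_yend [simp]: "sy yend = 0" "sy (- yend) = 0"
  by (simp_all add: sy_def xq_yend)

lemma parity [simp]: "sy (- y) = sy y" "ry (- y) = ry y" "jy (- y) = - jy y" "hy (- y) = hy y"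
  by (simp_all add: sy_def ry_def jy_def hy_def)

lemma ry_rx: "ry y = rx (xq y)" by (simp add: ry_def rx_def sy_def)

lemma jy_jx: "0 \<le> y \<Longrightarrow> jy y = jx (xq y)"
  by (simp add: jy_def jx_def sy_def xq_sq)

lemma sy_sq: "(sy y)\<^sup>2 = (ry y)\<^sup>2 - (jy y)\<^sup>2"
  by (simp add: ry_def jy_def power_mult_distrib xq_sq algebra_simps)

lemma ry_bounds: "\<bar>y\<bar> < yend \<Longrightarrow> 0 < ry y \<and> ry y < \<alpha> \<and> \<bar>jy y\<bar> < ry y"
  using sy_pos[of y] xq_gt[of y] rx_less_alpha[OF xq_ge xq_le_xend[of y]]
  by (auto simp: ry_rx[symmetric]) (auto simp: ry_def jy_def abs_mult)

lemma sy_crit: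
  assumes "\<bar>y\<bar> < yend"
  shows "\<kappa> * sy y = (\<alpha> - ry y) * ry y - (sy y)\<^sup>2 + \<delta> * ry y * sy y"
proof -
  have "sy y * den (xq y) = \<kappa> - \<alpha> * xq y"
    using sx_den[OF xq_ge xq_le_xend] assms by (simp add: sy_def)
  then show ?thesis unfolding den_def ry_def by algebra
qed

lemma psi_eq:
  assumes "\<bar>y\<bar> < yend"
  shows "psi (xq y) = 2 * ry y / sy y + (\<alpha> - ry y) * (jy y)\<^sup>2 / sy y ^ 3 - \<delta>"
  using sy_pos[OF assms]
  by (simp add: psi_def xq_sq ry_rx[symmetric] sy_def[symmetric])
     (simp add: ry_def jy_def field_simps power2_eq_square power3_eq_cube)

lemma psi_xq:
  assumes "\<bar>y\<bar> < yend"
  shows "psi (xq y) < 0 \<longleftrightarrow> \<bar>y\<bar> < ypar" "0 < psi (xq y) \<longleftrightarrow> ypar < \<bar>y\<bar>" "psi (xq y) = 0 \<longleftrightarrow> \<bar>y\<bar> = ypar"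
proof -
  have 1: "psi (xq y) < 0" if "\<bar>y\<bar> < ypar"
    using psi_neg[OF xq_ge] that xq_less[of y ypar] ypar xq_ypar by simp
  have 2: "psi (xq y) > 0" if "\<bar>y\<bar> > ypar"
    using psi_pos[of "xq y"] that xq_less[of ypar y] ypar xq_ypar xq_less_xend assms by simp
  have 3: "psi (xq y) = 0" if "\<bar>y\<bar> = ypar"
    using xpar that xq_ypar by (metis xq_def power2_abs)
  show "psi (xq y) < 0 \<longleftrightarrow> \<bar>y\<bar> < ypar" "0 < psi (xq y) \<longleftrightarrow> ypar < \<bar>y\<bar>" "psi (xq y) = 0 \<longleftrightarrow> \<bar>y\<bar> = ypar"
    using 1 2 3 by (metis less_asym less_irrefl linorder_neqE_linordered_idom)+
qed

lemma jy_incr: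
  assumes "- ypar \<le> y" "y < y'" "y' \<le> ypar" shows "jy y < jy y'"
proof -
  have *: "jy y < jy y'" if "0 \<le> y" "y < y'" "y' \<le> ypar" for y y'
    using that jx_incr[of "xq y" "xq y'"] xq_ge[of y] xq_less[of y y'] xq_le[of y' ypar] ypar
    by (simp add: jy_jx xq_ypar)
  have neg: "jy y \<le> 0" if "y \<le> 0" "- ypar \<le> y" for y
    using *[of 0 "- y"] that by (cases "y = 0") (auto simp: jy_def)
  have pos: "0 < jy y" if "0 < y" "y \<le> ypar" for y
    using *[of 0 y] that by (auto simp: jy_def)
  show ?thesis
  proof (cases "0 \<le> y")
    case True then show ?thesis using * assms by auto
  next
    case False
    show ?thesis
    proof (cases "y' \<le> 0")
      case True
      then show ?thesis using *[of "- y'" "- y"] assms by simp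
    next
      case F: False
      then show ?thesis using neg[of y] pos[of y'] False assms by simp
    qed
  qed
qed

lemma jy_decr:
  assumes "ypar \<le> y" "y < y'" "y' \<le> yend" shows "jy y' < jy y"
  using assms jx_decr[of "xq y" "xq y'"] xq_less[of y y'] xq_le[of ypar y] xq_le[of y' yend] ypar
  by (simp add: jy_jx xq_yend xq_ypar)

lemma jy_pos: "0 < y \<Longrightarrow> y < yend \<Longrightarrow> 0 < jy y"
  using sy_pos[of y] by (simp add: jy_def)

lemma hy_prof: 
  assumes "0 \<le> y" "y < yend" shows "hy y = prof (jy y) (ry y)"
  using sy_sq[of y] sy_pos[of y] assms by (simp add: hy_def prof_def flip: sy_sq)

text \<open>Two critical points over the same J have different heights, so the hyperbolic side can
  meet an elliptic side only at a corner.\<close>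

lemma hy_less:
  assumes "0 \<le> y" "y < y'" "y' \<le> yend" "jy y = jy y'"
  shows "hy y' < hy y"
proof (cases "y' = yend")
  \<comment> \<open>At \<open>yend\<close> one has s = 0 and \<open>prof_less\<close> does not
    apply. The partner y must be 0, since J > 0 strictly between, and both heights are
    explicit.\<close>
  case True
  then have "jy y = 0" using assms by (simp add: jy_def)
  then have y0: "y = 0" using jy_pos[of y] assms by force
  have x0: "xq 0 = 1" by (simp add: xq_def)
  have "sy 0 = (\<kappa> - \<alpha>) / (\<delta> - 2)" by (simp add: sy_def x0 sx_def den_def)
  moreover have "ry 0 = sy 0" by (simp add: ry_def x0)
  ultimately have "hy 0 = (\<kappa> - \<alpha>)\<^sup>2 / (2 * (\<delta> - 2))"
    using xend(4) by (simp add: hy_def divide_simps) algebra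
  then have "0 < hy 0" using xend(4) alpha_less by simp
  moreover have "hy yend = 0" by (simp add: hy_def ry_def)
  ultimately show ?thesis using True y0 by simp
next
  case False
  then have y': "0 < y'" "y' < yend" using assms by auto
  then have "0 < jy y'" using jy_pos by auto
  then show ?thesis
    using prof_less[of "xq y" "xq y'"] assms y' xq_ge xq_less[of y y'] xq_less_xend[of y']
    by (simp add: hy_prof jy_jx ry_rx)
qed

lemma sy_continuous: "continuous_on {- yend..yend} sy"
  unfolding sy_def
  by (rule continuous_on_compose2[OF sx_continuous])
     (auto simp: xq_def[abs_def] xq_ge xq_le_xend[unfolded xq_def] intro!: continuous_intros)

lemma jy_continuous: "continuous_on {- yend..yend} jy"
  unfolding jy_def by (intro continuous_intros sy_continuous)

lemma hy_continuous: "continuous_on {- yend..yend} hy"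
  unfolding hy_def ry_def xq_def by (auto intro!: continuous_intros sy_continuous)

lemma crit_yparam:
  assumes s: "0 < s" "s\<^sup>2 = r\<^sup>2 - j\<^sup>2" and r: "0 < r" "r < \<alpha>"
    and crit: "\<kappa> * s = (\<alpha> - r) * r - s\<^sup>2 + \<delta> * r * s"
  obtains y where "\<bar>y\<bar> < yend" "sy y = s" "ry y = r" "jy y = j"
proof -
  note c = crit_param[OF assms]
  define y where "y = j / s"
  have "(r / s)\<^sup>2 = 1 + y\<^sup>2" using s by (simp add: y_def power_divide field_simps)
  then have x: "xq y = r / s" using c(1) unfolding xq_def by (metis order_trans real_sqrt_unique zero_le_one)
  then have "sy y = s" using c by (simp add: sy_def)
  moreover have "\<bar>y\<bar> < yend" using x c(2) xq_less[of y yend] ypar by (simp add: xq_yend)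
  ultimately show ?thesis using that[of y] s x by (auto simp: ry_def jy_def y_def)
qed

end

section \<open>Singular points in the central chart\<close>

text \<open>The constants undo the affine normalization of H: g will be 4\<gamma>t and c0 the value
  of H at B.\<close>

locale flap_sys = flap_data +
  fixes c0 g :: real
  assumes g_pos: "0 < g"
begin

definition Rc :: "complex^2 \<Rightarrow> real" where "Rc u = (u \<bullet> u) / 2"
definition Xc :: "complex^2 \<Rightarrow> real" where "Xc u = Re (u $ 1 * u $ 2)"
definition Jc :: "complex^2 \<Rightarrow> real" where "Jc u = ((cmod (u $ 1))\<^sup>2 - (cmod (u $ 2))\<^sup>2) / 2"
text \<open>On the chart z_3 > 0 one has z_3^2 = 2(\<alpha> - R), so the square root in
  \<open>affine_lift\<close> cancels and H becomes a polynomial.\<close>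

definition Hc :: "complex^2 \<Rightarrow> real" where
  "Hc u = c0 + g * (\<kappa> * Rc u + (\<alpha> - Rc u) * Xc u - \<delta> * (Rc u)\<^sup>2 / 2)"

definition dX :: "complex^2 \<Rightarrow> complex^2 \<Rightarrow> real" where
  "dX u v = Re (v $ 1 * u $ 2 + u $ 1 * v $ 2)"
definition dJ :: "complex^2 \<Rightarrow> complex^2 \<Rightarrow> real" where
  "dJ u v = u $ 1 \<bullet> v $ 1 - u $ 2 \<bullet> v $ 2"
definition dH :: "complex^2 \<Rightarrow> complex^2 \<Rightarrow> real" where
  "dH u v = g * ((\<kappa> - Xc u - \<delta> * Rc u) * (u \<bullet> v) + (\<alpha> - Rc u) * dX u v)"
definition ddH :: "complex^2 \<Rightarrow> complex^2 \<Rightarrow> complex^2 \<Rightarrow> real" where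
  "ddH u v w = g * ((- dX u w - \<delta> * (u \<bullet> w)) * (u \<bullet> v) + (\<kappa> - Xc u - \<delta> * Rc u) * (w \<bullet> v)
     - (u \<bullet> w) * dX u v + (\<alpha> - Rc u) * dX w v)"

lemma Rc_has_derivative: "(Rc has_derivative (\<lambda>v. u \<bullet> v)) (at u)"
  unfolding Rc_def by (auto intro!: derivative_eq_intros simp: inner_commute)

lemma Xc_has_derivative: "(Xc has_derivative dX u) (at u)"
  unfolding Xc_def[abs_def] dX_def[abs_def]
  by (rule has_derivative_eq_rhs) (auto intro!: derivative_eq_intros nth_has_derivative simp: fun_eq_iff)

lemma dX_commute: "dX u v = dX v u"
  by (simp add: dX_def mult.commute add.commute)

lemma dX_has_derivative: "((\<lambda>u. dX u v) has_derivative (\<lambda>w. dX w v)) (at u)"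
  unfolding dX_def[abs_def]
  by (rule has_derivative_eq_rhs) (auto intro!: derivative_eq_intros nth_has_derivative simp: fun_eq_iff)

lemma Jc_has_derivative: "(Jc has_derivative dJ u) (at u)"
  unfolding Jc_def[abs_def] dJ_def[abs_def] cmod_power2 power2_norm_eq_inner
  by (rule has_derivative_eq_rhs)
    (auto intro!: derivative_eq_intros nth_has_derivative simp: fun_eq_iff inner_complex_def field_simps)

lemma Hc_has_derivative: "(Hc has_derivative dH u) (at u)"
  unfolding Hc_def[abs_def] dH_def[abs_def]
  by (rule has_derivative_eq_rhs)
    (auto intro!: derivative_eq_intros Rc_has_derivative Xc_has_derivative simp: fun_eq_iff algebra_simps)

lemma dJ_has_derivative: "((\<lambda>u. dJ u v) has_derivative (\<lambda>w. dJ v w)) (at u)"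
  unfolding dJ_def[abs_def]
  by (rule has_derivative_eq_rhs)
    (auto intro!: derivative_eq_intros nth_has_derivative simp: fun_eq_iff inner_commute)

lemma dH_has_derivative: "((\<lambda>u. dH u v) has_derivative (\<lambda>w. ddH u v w)) (at u)"
  unfolding dH_def[abs_def] ddH_def[abs_def]
  by (rule has_derivative_eq_rhs)
    (auto intro!: derivative_eq_intros Rc_has_derivative Xc_has_derivative dX_has_derivative simp: fun_eq_iff algebra_simps)

end

locale flap_chart = flap_sys +
  fixes f1 f2 :: "complex^2 \<Rightarrow> real"
  assumes f1: "u \<bullet> u < 2 * \<alpha> \<Longrightarrow> f1 u = Jc u" and f2: "u \<bullet> u < 2 * \<alpha> \<Longrightarrow> f2 u = Hc u"
begin

definition dom :: "(complex^2) set" where "dom = {u. u \<bullet> u < 2 * \<alpha>}"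

lemma open_dom: "open dom"
  unfolding dom_def by (intro open_Collect_less continuous_intros)

lemma f_has_derivative:
  assumes "u \<in> dom"
  shows "(f1 has_derivative dJ u) (at u)" "(f2 has_derivative dH u) (at u)"
  using assms f1 f2
  by (auto intro!: has_derivative_transform_within_open[OF Jc_has_derivative open_dom]
      has_derivative_transform_within_open[OF Hc_has_derivative open_dom] simp: dom_def)

lemma differential_f:
  assumes "u \<in> dom" shows "differential f1 u = dJ u" "differential f2 u = dH u"
  using f_has_derivative[OF assms] by (auto simp: differential_eq)

lemma hessian_comb:
  assumes "u \<in> dom"
  shows "hessian (\<lambda>y. a * f1 y + b * f2 y) u = (\<lambda>v w. a * dJ v w + b * ddH u v w)"
proof
  fix v
  show "hessian (\<lambda>y. a * f1 y + b * f2 y) u v = (\<lambda>w. a * dJ v w + b * ddH u v w)"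
  proof (rule hessian_eqI[OF open_dom assms, where f' = "\<lambda>y v. a * dJ y v + b * dH y v"])
    fix y assume "y \<in> dom"
    then show "((\<lambda>y. a * f1 y + b * f2 y) has_derivative (\<lambda>v. a * dJ y v + b * dH y v)) (at y)"
      by (intro has_derivative_add has_derivative_mult_right f_has_derivative)
  next
    show "((\<lambda>y. a * dJ y v + b * dH y v) has_derivative (\<lambda>w. a * dJ v w + b * ddH u v w)) (at u)"
      by (intro has_derivative_add has_derivative_mult_right dJ_has_derivative dH_has_derivative)
  qed
qed

lemma hessian_f:
  assumes "u \<in> dom" shows "hessian f1 u = dJ" "hessian f2 u = ddH u"
  using hessian_comb[OF assms, of 1 0] hessian_comb[OF assms, of 0 1] by (simp_all add: fun_eq_iff)

end

lemma omega_2: "omega (u :: complex^2) v = Im (cnj (u $ 1) * v $ 1) + Im (cnj (u $ 2) * v $ 2)"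
  by (simp add: omega_def UNIV_2)

lemma inner_2: "(u :: 'a::real_inner ^ 2) \<bullet> v = u $ 1 \<bullet> v $ 1 + u $ 2 \<bullet> v $ 2"
  by (simp add: inner_vec_def UNIV_2)

text \<open>The class of \<open>[-p, q, z\<^sub>3]\<close> with \<open>p, q, z\<^sub>3 > 0\<close> is a critical point of the lower profile. Since \<open>J\<close> and \<open>H\<close> are
  invariant under complex conjugation, their Hessians at this real point split into real and imaginary blocks.\<close>

locale flap_point = flap_chart +
  fixes p q :: real
  assumes pq: "0 < p" "0 < q" "p\<^sup>2 + q\<^sup>2 < 2 * \<alpha>"
    and crit: "\<kappa> * (p * q) = (\<alpha> - (p\<^sup>2 + q\<^sup>2) / 2) * ((p\<^sup>2 + q\<^sup>2) / 2) - (p * q)\<^sup>2 + \<delta> * ((p\<^sup>2 + q\<^sup>2) / 2) * (p * q)"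
begin

definition r where "r = (p\<^sup>2 + q\<^sup>2) / 2"
definition j where "j = (p\<^sup>2 - q\<^sup>2) / 2"
definition e where "e = \<alpha> - r"
definition x0 :: "complex^2" where "x0 = vector [complex_of_real (- p), complex_of_real q]"
text \<open>The derivative of the lower profile with respect to j at fixed r, hence the Lagrange
  multiplier of J up to the factor g (\<open>dH_x0\<close>).\<close>

definition k where "k = e * j / (p * q)"

lemma x0 [simp]: "x0 $ 1 = complex_of_real (- p)" "x0 $ 2 = complex_of_real q"
  by (simp_all add: x0_def)

lemma e_pos: "0 < e" using pq by (simp add: e_def r_def)

lemma x0_dom: "x0 \<in> dom"
  using pq by (simp add: dom_def inner_2 inner_complex_def power2_eq_square)

lemma Rx0: "Rc x0 = r" by (simp add: Rc_def r_def inner_2 inner_complex_def power2_eq_square)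
lemma Xx0: "Xc x0 = - (p * q)" by (simp add: Xc_def)
lemma Jx0: "Jc x0 = j" by (simp add: Jc_def j_def)

lemma kappa_eq: "\<kappa> + p * q - \<delta> * r = e * r / (p * q)"
  using crit pq unfolding r_def[symmetric] e_def[symmetric] by (simp add: field_simps power2_eq_square)

lemma kappa_k: "\<kappa> + p * q - \<delta> * r - k = e * q / p" "\<kappa> + p * q - \<delta> * r + k = e * p / q"
proof -
  have "e * r / (p * q) - k = e * (r - j) / (p * q)" "e * r / (p * q) + k = e * (r + j) / (p * q)"
    by (simp_all add: k_def add_divide_distrib diff_divide_distrib algebra_simps)
  moreover have "r - j = q\<^sup>2" "r + j = p\<^sup>2" by (simp_all add: r_def j_def field_simps)
  ultimately show "\<kappa> + p * q - \<delta> * r - k = e * q / p" "\<kappa> + p * q - \<delta> * r + k = e * p / q"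
    unfolding kappa_eq using pq by (simp_all add: power2_eq_square)
qed

lemma dJ_x0: "dJ x0 v = - p * Re (v $ 1) - q * Re (v $ 2)"
  by (simp add: dJ_def inner_complex_def)

lemma dR_x0: "x0 \<bullet> v = - p * Re (v $ 1) + q * Re (v $ 2)"
  by (simp add: inner_2 inner_complex_def)

lemma dX_x0: "dX x0 v = q * Re (v $ 1) - p * Re (v $ 2)"
  by (simp add: dX_def)

lemma dH_x0: "dH x0 v = g * k * dJ x0 v"
proof -
  have "(\<kappa> + p * q - \<delta> * r) * (x0 \<bullet> v) + e * dX x0 v - k * dJ x0 v
      = - p * Re (v $ 1) * (\<kappa> + p * q - \<delta> * r - k) + q * Re (v $ 2) * (\<kappa> + p * q - \<delta> * r + k)
        + e * (q * Re (v $ 1) - p * Re (v $ 2))"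
    unfolding dJ_x0 dR_x0 dX_x0 by (simp add: algebra_simps)
  also have "\<dots> = 0" unfolding kappa_k using pq by (simp add: field_simps)
  finally show ?thesis by (simp add: dH_def Rx0 Xx0 e_def[symmetric])
qed

text \<open>The Hessian of H/g - k J at \<open>x0\<close> (\<open>ddH_form\<close>). Its imaginary
  block is a positive multiple of the square of one linear form, which vanishes on the orbit
  direction i(p, q); the other terms form the real block.\<close>

definition form :: "complex^2 \<Rightarrow> complex^2 \<Rightarrow> real" where
  "form v w = e / (p * q) * (q * Im (v $ 1) - p * Im (v $ 2)) * (q * Im (w $ 1) - p * Im (w $ 2))
     + e / (p * q) * (q * Re (v $ 1) + p * Re (v $ 2)) * (q * Re (w $ 1) + p * Re (w $ 2))
     - (x0 \<bullet> v) * dX x0 w - (x0 \<bullet> w) * dX x0 v - \<delta> * (x0 \<bullet> v) * (x0 \<bullet> w)"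

lemma ddH_form: "ddH x0 v w - g * k * dJ v w = g * form v w"
proof -
  have "(\<kappa> + p * q - \<delta> * r) * (w \<bullet> v) - k * dJ v w + e * dX w v
    = (\<kappa> + p * q - \<delta> * r - k) * (Re (v $ 1) * Re (w $ 1) + Im (v $ 1) * Im (w $ 1))
     + (\<kappa> + p * q - \<delta> * r + k) * (Re (v $ 2) * Re (w $ 2) + Im (v $ 2) * Im (w $ 2)) + e * dX w v"
    by (simp add: inner_2 inner_complex_def dJ_def algebra_simps)
  also have "\<dots> = e / (p * q) * (q * Im (v $ 1) - p * Im (v $ 2)) * (q * Im (w $ 1) - p * Im (w $ 2))
     + e / (p * q) * (q * Re (v $ 1) + p * Re (v $ 2)) * (q * Re (w $ 1) + p * Re (w $ 2))"
    unfolding kappa_k using pq by (simp add: dX_def field_simps)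
  finally have 1: "(\<kappa> + p * q - \<delta> * r) * (w \<bullet> v) - k * dJ v w + e * dX w v = \<dots>" .
  have "ddH x0 v w - g * k * dJ v w = g * (((\<kappa> + p * q - \<delta> * r) * (w \<bullet> v) - k * dJ v w + e * dX w v)
     - (x0 \<bullet> v) * dX x0 w - (x0 \<bullet> w) * dX x0 v - \<delta> * (x0 \<bullet> v) * (x0 \<bullet> w))"
    unfolding ddH_def Rx0 Xx0 e_def[symmetric] by algebra
  then show ?thesis unfolding 1 form_def .
qed

lemma orbit_tangent_x0: "orbit_tangent f1 f2 x0 = {w. \<exists>c. w $ 1 = \<i> * of_real (c * p) \<and> w $ 2 = \<i> * of_real (c * q)}"
proof (intro equalityI subsetI)
  fix w :: "complex^2" assume "w \<in> orbit_tangent f1 f2 x0"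
  then obtain a b where "\<And>v. omega w v = a * dJ x0 v + b * dH x0 v"
    by (auto simp: orbit_tangent_def differential_f[OF x0_dom])
  then have w: "omega w v = (a + b * g * k) * dJ x0 v" for v by (simp add: dH_x0 algebra_simps)
  define c where "c = a + b * g * k"
  have "Re (w $ 1) = 0" using w[of "axis 1 \<i>"] by (simp add: omega_2 dJ_x0 axis_def)
  moreover have "Re (w $ 2) = 0" using w[of "axis 2 \<i>"] by (simp add: omega_2 dJ_x0 axis_def)
  moreover have "Im (w $ 1) = c * p" using w[of "axis 1 1"] by (simp add: omega_2 dJ_x0 axis_def c_def)
  moreover have "Im (w $ 2) = c * q" using w[of "axis 2 1"] by (simp add: omega_2 dJ_x0 axis_def c_def)
  ultimately show "w \<in> {w. \<exists>c. w $ 1 = \<i> * of_real (c * p) \<and> w $ 2 = \<i> * of_real (c * q)}"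
    by (auto simp: complex_eq_iff intro!: exI[of _ c])
next
  fix w :: "complex^2" assume "w \<in> {w. \<exists>c. w $ 1 = \<i> * of_real (c * p) \<and> w $ 2 = \<i> * of_real (c * q)}"
  then obtain c where "w $ 1 = \<i> * of_real (c * p)" "w $ 2 = \<i> * of_real (c * q)" by blast
  then have "\<forall>v. omega w v = c * dJ x0 v + 0 * dH x0 v"
    by (simp add: omega_2 dJ_x0 algebra_simps)
  then show "w \<in> orbit_tangent f1 f2 x0"
    unfolding orbit_tangent_def differential_f[OF x0_dom] by blast
qed

lemma symplectic_orthogonal_x0: "symplectic_orthogonal (orbit_tangent f1 f2 x0) = {v. p * Re (v $ 1) + q * Re (v $ 2) = 0}"
proof (intro equalityI subsetI)
  fix v assume v: "v \<in> symplectic_orthogonal (orbit_tangent f1 f2 x0)"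
  have "vector [\<i> * of_real p, \<i> * of_real q] \<in> orbit_tangent f1 f2 x0"
    by (auto simp: orbit_tangent_x0 intro!: exI[of _ 1])
  with v have "omega (vector [\<i> * of_real p, \<i> * of_real q]) v = 0" by (auto simp: symplectic_orthogonal_def)
  then show "v \<in> {v. p * Re (v $ 1) + q * Re (v $ 2) = 0}" by (simp add: omega_2)
next
  fix v :: "complex^2" assume v: "v \<in> {v. p * Re (v $ 1) + q * Re (v $ 2) = 0}"
  have "omega w v = 0" if "w $ 1 = \<i> * of_real (c * p)" "w $ 2 = \<i> * of_real (c * q)" for w :: "complex^2" and c
  proof -
    have "omega w v = - c * (p * Re (v $ 1) + q * Re (v $ 2))" using that by (simp add: omega_2[of w] algebra_simps)
    then show ?thesis using v by simp
  qed
  then show "v \<in> symplectic_orthogonal (orbit_tangent f1 f2 x0)"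
    by (auto simp: symplectic_orthogonal_def orbit_tangent_x0)
qed

lemma rank_one_x0: "rank_one_at f1 f2 x0"
proof -
  have "\<forall>v. - (g * k) * dJ x0 v + 1 * dH x0 v = 0" by (simp add: dH_x0)
  then have "singular_at f1 f2 x0"
    unfolding singular_at_def differential_f[OF x0_dom] by (metis prod.inject zero_neq_one)
  moreover have "dJ x0 (axis 1 1) \<noteq> 0" using pq by (simp add: dJ_x0 axis_def)
  ultimately show ?thesis
    unfolding rank_one_at_def rank_zero_at_def differential_f[OF x0_dom] by blast
qed

text \<open>As a vector of C^2 this is (a + i b)(q, -p). These vectors form a complement of the
  orbit line in its symplectic orthogonal, hence a model of the transverse plane;
  \<open>form\<close> is diagonal on it, with entries A and B.\<close>

definition E :: "real \<Rightarrow> real \<Rightarrow> complex^2" where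
  "E a b = vector [Complex (a * q) (b * q), Complex (- a * p) (- b * p)]"

definition A where "A = e / (p * q) * (q\<^sup>2 - p\<^sup>2)\<^sup>2 + 4 * (p * q) * (p\<^sup>2 + q\<^sup>2) - 4 * \<delta> * (p * q)\<^sup>2"
definition B where "B = e / (p * q) * (p\<^sup>2 + q\<^sup>2)\<^sup>2"

lemma form_E: "form (E a b) (E a' b') = a * a' * A + b * b' * B"
  by (simp add: form_def E_def A_def B_def dR_x0 dX_x0 power2_eq_square) algebra

lemma omega_E: "omega (E a b) (E a' b') = (a * b' - b * a') * (p\<^sup>2 + q\<^sup>2)"
  by (simp add: omega_2 E_def) algebra

lemma E_orthogonal: "E a b \<in> symplectic_orthogonal (orbit_tangent f1 f2 x0)"
  by (simp add: symplectic_orthogonal_x0 E_def)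

lemma B_pos: "0 < B"
  using pq e_pos by (auto simp: B_def intro!: mult_pos_pos divide_pos_pos add_pos_pos)

definition psi' where "psi' = 2 * r / (p * q) + e * j\<^sup>2 / (p * q) ^ 3 - \<delta>"

text \<open>The link between the transverse Hessian and the second derivative of the profile: since
  B > 0, the sign of \<open>psi'\<close> decides the type of the point.\<close>

lemma A_psi: "A = 4 * (p * q)\<^sup>2 * psi'"
  using pq by (simp add: A_def psi'_def r_def j_def field_simps power2_eq_square power3_eq_cube)

lemma transverse_hessian_x0: "transverse_hessian f1 f2 x0 form"
proof -
  have "form = hessian (\<lambda>y. (- k) * f1 y + (1 / g) * f2 y) x0"
  proof -
    have "form v w = (- k) * dJ v w + (1 / g) * ddH x0 v w" for v w
      using ddH_form[of v w] g_pos by (simp add: field_simps)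
    then show ?thesis unfolding hessian_comb[OF x0_dom] by blast
  qed
  moreover have "\<forall>v. (- k) * dJ x0 v + (1 / g) * dH x0 v = 0" using g_pos by (simp add: dH_x0)
  ultimately show ?thesis
    unfolding transverse_hessian_def differential_f[OF x0_dom] using g_pos
    by (intro exI[of _ "- k"] exI[of _ "1 / g"]) auto
qed

lemma nondegenerate_x0:
  assumes "A \<noteq> 0" shows "nondegenerate_transverse (orbit_tangent f1 f2 x0) form"
  unfolding nondegenerate_transverse_def
proof (intro conjI ballI impI)
  fix v w assume "v \<in> symplectic_orthogonal (orbit_tangent f1 f2 x0)" "w \<in> orbit_tangent f1 f2 x0"
  then show "form v w = 0" by (auto simp: orbit_tangent_x0 form_def dR_x0 dX_x0)
next
  fix v assume v: "v \<in> symplectic_orthogonal (orbit_tangent f1 f2 x0)"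
    and 0: "\<forall>w\<in>symplectic_orthogonal (orbit_tangent f1 f2 x0). form v w = 0"
  have v': "p * Re (v $ 1) = - q * Re (v $ 2)" using v by (simp add: symplectic_orthogonal_x0)
  define a where "a = Re (v $ 1) / q"
  have a: "Re (v $ 1) = a * q" "Re (v $ 2) = - a * p" using v' pq by (auto simp: a_def field_simps)
  have "form v (E 1 0) = a * A"
    by (simp add: form_def dR_x0 dX_x0 a E_def A_def power2_eq_square) algebra
  then have a0: "a = 0" using 0 E_orthogonal assms by auto
  have "form v (E 0 1) = e / (p * q) * (q * Im (v $ 1) - p * Im (v $ 2)) * (p\<^sup>2 + q\<^sup>2)"
    by (simp add: form_def dR_x0 dX_x0 a a0 E_def power2_eq_square algebra_simps)
  moreover have "0 < p\<^sup>2 + q\<^sup>2" using pq by (auto intro!: add_pos_pos)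
  moreover have "form v (E 0 1) = 0" using 0 E_orthogonal by blast
  ultimately have "q * Im (v $ 1) - p * Im (v $ 2) = 0" using pq e_pos by auto
  then have "Im (v $ 2) = Im (v $ 1) / p * q" "Im (v $ 1) = Im (v $ 1) / p * p" using pq by (auto simp: field_simps)
  then show "v \<in> orbit_tangent f1 f2 x0"
    using a a0 by (auto simp: orbit_tangent_x0 complex_eq_iff intro!: exI[of _ "Im (v $ 1) / p"])
qed

text \<open>Eliminating \<sigma> from the two equations leaves \<tau>^4 = b / (a w^2), which
  explains the nested roots.\<close>

lemma scaling:
  assumes "0 < a" "0 < b" "0 < w"
  obtains \<tau> \<sigma> :: real where "\<tau> * \<sigma> * w = 1" "\<tau>\<^sup>2 * a = \<sigma>\<^sup>2 * b" "0 < \<tau>" "0 < \<sigma>"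
proof (rule that[of "sqrt (sqrt (b / a) / w)" "1 / (sqrt (sqrt (b / a) / w) * w)"])
  let ?t = "sqrt (sqrt (b / a) / w)"
  show t: "0 < ?t" using assms by simp
  show "?t * (1 / (?t * w)) * w = 1" using assms by simp
  show "0 < 1 / (?t * w)" using assms t by simp
  have t2: "?t\<^sup>2 = sqrt (b / a) / w" using assms by simp
  have "(1 / (?t * w))\<^sup>2 * b = b / (?t\<^sup>2 * w\<^sup>2)" by (simp add: power_divide power_mult_distrib)
  also have "\<dots> = b / (sqrt (b / a) * w)" unfolding t2 using assms by (simp add: power2_eq_square)
  also have "\<dots> = (sqrt (b / a) * sqrt (b / a)) * a / (sqrt (b / a) * w)" using assms by simp
  also have "\<dots> = sqrt (b / a) / w * a" using assms by (simp add: field_simps)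
  finally show "?t\<^sup>2 * a = (1 / (?t * w))\<^sup>2 * b" unfolding t2 by simp
qed

lemma elliptic_x0:
  assumes "0 < psi'" shows "elliptic_regular_at f1 f2 x0"
proof -
  have A: "0 < A" using assms pq by (simp add: A_psi)
  obtain \<tau> \<sigma> where ts: "\<tau> * \<sigma> * (p\<^sup>2 + q\<^sup>2) = 1" "\<tau>\<^sup>2 * A = \<sigma>\<^sup>2 * B" "0 < \<tau>"
    using scaling[OF A B_pos, of "p\<^sup>2 + q\<^sup>2"] pq by (metis add_pos_pos zero_less_power)
  show ?thesis
    unfolding elliptic_regular_at_def
  proof (intro conjI exI bexI)
    show "\<tau>\<^sup>2 * A \<noteq> 0" using A ts(3) by simp
    show "omega (E \<tau> 0) (E 0 \<sigma>) = 1" using ts by (simp add: omega_E)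
    show "form (E \<tau> 0) (E \<tau> 0) = \<tau>\<^sup>2 * A" "form (E 0 \<sigma>) (E 0 \<sigma>) = \<tau>\<^sup>2 * A" "form (E \<tau> 0) (E 0 \<sigma>) = 0"
      using ts by (simp_all add: form_E power2_eq_square)
  qed (use A nondegenerate_x0 in \<open>auto intro: rank_one_x0 transverse_hessian_x0 E_orthogonal\<close>)
qed

lemma hyperbolic_x0:
  assumes "psi' < 0" shows "hyperbolic_regular_at f1 f2 x0"
proof -
  have A: "0 < - A" using assms pq by (simp add: A_psi mult_pos_neg)
  obtain \<tau> \<sigma> where ts: "\<tau> * \<sigma> * (p\<^sup>2 + q\<^sup>2) = 1" "\<tau>\<^sup>2 * - A = \<sigma>\<^sup>2 * B" "0 < \<tau>"
    using scaling[OF A B_pos, of "p\<^sup>2 + q\<^sup>2"] pq by (metis add_pos_pos zero_less_power)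
  show ?thesis
    unfolding hyperbolic_regular_at_def
  proof (intro conjI exI bexI)
    show "\<tau>\<^sup>2 * - A \<noteq> 0" using A ts(3) by simp
    \<comment> \<open>By the choice of \<tau> and \<sigma>, the two isotropic lines of
      \<open>form\<close> in the transverse plane are spanned by E \<tau> \<sigma> and E (-\<tau>)
      \<sigma>; the factor 1/2 normalizes the symplectic product.\<close>
    show "omega (E \<tau> \<sigma>) (E (- \<tau> / 2) (\<sigma> / 2)) = 1" using ts(1) by (simp add: omega_E field_simps)
    show "form (E \<tau> \<sigma>) (E \<tau> \<sigma>) = 0" "form (E (- \<tau> / 2) (\<sigma> / 2)) (E (- \<tau> / 2) (\<sigma> / 2)) = 0"
      "form (E \<tau> \<sigma>) (E (- \<tau> / 2) (\<sigma> / 2)) = \<tau>\<^sup>2 * - A"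
      using ts(2) by (simp_all add: form_E power2_eq_square field_simps)
  qed (use A nondegenerate_x0 in \<open>auto intro: rank_one_x0 transverse_hessian_x0 E_orthogonal\<close>)
qed

end

section \<open>The parabolic points\<close>

lemma local_diffeo_at_ident: "local_diffeo_at (y :: 'a::real_normed_vector) (\<lambda>z. z)"
  unfolding local_diffeo_at_def smooth_on_def
  by (intro exI[of _ UNIV] exI[of _ "\<lambda>z. z"])
    (auto simp: homeomorphism_def intro!: Ck_on_linear bounded_linear_ident)

lemma deriv_funpow_3:
  fixes f :: "real \<Rightarrow> real"
  assumes "open I" "x \<in> I"
    and "\<And>y. y \<in> I \<Longrightarrow> (f has_real_derivative f1 y) (at y)"
    and "\<And>y. y \<in> I \<Longrightarrow> (f1 has_real_derivative f2 y) (at y)"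
    and "(f2 has_real_derivative d) (at x)"
  shows "(deriv ^^ 3) f x = d"
proof -
  have ev: "eventually (\<lambda>y. y \<in> I) (nhds z)" if "z \<in> I" for z
    using assms(1) that by (rule eventually_nhds_in_open)
  have 1: "deriv f y = f1 y" if "y \<in> I" for y using assms(3)[OF that] by (rule DERIV_imp_deriv)
  have 2: "deriv (deriv f) y = f2 y" if "y \<in> I" for y
  proof -
    have "deriv (deriv f) y = deriv f1 y"
      by (rule deriv_cong_ev[OF eventually_mono[OF ev[OF that]]]) (use 1 in auto)
    then show ?thesis using assms(4)[OF that] by (simp add: DERIV_imp_deriv)
  qed
  have "deriv (deriv (deriv f)) x = deriv f2 x"
    by (rule deriv_cong_ev[OF eventually_mono[OF ev[OF assms(2)]]]) (use 2 in auto)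
  then show ?thesis using assms(5) by (simp add: numeral_3_eq_3 DERIV_imp_deriv)
qed

context flap_point
begin

text \<open>Coordinates on the hypersurface J = j: s_1 shifts R, s_2 turns the phase of z_1 z_2, and
  s_3 follows the flow of J, on which H does not depend.\<close>

definition par :: "real^3 \<Rightarrow> complex^2" where
  "par s = vector [- of_real (sqrt (r + s $ 1 + j)) * cis (s $ 2 + s $ 3),
     of_real (sqrt (r + s $ 1 - j)) * cis (s $ 2 - s $ 3)]"

definition pdom :: "(real^3) set" where "pdom = {s. \<bar>j\<bar> < r + s $ 1 \<and> r + s $ 1 < \<alpha>}"

lemma rj: "r + j = p\<^sup>2" "r - j = q\<^sup>2" "\<bar>j\<bar> < r" "r < \<alpha>"
proof -
  show a: "r + j = p\<^sup>2" "r - j = q\<^sup>2" by (simp_all add: r_def j_def field_simps)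
  moreover have "0 < p\<^sup>2" "0 < q\<^sup>2" using pq by auto
  ultimately show "\<bar>j\<bar> < r" by linarith
  show "r < \<alpha>" using e_pos by (simp add: e_def)
qed

lemma open_pdom: "open pdom" "0 \<in> pdom"
  unfolding pdom_def using rj
  by (auto intro!: open_Collect_conj open_Collect_less continuous_intros)

lemma par_smooth: "smooth_on pdom par"
  unfolding smooth_on_def
proof
  fix n
  have nth: "Ck_on n pdom (\<lambda>s. s $ i)" for i
    by (intro Ck_on_linear open_pdom bounded_linear_vec_nth)
  have "Ck_on n pdom (\<lambda>s. - of_real (sqrt (r + s $ 1 + j)) * cis (s $ 2 + s $ 3))"
    "Ck_on n pdom (\<lambda>s. of_real (sqrt (r + s $ 1 - j)) * cis (s $ 2 - s $ 3))"
    by (intro Ck_on_mult Ck_on_minus Ck_on_linear_compose[OF _ bounded_linear_of_real] Ck_on_real_compose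
       Ck_on_cis Ck_on_add Ck_on_diff Ck_on_const nth open_pdom, force simp: pdom_def)+
  then have "Ck_on n pdom (\<lambda>s. par s $ i)" for i using exhaust_2[of i] by (auto simp: par_def)
  then show "Ck_on n pdom par" by (intro Ck_on_vec open_pdom)
qed

lemma par_0: "par 0 = x0"
  using rj pq by (simp add: par_def x0_def)

definition par' :: "real^3 \<Rightarrow> complex^2" where
  "par' v = vector [- of_real (v $ 1 / (2 * p)) - \<i> * of_real (p * (v $ 2 + v $ 3)),
     of_real (v $ 1 / (2 * q)) + \<i> * of_real (q * (v $ 2 - v $ 3))]"

lemma par_has_derivative: "(par has_derivative par') (at 0)"
proof (rule has_derivative_vec)
  have cis: "cis t = of_real (cos t) + \<i> * of_real (sin t)" for t by (simp add: complex_eq_iff)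
  have rj': "r + j = p\<^sup>2" "r - j = q\<^sup>2" using rj by auto
  have sq: "((\<lambda>s :: real^3. sqrt (r + s $ 1 + j)) has_derivative (\<lambda>v. v $ 1 / (2 * p))) (at 0)"
    "((\<lambda>s :: real^3. sqrt (r + s $ 1 - j)) has_derivative (\<lambda>v. v $ 1 / (2 * q))) (at 0)"
  proof -
    have i: "((\<lambda>s :: real^3. r + s $ 1 + j) has_derivative (\<lambda>v. v $ 1)) (at 0)"
      "((\<lambda>s :: real^3. r + s $ 1 - j) has_derivative (\<lambda>v. v $ 1)) (at 0)"
      by (auto intro!: derivative_eq_intros nth_has_derivative)
    have d: "(sqrt has_derivative (\<lambda>h. h / (2 * w))) (at y)" if "y = w\<^sup>2" "0 < w" for y w :: real
    proof -
      have "(sqrt has_real_derivative inverse (sqrt (w\<^sup>2)) / 2) (at (w\<^sup>2))" using that by (intro DERIV_real_sqrt) simp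
      moreover have "(*) (inverse (sqrt (w\<^sup>2)) / 2) = (\<lambda>h. h / (2 * w))" using that(2) by (auto simp: field_simps)
      ultimately show ?thesis unfolding has_field_derivative_def that(1) by simp
    qed
    have d1: "(sqrt has_derivative (\<lambda>h. h / (2 * p))) (at (r + (0::real^3) $ 1 + j))"
      by (rule d) (use rj' pq in simp_all)
    have d2: "(sqrt has_derivative (\<lambda>h. h / (2 * q))) (at (r + (0::real^3) $ 1 - j))"
      by (rule d) (use rj' pq in simp_all)
    show "((\<lambda>s :: real^3. sqrt (r + s $ 1 + j)) has_derivative (\<lambda>v. v $ 1 / (2 * p))) (at 0)"
      by (rule has_derivative_compose[OF i(1) d1])
    show "((\<lambda>s :: real^3. sqrt (r + s $ 1 - j)) has_derivative (\<lambda>v. v $ 1 / (2 * q))) (at 0)"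
      by (rule has_derivative_compose[OF i(2) d2])
  qed
  have cs: "((\<lambda>s :: real^3. cis (s $ 2 + s $ 3)) has_derivative (\<lambda>v. \<i> * of_real (v $ 2 + v $ 3))) (at 0)"
    "((\<lambda>s :: real^3. cis (s $ 2 - s $ 3)) has_derivative (\<lambda>v. \<i> * of_real (v $ 2 - v $ 3))) (at 0)"
    unfolding cis by (auto intro!: derivative_eq_intros nth_has_derivative)
  have 1: "((\<lambda>s :: real^3. - complex_of_real (sqrt (r + s $ 1 + j)) * cis (s $ 2 + s $ 3)) has_derivative
    (\<lambda>v. - of_real (v $ 1 / (2 * p)) - \<i> * of_real (p * (v $ 2 + v $ 3)))) (at 0)"
    by (rule has_derivative_eq_rhs[OF has_derivative_mult[OF has_derivative_minus[OF has_derivative_of_real[OF sq(1)]] cs(1)]])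
       (use pq in \<open>simp add: rj' fun_eq_iff\<close>)
  have 2: "((\<lambda>s :: real^3. complex_of_real (sqrt (r + s $ 1 - j)) * cis (s $ 2 - s $ 3)) has_derivative
    (\<lambda>v. of_real (v $ 1 / (2 * q)) + \<i> * of_real (q * (v $ 2 - v $ 3)))) (at 0)"
    by (rule has_derivative_eq_rhs[OF has_derivative_mult[OF has_derivative_of_real[OF sq(2)] cs(2)]])
       (use pq in \<open>simp add: rj' fun_eq_iff\<close>)
  show "((\<lambda>x. par x $ i) has_derivative (\<lambda>v. par' v $ i)) (at 0)" for i
    using exhaust_2[of i] 1 2 by (auto simp: par_def par'_def)
qed

lemma par_inj: "inj (frechet_derivative par (at 0))"
proof -
  have "linear par'" using par_has_derivative has_derivative_linear by blast
  moreover have "v = 0" if "par' v = 0" for v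
  proof -
    have "par' v $ 1 = 0" "par' v $ 2 = 0" using that by simp_all
    then have "v $ 1 = 0 \<and> v $ 2 + v $ 3 = 0 \<and> v $ 2 - v $ 3 = 0"
      using pq by (auto simp: par'_def complex_eq_iff)
    then show ?thesis by (simp add: vec_eq_iff forall_3)
  qed
  ultimately have "inj par'" by (simp add: linear_injective_0)
  then show ?thesis using frechet_derivative_at[OF par_has_derivative] by simp
qed

lemma par_norm:
  assumes "s \<in> pdom" shows "(cmod (par s $ 1))\<^sup>2 = r + s $ 1 + j" "(cmod (par s $ 2))\<^sup>2 = r + s $ 1 - j"
  using assms by (auto simp: par_def pdom_def norm_mult)

lemma inner_self_2: "(u :: complex^2) \<bullet> u = (cmod (u $ 1))\<^sup>2 + (cmod (u $ 2))\<^sup>2"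
  by (simp add: inner_2 power2_norm_eq_inner)

lemma f1_par: "s \<in> pdom \<Longrightarrow> f1 (par s) = j"
  using par_norm[of s] by (subst f1) (auto simp: inner_self_2 Jc_def pdom_def)

lemma f2_par:
  assumes "s \<in> pdom"
  shows "f2 (par s) = c0 + g * (\<kappa> * (r + s $ 1) - (\<alpha> - (r + s $ 1)) * sqrt ((r + s $ 1)\<^sup>2 - j\<^sup>2) * cos (2 * s $ 2)
     - \<delta> * (r + s $ 1)\<^sup>2 / 2)"
proof -
  have "Rc (par s) = r + s $ 1" using par_norm[OF assms] by (simp add: Rc_def inner_self_2)
  moreover have "Xc (par s) = - (sqrt ((r + s $ 1)\<^sup>2 - j\<^sup>2) * cos (2 * s $ 2))"
  proof -
    have "par s $ 1 * par s $ 2 = - of_real (sqrt (r + s $ 1 + j) * sqrt (r + s $ 1 - j)) * (cis (s $ 2 + s $ 3) * cis (s $ 2 - s $ 3))"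
      by (simp add: par_def)
    also have "sqrt (r + s $ 1 + j) * sqrt (r + s $ 1 - j) = sqrt ((r + s $ 1)\<^sup>2 - j\<^sup>2)"
      by (simp add: real_sqrt_mult[symmetric] algebra_simps power2_eq_square)
    finally show ?thesis by (simp add: Xc_def cis_mult)
  qed
  moreover have "par s \<bullet> par s < 2 * \<alpha>" using assms par_norm[OF assms] by (auto simp: inner_self_2 pdom_def)
  ultimately have "f2 (par s) = c0 + g * (\<kappa> * (r + s $ 1) + (\<alpha> - (r + s $ 1)) * - (sqrt ((r + s $ 1)\<^sup>2 - j\<^sup>2) * cos (2 * s $ 2))
     - \<delta> * (r + s $ 1)\<^sup>2 / 2)" using f2[of "par s"] by (simp only: Hc_def)
  then show ?thesis by (simp only: mult_minus_right add_uminus_conv_diff mult.assoc)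
qed

text \<open>Half the amplitude of Re(z_1 z_2 cnj(z_3)^2) on the circle R = x, J = j; the next three
  functions are its successive derivatives.\<close>

definition Bf :: "real \<Rightarrow> real" where "Bf x = (\<alpha> - x) * sqrt (x\<^sup>2 - j\<^sup>2)"
definition Bf1 :: "real \<Rightarrow> real" where "Bf1 x = (\<alpha> - x) * x / sqrt (x\<^sup>2 - j\<^sup>2) - sqrt (x\<^sup>2 - j\<^sup>2)"
definition Bf2 :: "real \<Rightarrow> real" where "Bf2 x = - (2 * x / sqrt (x\<^sup>2 - j\<^sup>2)) - (\<alpha> - x) * j\<^sup>2 / sqrt (x\<^sup>2 - j\<^sup>2) ^ 3"
definition Bf3 :: "real \<Rightarrow> real" where
  "Bf3 x = 3 * j\<^sup>2 / sqrt (x\<^sup>2 - j\<^sup>2) ^ 3 + 3 * (\<alpha> - x) * j\<^sup>2 * x / sqrt (x\<^sup>2 - j\<^sup>2) ^ 5"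

lemma sqrt_deriv:
  assumes "\<bar>j\<bar> < x"
  shows "((\<lambda>x. sqrt (x\<^sup>2 - j\<^sup>2)) has_real_derivative x / sqrt (x\<^sup>2 - j\<^sup>2)) (at x)" "0 < sqrt (x\<^sup>2 - j\<^sup>2)"
    "(sqrt (x\<^sup>2 - j\<^sup>2))\<^sup>2 = x\<^sup>2 - j\<^sup>2"
proof -
  have "j\<^sup>2 < x\<^sup>2" using assms by (metis abs_ge_zero power2_abs power_strict_mono pos2)
  then show "((\<lambda>x. sqrt (x\<^sup>2 - j\<^sup>2)) has_real_derivative x / sqrt (x\<^sup>2 - j\<^sup>2)) (at x)" "0 < sqrt (x\<^sup>2 - j\<^sup>2)"
    "(sqrt (x\<^sup>2 - j\<^sup>2))\<^sup>2 = x\<^sup>2 - j\<^sup>2"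
    by (auto intro!: derivative_eq_intros simp: field_simps)
qed

lemma Bf_deriv:
  assumes "\<bar>j\<bar> < x"
  shows "(Bf has_real_derivative Bf1 x) (at x)" "(Bf1 has_real_derivative Bf2 x) (at x)"
    "(Bf2 has_real_derivative Bf3 x) (at x)"
proof -
  note S = sqrt_deriv[OF assms]
  define w where "w = sqrt (x\<^sup>2 - j\<^sup>2)"
  have w: "0 < w" "x\<^sup>2 = w\<^sup>2 + j\<^sup>2" using S by (simp_all add: w_def)
  have w': "x * x = w * w + j * j" using w(2) by (simp add: power2_eq_square)
  show "(Bf has_real_derivative Bf1 x) (at x)"
    unfolding Bf_def Bf1_def
    by (rule DERIV_cong, (rule derivative_eq_intros S refl)+) (simp add: algebra_simps)
  have "((\<lambda>x. (\<alpha> - x) * x / sqrt (x\<^sup>2 - j\<^sup>2) - sqrt (x\<^sup>2 - j\<^sup>2)) has_real_derivative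
     ((\<alpha> - 2 * x) * w - (\<alpha> - x) * x * (x / w)) / (w * w) - x / w) (at x)"
    by (rule DERIV_cong, (rule derivative_eq_intros S refl | use S in force)+)
       (simp add: w_def[symmetric] algebra_simps)
  moreover have "((\<alpha> - 2 * x) * w - (\<alpha> - x) * x * (x / w)) / (w * w) - x / w = - (2 * x / w) - (\<alpha> - x) * j\<^sup>2 / w ^ 3"
  proof -
    have "((\<alpha> - 2 * x) * w - (\<alpha> - x) * x * (x / w)) / (w * w) - x / w = ((\<alpha> - 2 * x) * (w * w) - (\<alpha> - x) * (x * x) - x * (w * w)) / w ^ 3"
      using w(1) by (simp add: field_simps power3_eq_cube)
    also have "\<dots> = (- (2 * x * (w * w)) - (\<alpha> - x) * j\<^sup>2) / w ^ 3"
      unfolding w' by (simp add: algebra_simps power2_eq_square)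
    also have "\<dots> = - (2 * x / w) - (\<alpha> - x) * j\<^sup>2 / w ^ 3"
      using w(1) by (simp add: field_simps power3_eq_cube)
    finally show ?thesis .
  qed
  ultimately show "(Bf1 has_real_derivative Bf2 x) (at x)"
    unfolding Bf1_def[abs_def] Bf2_def w_def by simp
  have "((\<lambda>x. - (2 * x / sqrt (x\<^sup>2 - j\<^sup>2)) - (\<alpha> - x) * j\<^sup>2 / sqrt (x\<^sup>2 - j\<^sup>2) ^ 3) has_real_derivative
     - ((2 * w - 2 * x * (x / w)) / (w * w)) - ((- j\<^sup>2) * w ^ 3 - (\<alpha> - x) * j\<^sup>2 * (3 * (x / w) * w\<^sup>2)) / (w ^ 3 * w ^ 3)) (at x)"
    by (rule DERIV_cong, (rule derivative_eq_intros S refl | use S in force)+)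
       (simp add: w_def[symmetric] algebra_simps)
  moreover have "- ((2 * w - 2 * x * (x / w)) / (w * w)) - ((- j\<^sup>2) * w ^ 3 - (\<alpha> - x) * j\<^sup>2 * (3 * (x / w) * w\<^sup>2)) / (w ^ 3 * w ^ 3)
     = 3 * j\<^sup>2 / w ^ 3 + 3 * (\<alpha> - x) * j\<^sup>2 * x / w ^ 5"
  proof -
    have a: "- ((2 * w - 2 * x * (x / w)) / (w * w)) = 2 * j\<^sup>2 / w ^ 3"
    proof -
      have "- ((2 * w - 2 * x * (x / w)) / (w * w)) = 2 * (x * x - w * w) / w ^ 3"
        using w(1) by (simp add: field_simps power3_eq_cube)
      then show ?thesis unfolding w' by (simp add: power2_eq_square)
    qed
    have b: "((- j\<^sup>2) * w ^ 3 - (\<alpha> - x) * j\<^sup>2 * (3 * (x / w) * w\<^sup>2)) / (w ^ 3 * w ^ 3)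
       = - j\<^sup>2 / w ^ 3 - 3 * (\<alpha> - x) * j\<^sup>2 * x / w ^ 5"
      using w(1) by (simp add: field_simps eval_nat_numeral)
    show ?thesis unfolding a b by simp
  qed
  ultimately show "(Bf2 has_real_derivative Bf3 x) (at x)"
    unfolding Bf2_def[abs_def] Bf3_def w_def by simp
qed

lemma sqrt_r: "sqrt (r\<^sup>2 - j\<^sup>2) = p * q"
proof -
  have "r\<^sup>2 - j\<^sup>2 = (p * q)\<^sup>2" by (simp add: r_def j_def power2_eq_square field_simps)
  then show ?thesis using pq by simp
qed

lemma Bf_r: "Bf r = e * (p * q)" "Bf1 r = \<kappa> - \<delta> * r" "Bf2 r = - \<delta> - psi'"
  using kappa_eq pq
  by (simp_all add: Bf_def Bf1_def Bf2_def sqrt_r e_def[symmetric] psi'_def)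

definition mf :: "real^3 \<Rightarrow> real" where
  "mf s = c0 + g * (\<kappa> * (r + s $ 1) - Bf (r + s $ 1) * cos (2 * s $ 2) - \<delta> * (r + s $ 1)\<^sup>2 / 2)"

definition dmf :: "real^3 \<Rightarrow> real^3 \<Rightarrow> real" where
  "dmf s v = g * ((\<kappa> - \<delta> * (r + s $ 1) - Bf1 (r + s $ 1) * cos (2 * s $ 2)) * v $ 1
      + 2 * Bf (r + s $ 1) * sin (2 * s $ 2) * v $ 2)"

lemma f2_par_mf: "s \<in> pdom \<Longrightarrow> f2 (par s) = mf s"
  by (simp add: f2_par mf_def Bf_def)

lemma B_comp_deriv:
  assumes "s \<in> pdom"
  shows "((\<lambda>s. Bf (r + s $ 1)) has_derivative (\<lambda>v. Bf1 (r + s $ 1) * v $ 1)) (at s)"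
    "((\<lambda>s. Bf1 (r + s $ 1)) has_derivative (\<lambda>v. Bf2 (r + s $ 1) * v $ 1)) (at s)"
proof -
  have x: "\<bar>j\<bar> < r + s $ 1" using assms by (simp add: pdom_def)
  have i: "((\<lambda>s :: real^3. r + s $ 1) has_derivative (\<lambda>v. v $ 1)) (at s)"
    by (auto intro!: derivative_eq_intros nth_has_derivative)
  show "((\<lambda>s. Bf (r + s $ 1)) has_derivative (\<lambda>v. Bf1 (r + s $ 1) * v $ 1)) (at s)"
    "((\<lambda>s. Bf1 (r + s $ 1)) has_derivative (\<lambda>v. Bf2 (r + s $ 1) * v $ 1)) (at s)"
    using has_derivative_compose[OF i Bf_deriv(1)[OF x, unfolded has_field_derivative_def]]
      has_derivative_compose[OF i Bf_deriv(2)[OF x, unfolded has_field_derivative_def]] by simp_all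
qed

lemma mf_has_derivative:
  assumes "s \<in> pdom" shows "(mf has_derivative dmf s) (at s)"
  unfolding mf_def[abs_def] dmf_def[abs_def]
  by (rule has_derivative_eq_rhs,
      (rule derivative_intros nth_has_derivative B_comp_deriv[OF assms] | simp)+)
     (simp add: fun_eq_iff algebra_simps)

text \<open>With \<open>psi'\<close> = 0 the coefficient of v_1 w_1 vanishes, which leaves only the
  phase direction s_2. This gives the rank one required of a parabolic point.\<close>

lemma dmf_has_derivative:
  assumes "psi' = 0"
  shows "((\<lambda>s. dmf s v) has_derivative (\<lambda>w. g * (4 * Bf r * v $ 2 * w $ 2))) (at 0)"
proof -
  have "((\<lambda>s. dmf s v) has_derivative (\<lambda>w. g * ((- \<delta> * w $ 1 - Bf2 r * w $ 1) * v $ 1 + 4 * Bf r * w $ 2 * v $ 2))) (at 0)"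
    unfolding dmf_def
    by (rule has_derivative_eq_rhs,
      (rule derivative_intros nth_has_derivative B_comp_deriv[OF open_pdom(2)] | simp)+)
     (simp add: fun_eq_iff algebra_simps)
  then show ?thesis using assms by (simp add: Bf_r algebra_simps)
qed

lemma f2_par_has_derivative:
  assumes "s \<in> pdom" shows "((f2 \<circ> par) has_derivative dmf s) (at s)"
  by (rule has_derivative_transform_within_open[OF mf_has_derivative[OF assms] open_pdom(1) assms])
     (simp add: f2_par_mf)

lemma hessian_par:
  assumes "psi' = 0" shows "hessian (f2 \<circ> par) 0 v w = g * (4 * Bf r * v $ 2 * w $ 2)"
  using hessian_eqI[OF open_pdom f2_par_has_derivative dmf_has_derivative[OF assms]] by metis

lemma third_derivative_par:
  "(deriv ^^ 3) (\<lambda>t. f2 (par (t *\<^sub>R axis 1 1))) 0 = - g * Bf3 r"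
proof -
  define I where "I = {t. \<bar>j\<bar> < r + t \<and> r + t < \<alpha>}"
  have I: "open I" "0 \<in> I" unfolding I_def using rj
    by (auto intro!: open_Collect_conj open_Collect_less continuous_intros)
  have m: "mf (t *\<^sub>R axis 1 1) = c0 + g * (\<kappa> * (r + t) - Bf (r + t) - \<delta> * (r + t)\<^sup>2 / 2)" for t
    by (simp add: mf_def axis_def)
  have tp: "t *\<^sub>R axis 1 1 \<in> pdom" if "t \<in> I" for t
    using that by (simp add: pdom_def I_def axis_def)
  have d: "((\<lambda>t. c0 + g * (\<kappa> * (r + t) - Bf (r + t) - \<delta> * (r + t)\<^sup>2 / 2)) has_real_derivative
      g * (\<kappa> - Bf1 (r + t) - \<delta> * (r + t))) (at t)"
    "((\<lambda>t. g * (\<kappa> - Bf1 (r + t) - \<delta> * (r + t))) has_real_derivative g * (- Bf2 (r + t) - \<delta>)) (at t)"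
    "((\<lambda>t. g * (- Bf2 (r + t) - \<delta>)) has_real_derivative - g * Bf3 (r + t)) (at t)"
    if "t \<in> I" for t
  proof -
    have t: "\<bar>j\<bar> < r + t" using that by (simp add: I_def)
    have i: "((\<lambda>t. r + t) has_real_derivative 1) (at t)" by (auto intro!: derivative_eq_intros)
    note b = DERIV_chain2[OF Bf_deriv(1)[OF t] i] DERIV_chain2[OF Bf_deriv(2)[OF t] i] DERIV_chain2[OF Bf_deriv(3)[OF t] i]
    show "((\<lambda>t. c0 + g * (\<kappa> * (r + t) - Bf (r + t) - \<delta> * (r + t)\<^sup>2 / 2)) has_real_derivative
      g * (\<kappa> - Bf1 (r + t) - \<delta> * (r + t))) (at t)"
      "((\<lambda>t. g * (\<kappa> - Bf1 (r + t) - \<delta> * (r + t))) has_real_derivative g * (- Bf2 (r + t) - \<delta>)) (at t)"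
      "((\<lambda>t. g * (- Bf2 (r + t) - \<delta>)) has_real_derivative - g * Bf3 (r + t)) (at t)"
      by (auto intro!: derivative_eq_intros b)
  qed
  show ?thesis
  proof (rule deriv_funpow_3[OF I])
    fix t assume t: "t \<in> I"
    show "((\<lambda>t. f2 (par (t *\<^sub>R axis 1 1))) has_real_derivative g * (\<kappa> - Bf1 (r + t) - \<delta> * (r + t))) (at t)"
      by (rule has_field_derivative_transform_within_open[OF d(1)[OF t] I(1) t])
         (simp add: f2_par_mf[OF tp] m)
    show "((\<lambda>t. g * (\<kappa> - Bf1 (r + t) - \<delta> * (r + t))) has_real_derivative g * (- Bf2 (r + t) - \<delta>)) (at t)"
      by (rule d(2)[OF t])
  qed (use d(3)[OF I(2)] in simp)
qed

text \<open>On real vectors, in the basis (q, -p), (p, q), the form has first diagonal entry A = 0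
  and off-diagonal entry cc \<noteq> 0, so it is nondegenerate there. The imaginary block has
  exactly the orbit line as kernel.\<close>

lemma form_kernel_x0:
  assumes "psi' = 0" "j \<noteq> 0"
  shows "form_kernel form = span {vector [\<i> * of_real p, \<i> * of_real q]}"
proof (intro equalityI subsetI)
  fix v assume v: "v \<in> form_kernel form"
  have A0: "A = 0" using assms by (simp add: A_psi)
  define a b where "a = (q * Re (v $ 1) - p * Re (v $ 2)) / (2 * r)" and "b = (p * Re (v $ 1) + q * Re (v $ 2)) / (2 * r)"
  have r: "2 * r = p\<^sup>2 + q\<^sup>2" "0 < r" using rj by (auto simp: r_def)
  have ab: "Re (v $ 1) = a * q + b * p" "Re (v $ 2) = b * q - a * p"
  proof -
    have "2 * r * a = q * Re (v $ 1) - p * Re (v $ 2)" "2 * r * b = p * Re (v $ 1) + q * Re (v $ 2)"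
      using r(2) by (simp_all add: a_def b_def)
    then have "2 * r * (a * q + b * p) = 2 * r * Re (v $ 1)" "2 * r * (b * q - a * p) = 2 * r * Re (v $ 2)"
      using r(1) by algebra+
    then show "Re (v $ 1) = a * q + b * p" "Re (v $ 2) = b * q - a * p" using r by auto
  qed
  \<comment> \<open>The value of \<open>form\<close> on the pair (q, -p), (p, q), as
    \<open>mix\<close> shows; the bracket is positive, so j \<noteq> 0 makes it nonzero.\<close>
  define cc where "cc = - 4 * j * (e * r\<^sup>2 / (p * q)\<^sup>2 + r)"
  have mix: "e / (p * q) * (q\<^sup>2 - p\<^sup>2) * (2 * p * q) - (q\<^sup>2 - p\<^sup>2) * (p\<^sup>2 + q\<^sup>2) - \<delta> * (- 2 * p * q) * (q\<^sup>2 - p\<^sup>2) = cc"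
  proof -
    have dl: "\<delta> = 2 * r / (p * q) + e * j\<^sup>2 / (p * q) ^ 3" using assms(1) by (simp add: psi'_def)
    have "\<delta> * (p * q) = 2 * r + e * j\<^sup>2 / (p * q)\<^sup>2"
      unfolding dl using pq by (simp add: field_simps power2_eq_square power3_eq_cube)
    moreover have "q\<^sup>2 - p\<^sup>2 = - 2 * j" by (simp add: j_def)
    moreover have "e / (p * q) * (- 2 * j) * (2 * p * q) = - 4 * e * j" using pq by simp
    moreover have "r\<^sup>2 = (p * q)\<^sup>2 + j\<^sup>2" by (simp add: r_def j_def power2_eq_square field_simps)
    then have "e * r\<^sup>2 / (p * q)\<^sup>2 = e + e * j\<^sup>2 / (p * q)\<^sup>2" using pq by (simp add: field_simps)
    ultimately show ?thesis unfolding r(1)[symmetric] cc_def by algebra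
  qed
  have cc0: "cc \<noteq> 0"
    using assms r pq e_pos by (auto simp: cc_def add_nonneg_pos intro!: less_imp_neq[THEN not_sym] add_nonneg_pos)
  define eh where "eh = e / (p * q)"
  have E10: "Re (E 1 0 $ 1) = q" "Re (E 1 0 $ 2) = - p" "Im (E 1 0 $ 1) = 0" "Im (E 1 0 $ 2) = 0"
    by (simp_all add: E_def)
  have "form v (E 1 0) = a * A + b * cc"
    unfolding mix[symmetric] A_def form_def dR_x0 dX_x0 ab E10 eh_def[symmetric] by algebra
  then have b0: "b = 0" using v A0 cc0 by (auto simp: form_kernel_def)
  have "form v (vector [of_real p, of_real q]) = a * cc"
    unfolding mix[symmetric] form_def dR_x0 dX_x0 ab b0 eh_def[symmetric] by simp algebra
  then have a0: "a = 0" using v cc0 by (auto simp: form_kernel_def)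
  have "form v (E 0 1) = e / (p * q) * (q * Im (v $ 1) - p * Im (v $ 2)) * (p\<^sup>2 + q\<^sup>2)"
    by (simp add: form_def dR_x0 dX_x0 ab b0 a0 E_def power2_eq_square algebra_simps)
  moreover have "form v (E 0 1) = 0" using v by (auto simp: form_kernel_def)
  ultimately have "q * Im (v $ 1) - p * Im (v $ 2) = 0" using pq e_pos r by auto
  then have "v = (Im (v $ 1) / p) *\<^sub>R vector [\<i> * of_real p, \<i> * of_real q]"
    using ab a0 b0 pq by (simp add: vec_eq_iff forall_2 complex_eq_iff field_simps)
  then show "v \<in> span {vector [\<i> * of_real p, \<i> * of_real q]}" by (auto simp: span_singleton)
next
  fix v assume "v \<in> span {vector [\<i> * complex_of_real p, \<i> * of_real q] :: complex^2}"
  then show "v \<in> form_kernel form"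
    by (auto simp: span_singleton form_kernel_def form_def dR_x0 dX_x0)
qed

lemma parabolic_x0:
  assumes "psi' = 0" "j \<noteq> 0"
  shows "parabolic_at f1 f2 x0"
proof -
  have "parabolic_normal_at f1 f2 x0"
    unfolding parabolic_normal_at_def
  proof (intro conjI exI bexI)
    show "differential f1 x0 (axis 1 1) \<noteq> 0"
      using pq by (simp add: differential_f[OF x0_dom] dJ_x0 axis_def)
    show "open pdom" "0 \<in> pdom" "smooth_on pdom par" "par 0 = x0" "inj (frechet_derivative par (at 0))"
      using open_pdom par_smooth par_0 par_inj by auto
    show "\<forall>s\<in>pdom. f1 (par s) = f1 x0"
      using f1_par open_pdom par_0 by metis
    have "differential (f2 \<circ> par) 0 = dmf 0" by (rule differential_eq[OF f2_par_has_derivative[OF open_pdom(2)]])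
    then show "\<forall>v. differential (f2 \<circ> par) 0 v = 0" by (simp add: dmf_def Bf_r)
    have Bp: "0 < Bf r" using e_pos pq by (simp add: Bf_r)
    have ker: "form_kernel (hessian (f2 \<circ> par) 0) = {v. axis 2 1 \<bullet> v = 0}"
    proof -
      have "(\<forall>w::real^3. w $ 2 = 0) = False" by (metis axis_nth zero_neq_one)
      then show ?thesis using g_pos Bp
        by (auto simp: form_kernel_def hessian_par[OF assms(1)] inner_axis' dest: spec[of _ "axis 2 1"])
    qed
    have "dim {v :: real^3. axis 2 1 \<bullet> v = 0} = DIM(real^3) - 1"
      by (rule dim_hyperplane) (simp add: axis_eq_0_iff)
    then show "form_rank (hessian (f2 \<circ> par) 0) = 1"
      unfolding form_rank_def ker by simp
    show "axis 1 1 \<in> form_kernel (hessian (f2 \<circ> par) 0)" by (simp add: ker inner_axis_axis)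
    show "smooth_at 0 (\<lambda>t. t *\<^sub>R axis 1 (1::real) :: real^3)"
      unfolding smooth_at_def smooth_on_def
      by (intro exI[of _ UNIV]) (auto intro!: Ck_on_linear bounded_linear_scaleR_left)
    show "((\<lambda>t. t *\<^sub>R axis 1 (1::real) :: real^3) has_vector_derivative axis 1 1) (at 0)"
      by (auto intro!: derivative_eq_intros)
    \<comment> \<open>Both summands of \<open>Bf3 r\<close> carry the factor j^2, so the third
      derivative in the radial direction is nonzero because j is.\<close>
    have "0 < Bf3 r" unfolding Bf3_def sqrt_r e_def[symmetric]
      using assms pq e_pos rj by (auto intro!: add_pos_pos divide_pos_pos mult_pos_pos)
    then show "(deriv ^^ 3) (\<lambda>t. f2 (par (t *\<^sub>R axis 1 1))) 0 \<noteq> 0"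
      using g_pos by (simp add: third_derivative_par)
    show "\<forall>v. differential f2 x0 v = (g * k) * differential f1 x0 v"
      by (simp add: differential_f[OF x0_dom] dH_x0)
    have h: "hessian (\<lambda>y. f2 y - g * k * f1 y) x0 = (\<lambda>v w. g * form v w)"
      using hessian_comb[OF x0_dom, of "- (g * k)" 1] ddH_form by (simp add: fun_eq_iff algebra_simps)
    have "form_kernel (hessian (\<lambda>y. f2 y - g * k * f1 y) x0) = form_kernel form"
      using g_pos by (simp add: h form_kernel_def)
    moreover have "(vector [\<i> * of_real p, \<i> * of_real q] :: complex^2) \<noteq> 0"
      using pq by (auto simp: vec_eq_iff forall_2)
    ultimately show "form_rank (hessian (\<lambda>y. f2 y - g * k * f1 y) x0) = 3"
      by (simp add: form_rank_def form_kernel_x0[OF assms] dim_span dim_singleton)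
  qed simp
  then show ?thesis
    unfolding parabolic_at_def using local_diffeo_at_ident by (intro exI[of _ "\<lambda>z. z"]) auto
qed

end

section \<open>The elliptic-elliptic point\<close>

context flap_chart
begin

text \<open>The linear Hamiltonian vector field of a J + c (\<kappa> R + \<alpha> X) with X = Re(u_1
  u_2), the quadratic parts of J and H/g at B; see \<open>omega_lin_ham\<close>.\<close>

definition lin_ham :: "real \<Rightarrow> real \<Rightarrow> complex^2 \<Rightarrow> complex^2" where
  "lin_ham a c u = vector [- \<i> * (of_real a * u $ 1) - \<i> * of_real c * (of_real \<kappa> * u $ 1 + of_real \<alpha> * cnj (u $ 2)),
     \<i> * (of_real a * u $ 2) - \<i> * of_real c * (of_real \<kappa> * u $ 2 + of_real \<alpha> * cnj (u $ 1))]"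

lemma zero_dom: "0 \<in> dom" using alpha_pos by (simp add: dom_def)

lemma ddH_0: "ddH 0 v w = g * (\<kappa> * (v \<bullet> w) + \<alpha> * dX v w)"
  by (simp add: ddH_def dX_def Xc_def Rc_def inner_commute algebra_simps)

lemma lin_ham_linear: "linear (lin_ham a c)"
  by (rule linearI) (simp_all add: lin_ham_def vec_eq_iff forall_2 complex_eq_iff algebra_simps)

lemma omega_lin_ham: "omega (lin_ham a c u) v = a * dJ u v + c * (\<kappa> * (u \<bullet> v) + \<alpha> * dX u v)"
  by (simp add: omega_2 lin_ham_def dJ_def dX_def inner_2 inner_complex_def algebra_simps)

lemma omega_nondegenerate:
  assumes "\<And>v. omega x v = omega (y :: complex^2) v" shows "x = y"
proof -
  have "omega x (axis i z) = Im (cnj (x $ i) * z)" for x :: "complex^2" and i z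
    using exhaust_2[of i] by (auto simp: omega_2 axis_def)
  then have "Im (cnj (x $ i) * z) = Im (cnj (y $ i) * z)" for i z using assms by metis
  from this[of _ 1] this[of _ \<i>] show ?thesis by (simp add: vec_eq_iff complex_eq_iff)
qed

lemma omega_skew: "omega u v = - omega v (u :: complex^2)"
  by (simp add: omega_2)

lemma span_lin_ham: "hamiltonian_span dJ (ddH 0) = {lin_ham a c | a c. True}"
proof (intro equalityI subsetI)
  fix A assume "A \<in> hamiltonian_span dJ (ddH 0)"
  then obtain a c where "\<And>u v. omega (A u) v = a * dJ u v + c * ddH 0 u v"
    by (auto simp: hamiltonian_span_def)
  then have "omega (A u) v = omega (lin_ham a (c * g) u) v" for u v
    by (simp add: omega_lin_ham ddH_0)
  then have "A = lin_ham a (c * g)" using omega_nondegenerate by blast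
  then show "A \<in> {lin_ham a c | a c. True}" by blast
next
  fix A assume "A \<in> {lin_ham a c | a c. True}"
  then obtain a c where A: "A = lin_ham a c" by blast
  have "omega (A u) v = a * dJ u v + (c / g) * ddH 0 u v" for u v
    using g_pos by (simp add: A omega_lin_ham ddH_0)
  then show "A \<in> hamiltonian_span dJ (ddH 0)"
    using lin_ham_linear unfolding hamiltonian_span_def A by blast
qed

lemma lin_ham_commute: "lin_ham a c (lin_ham a' c' u) = lin_ham a' c' (lin_ham a c u)"
  by (simp add: lin_ham_def vec_eq_iff forall_2 complex_eq_iff algebra_simps)

lemma lin_ham_bracket: "lie_bracket (lin_ham a c) (lin_ham a' c') = (\<lambda>_. 0)"
  by (simp add: lie_bracket_def fun_eq_iff lin_ham_commute[of a c])

lemma lin_ham_zero: "lin_ham 0 0 = (\<lambda>_. 0)"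
  by (simp add: lin_ham_def fun_eq_iff vec_eq_iff forall_2)

lemma lin_ham_add: "(\<lambda>u. lin_ham a c u + lin_ham a' c' u) = lin_ham (a + a') (c + c')"
  by (simp add: lin_ham_def fun_eq_iff vec_eq_iff forall_2 algebra_simps)

lemma lin_ham_scale: "(\<lambda>u. t *\<^sub>R lin_ham a c u) = lin_ham (t * a) (t * c)"
  by (simp add: lin_ham_def fun_eq_iff vec_eq_iff forall_2 complex_eq_iff algebra_simps)

lemma lin_ham_sp: "lin_ham a c \<in> sp_algebra"
proof -
  have "dJ u v = dJ v u" "u \<bullet> v = v \<bullet> u" "dX u v = dX v u" for u v
    by (auto simp: dJ_def inner_commute dX_commute)
  then have "omega (lin_ham a c u) v = omega (lin_ham a c v) u" for u v
    unfolding omega_lin_ham by metis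
  then have "omega (lin_ham a c u) v + omega u (lin_ham a c v) = 0" for u v
    using omega_skew[of u "lin_ham a c v"] by simp
  then show ?thesis using lin_ham_linear by (simp add: sp_algebra_def)
qed

lemma lin_ham_J_sq: "lin_ham 1 0 (lin_ham 1 0 u) = - 1 *\<^sub>R u"
  by (simp add: lin_ham_def vec_eq_iff forall_2 complex_eq_iff)

lemma lin_ham_H_sq: "lin_ham 0 1 (lin_ham 0 1 u) = - (\<kappa>\<^sup>2 - \<alpha>\<^sup>2) *\<^sub>R u"
  by (simp add: lin_ham_def vec_eq_iff forall_2 complex_eq_iff algebra_simps power2_eq_square)

text \<open>If \<open>C = [A, K]\<close> commutes with \<open>K\<close> and \<open>K\<^sup>2\<close> is scalar, then \<open>0 = [A, K\<^sup>2] = 2 K C\<close>.\<close>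

lemma normalizer_commutes:
  assumes A: "linear A" and K: "\<And>u. lin_ham a c (lin_ham a c u) = - m *\<^sub>R u" "m \<noteq> 0"
    and C: "lie_bracket A (lin_ham a c) = lin_ham a' c'"
  shows "A (lin_ham a c u) = lin_ham a c (A u)"
proof -
  have lin: "linear (lin_ham a c)" by (rule lin_ham_linear)
  have C': "A (lin_ham a c u) - lin_ham a c (A u) = lin_ham a' c' u" for u using C by (metis lie_bracket_def)
  have "A (- m *\<^sub>R u) - lin_ham a c (A (lin_ham a c u)) = lin_ham a' c' (lin_ham a c u)"
    using C'[of "lin_ham a c u"] K by simp
  then have 1: "(- m) *\<^sub>R A u - lin_ham a c (A (lin_ham a c u)) = lin_ham a c (lin_ham a' c' u)"
    using A by (simp only: linear_cmul lin_ham_commute)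
  have 2: "lin_ham a c (A (lin_ham a c u)) - (- m) *\<^sub>R A u = lin_ham a c (lin_ham a' c' u)"
  proof -
    have "lin_ham a c (A (lin_ham a c u) - lin_ham a c (A u)) = lin_ham a c (lin_ham a' c' u)" by (simp only: C')
    then show ?thesis by (simp only: linear_diff[OF lin] K(1))
  qed
  have "lin_ham a c (lin_ham a' c' u) = - lin_ham a c (lin_ham a' c' u)"
    using 1 2 minus_diff_eq[of "lin_ham a c (A (lin_ham a c u))" "(- m) *\<^sub>R A u"] by simp
  then have "lin_ham a c (lin_ham a' c' u) = 0" by (simp add: vec_eq_iff)
  then have "lin_ham a c (lin_ham a c (lin_ham a' c' u)) = 0" using lin by (simp add: linear_0)
  then have "lin_ham a' c' u = 0" using K by simp
  then show ?thesis using C'[of u] by simp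
qed

text \<open>The algebra is abelian. An element A of its normalizer commutes with both generators,
  whose squares are nonzero scalars because \<alpha> < \<kappa>. So A is determined by its value on
  e_1, from which the generators produce all of C^2. The symplectic condition makes both entries of
  A e_1 imaginary, and the two remaining real parameters are those of the algebra.\<close>

lemma cartan: "cartan_subalgebra {lin_ham a c | a c. True}"
  unfolding cartan_subalgebra_def
proof (intro conjI ballI allI)
  let ?h = "{lin_ham a c | a c. True}"
  show "?h \<subseteq> sp_algebra" using lin_ham_sp by auto
  show "(\<lambda>_. 0) \<in> ?h" using lin_ham_zero by (metis (mono_tags) mem_Collect_eq)
  show "(\<lambda>u. A u + B u) \<in> ?h" if "A \<in> ?h" "B \<in> ?h" for A B
    using that by clarsimp (metis lin_ham_add)
  show "(\<lambda>u. t *\<^sub>R A u) \<in> ?h" if "A \<in> ?h" for A t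
    using that by clarsimp (metis lin_ham_scale)
  show "lie_bracket A B \<in> ?h" if "A \<in> ?h" "B \<in> ?h" for A B
    using that by clarsimp (simp only: lin_ham_bracket, intro exI, rule lin_ham_zero[symmetric])
  show "\<exists>n. \<forall>As B. set As \<subseteq> ?h \<and> length As = n \<and> B \<in> ?h \<longrightarrow> foldr lie_bracket As B = (\<lambda>_. 0)"
  proof (intro exI[of _ 1] allI impI)
    fix As B assume a: "set As \<subseteq> ?h \<and> length As = 1 \<and> B \<in> ?h"
    then obtain A where "As = [A]" by (auto simp: length_Suc_conv)
    then show "foldr lie_bracket As B = (\<lambda>_. 0)" using a lin_ham_bracket by auto
  qed
  show "{A \<in> sp_algebra. \<forall>B\<in>?h. lie_bracket A B \<in> ?h} = ?h"
  proof (intro equalityI subsetI)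
    fix A assume "A \<in> ?h"
    then show "A \<in> {A \<in> sp_algebra. \<forall>B\<in>?h. lie_bracket A B \<in> ?h}"
      using lin_ham_sp by clarsimp (simp only: lin_ham_bracket, intro exI, rule lin_ham_zero[symmetric])
  next
    fix A assume "A \<in> {A \<in> sp_algebra. \<forall>B\<in>?h. lie_bracket A B \<in> ?h}"
    then have sp': "A \<in> sp_algebra" and N': "\<forall>B\<in>?h. lie_bracket A B \<in> ?h" by auto
    then have lin: "linear A" and sp: "\<And>u v. omega (A u) v + omega u (A v) = 0"
      by (auto simp: sp_algebra_def)
    have N: "lie_bracket A (lin_ham a c) \<in> ?h" for a c using N' by blast
    have m: "\<kappa>\<^sup>2 - \<alpha>\<^sup>2 \<noteq> 0" using alpha_less alpha_pos by (simp add: power2_eq_iff)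
    obtain a1 c1 a2 c2 where "lie_bracket A (lin_ham 1 0) = lin_ham a1 c1" "lie_bracket A (lin_ham 0 1) = lin_ham a2 c2"
      using N[of 1 0] N[of 0 1] by auto
    then have AJ: "A (lin_ham 1 0 u) = lin_ham 1 0 (A u)" and AH: "A (lin_ham 0 1 u) = lin_ham 0 1 (A u)" for u
      using normalizer_commutes[OF lin lin_ham_J_sq] normalizer_commutes[OF lin lin_ham_H_sq m] by auto
    define P Q where "P = A (axis 1 1) $ 1" and "Q = A (axis 1 1) $ 2"
    have Ai: "A (axis 1 \<i>) = vector [\<i> * P, - \<i> * Q]"
    proof -
      have "axis 1 \<i> = - lin_ham 1 0 (axis 1 1)" by (simp add: lin_ham_def vec_eq_iff forall_2 axis_def)
      then have "A (axis 1 \<i>) = - lin_ham 1 0 (A (axis 1 1))" using lin AJ by (simp add: linear_neg)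
      then show ?thesis by (simp add: lin_ham_def vec_eq_iff forall_2 P_def Q_def)
    qed
    have A2: "A (axis 2 \<i>) $ 1 = \<i> * cnj Q"
    proof -
      have ax: "axis 2 \<i> = (- 1 / \<alpha>) *\<^sub>R (lin_ham 0 1 (axis 1 1) + \<kappa> *\<^sub>R axis 1 \<i>)"
        using alpha_pos by (simp add: lin_ham_def vec_eq_iff forall_2 axis_def complex_eq_iff)
      then have "A (axis 2 \<i>) = (- 1 / \<alpha>) *\<^sub>R (lin_ham 0 1 (A (axis 1 1)) + \<kappa> *\<^sub>R A (axis 1 \<i>))"
        by (simp only: ax linear_cmul[OF lin] linear_add[OF lin] AH)
      then show ?thesis using alpha_pos
        by (simp add: Ai) (simp add: lin_ham_def P_def Q_def complex_eq_iff field_simps)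
    qed
    have P0: "Re P = 0"
      using sp[of "axis 1 1" "axis 1 \<i>"] unfolding Ai by (simp add: omega_2 P_def axis_def)
    have Q0: "Re Q = 0"
    proof -
      have "omega x (axis 2 \<i>) = Re (x $ 2)" "omega (axis 1 1) x = Im (x $ 1)" for x :: "complex^2"
        by (simp_all add: omega_2 axis_def)
      then show ?thesis using sp[of "axis 1 1" "axis 2 \<i>"] by (simp add: A2 Q_def[symmetric])
    qed
    \<comment> \<open>The values of y and x for which \<open>lin_ham x y\<close> agrees with A on
      e_1.\<close>
    define y where "y = - Im Q / \<alpha>"
    define x where "x = - Im P - y * \<kappa>"
    define B where "B u = A u - lin_ham x y u" for u
    have Bl: "linear B" unfolding B_def by (intro linear_compose_sub lin lin_ham_linear)
    have BJ: "B (lin_ham 1 0 u) = lin_ham 1 0 (B u)" and BH: "B (lin_ham 0 1 u) = lin_ham 0 1 (B u)" for u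
      by (simp_all add: B_def AJ AH linear_diff[OF lin_ham_linear] lin_ham_commute[of x y])
    have L0: "lin_ham a c 0 = 0" for a c by (rule linear_0[OF lin_ham_linear])
    have b1: "B (axis 1 1) = 0"
      using P0 Q0 alpha_pos
      by (simp add: B_def vec_eq_iff forall_2 P_def[symmetric] Q_def[symmetric])
        (simp add: lin_ham_def axis_def complex_eq_iff x_def y_def)
    have b2: "B (axis 1 \<i>) = 0"
    proof -
      have "axis 1 \<i> = - lin_ham 1 0 (axis 1 1)" by (simp add: lin_ham_def vec_eq_iff forall_2 axis_def)
      then show ?thesis using Bl b1 by (simp add: linear_neg BJ L0)
    qed
    have b3: "B (axis 2 \<i>) = 0"
    proof -
      have ax: "axis 2 \<i> = (- 1 / \<alpha>) *\<^sub>R (lin_ham 0 1 (axis 1 1) + \<kappa> *\<^sub>R axis 1 \<i>)"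
        using alpha_pos by (simp add: lin_ham_def vec_eq_iff forall_2 axis_def complex_eq_iff)
      then show ?thesis by (simp only: linear_cmul[OF Bl] linear_add[OF Bl] BH b1 b2 L0) simp
    qed
    have b4: "B (axis 2 1) = 0"
    proof -
      have "axis 2 1 = - lin_ham 1 0 (axis 2 \<i>)" by (simp add: lin_ham_def vec_eq_iff forall_2 axis_def)
      then show ?thesis using Bl b3 by (simp add: linear_neg BJ L0)
    qed
    have "B u = 0" for u
    proof -
      have "u = Re (u $ 1) *\<^sub>R axis 1 1 + Im (u $ 1) *\<^sub>R axis 1 \<i> + Re (u $ 2) *\<^sub>R axis 2 1 + Im (u $ 2) *\<^sub>R axis 2 \<i>"
        by (simp add: vec_eq_iff forall_2 axis_def complex_eq_iff)
      then have "B u = Re (u $ 1) *\<^sub>R B (axis 1 1) + Im (u $ 1) *\<^sub>R B (axis 1 \<i>) + Re (u $ 2) *\<^sub>R B (axis 2 1) + Im (u $ 2) *\<^sub>R B (axis 2 \<i>)"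
        by (metis (no_types, lifting) linear_add[OF Bl] linear_cmul[OF Bl])
      then show ?thesis by (simp add: b1 b2 b3 b4)
    qed
    then have "A = lin_ham x y" by (auto simp: B_def)
    then show "A \<in> ?h" by blast
  qed
qed

text \<open>A hyperbolic rotation S mixing u_1 with the conjugate of u_2 preserves J and turns
  \<kappa> R + \<alpha> Re(u_1 u_2) into D R. The combinations of R and J are those of the two
  elliptic blocks.\<close>

lemma elliptic_elliptic_0: "elliptic_elliptic_at f1 f2 0"
proof -
  define D where "D = sqrt (\<kappa>\<^sup>2 - \<alpha>\<^sup>2)"
  have "\<alpha>\<^sup>2 < \<kappa>\<^sup>2" using alpha_less alpha_pos by (intro power_strict_mono) auto
  then have D: "0 < D" "D\<^sup>2 = \<kappa>\<^sup>2 - \<alpha>\<^sup>2" by (simp_all add: D_def)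
  have Dk: "D \<le> \<kappa>" using D alpha_less alpha_pos by (intro power2_le_imp_le[of D \<kappa>]) auto
  \<comment> \<open>\<open>c = cosh \<theta>\<close>, \<open>s = sinh \<theta>\<close> with \<open>tanh (2 \<theta>) = - \<alpha> / \<kappa>\<close>, which removes the term \<open>Re (u\<^sub>1 u\<^sub>2)\<close>.\<close>
  define c s where "c = sqrt ((\<kappa> / D + 1) / 2)" and "s = - sqrt ((\<kappa> / D - 1) / 2)"
  have k1: "1 \<le> \<kappa> / D" using D Dk by simp
  have c2: "c\<^sup>2 = (\<kappa> / D + 1) / 2" "s\<^sup>2 = (\<kappa> / D - 1) / 2" using k1 by (simp_all add: c_def s_def)
  have cs: "2 * (c * s) = - \<alpha> / D"
  proof -
    have "c * s = - sqrt ((\<kappa> / D + 1) / 2 * ((\<kappa> / D - 1) / 2))" unfolding c_def s_def real_sqrt_mult by simp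
    also have "(\<kappa> / D + 1) / 2 * ((\<kappa> / D - 1) / 2) = (\<alpha> / (2 * D))\<^sup>2"
    proof -
      have "(\<kappa> / D + 1) / 2 * ((\<kappa> / D - 1) / 2) = (\<kappa>\<^sup>2 - D\<^sup>2) / (2 * D)\<^sup>2"
        using D(1) by (simp add: field_simps power2_eq_square)
      then show ?thesis unfolding D(2) by (simp add: power_divide)
    qed
    finally show ?thesis using D alpha_pos by simp
  qed
  have one: "c\<^sup>2 - s\<^sup>2 = 1" and sum: "c\<^sup>2 + s\<^sup>2 = \<kappa> / D" using c2 by (simp_all add: field_simps)
  define S :: "complex^2 \<Rightarrow> complex^2" where
    "S u = vector [of_real c * u $ 1 + of_real s * cnj (u $ 2), of_real c * u $ 2 + of_real s * cnj (u $ 1)]" for u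
  have "linear S"
    by (rule linearI) (simp_all add: S_def vec_eq_iff forall_2 complex_eq_iff algebra_simps)
  moreover have "omega (S u) (S v) = omega u v" for u v
  proof -
    have "omega (S u) (S v) = (c\<^sup>2 - s\<^sup>2) * omega u v"
      by (simp add: omega_2 S_def power2_eq_square algebra_simps)
    then show ?thesis by (simp add: one)
  qed
  ultimately have S: "symplectic_map S" by (auto simp: symplectic_map_def)
  have J: "dJ (S u) (S u) = (cmod (u $ 1))\<^sup>2 - (cmod (u $ 2))\<^sup>2" for u
  proof -
    have "dJ (S u) (S u) = (c\<^sup>2 - s\<^sup>2) * ((cmod (u $ 1))\<^sup>2 - (cmod (u $ 2))\<^sup>2)"
      unfolding cmod_power2 by (simp add: dJ_def S_def inner_complex_def power2_eq_square algebra_simps)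
    then show ?thesis by (simp add: one)
  qed
  have H: "ddH 0 (S u) (S u) = g * D * ((cmod (u $ 1))\<^sup>2 + (cmod (u $ 2))\<^sup>2)" for u
  proof -
    have "\<kappa> * (S u \<bullet> S u) + \<alpha> * dX (S u) (S u) = (\<kappa> * (c\<^sup>2 + s\<^sup>2) + \<alpha> * (2 * (c * s))) * ((cmod (u $ 1))\<^sup>2 + (cmod (u $ 2))\<^sup>2)
       + 2 * (\<kappa> * (2 * (c * s)) + \<alpha> * (c\<^sup>2 + s\<^sup>2)) * Re (u $ 1 * u $ 2)"
      unfolding cmod_power2 by (simp add: dX_def S_def inner_2 inner_complex_def power2_eq_square algebra_simps)
    also have "\<kappa> * (2 * (c * s)) + \<alpha> * (c\<^sup>2 + s\<^sup>2) = 0" unfolding cs sum by simp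
    also have "\<kappa> * (c\<^sup>2 + s\<^sup>2) + \<alpha> * (2 * (c * s)) = D\<^sup>2 / D" unfolding cs sum D(2) by (simp add: power2_eq_square diff_divide_distrib)
    finally show ?thesis using D(1) by (simp add: ddH_0 power2_eq_square)
  qed
  have "{\<lambda>u. a * dJ (S u) (S u) + b * ddH 0 (S u) (S u) | a b. True} =
        {\<lambda>u. a * (cmod (u $ 1))\<^sup>2 + b * (cmod (u $ 2))\<^sup>2 | a b. True}" (is "?X = ?Y")
  proof (intro equalityI subsetI)
    fix f assume "f \<in> ?X"
    then obtain a b where "f = (\<lambda>u. a * dJ (S u) (S u) + b * ddH 0 (S u) (S u))" by blast
    then have "f = (\<lambda>u. (a + b * (g * D)) * (cmod (u $ 1))\<^sup>2 + (b * (g * D) - a) * (cmod (u $ 2))\<^sup>2)"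
      unfolding J H by (simp add: fun_eq_iff algebra_simps)
    then show "f \<in> ?Y" by blast
  next
    fix f assume "f \<in> ?Y"
    then obtain a b where "f = (\<lambda>u :: complex^2. a * (cmod (u $ 1))\<^sup>2 + b * (cmod (u $ 2))\<^sup>2)" by blast
    moreover have "a * m + b * n = (a - b) / 2 * (m - n) + (a + b) / (2 * (g * D)) * (g * D * (m + n))" for m n
    proof -
      have "(a + b) / (2 * (g * D)) * (g * D * (m + n)) = (a + b) / 2 * (m + n)" using g_pos D by simp
      then show ?thesis by (simp add: field_simps)
    qed
    ultimately have "f = (\<lambda>u. (a - b) / 2 * dJ (S u) (S u) + (a + b) / (2 * (g * D)) * ddH 0 (S u) (S u))"
      unfolding J H by simp
    then show "f \<in> ?X" by blast
  qed
  moreover have "rank_zero_at f1 f2 0"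
    unfolding rank_zero_at_def differential_f[OF zero_dom] by (simp add: dJ_def dH_def dX_def)
  ultimately show ?thesis
    unfolding elliptic_elliptic_at_def nondegenerate_zero_at_def hessian_f[OF zero_dom] span_lin_ham
    using S cartan by blast
qed

end

section \<open>Critical points on the level set\<close>

lemma inner_3: "(u :: 'a::real_inner ^ 3) \<bullet> v = u $ 1 \<bullet> v $ 1 + u $ 2 \<bullet> v $ 2 + u $ 3 \<bullet> v $ 3"
  by (simp add: inner_vec_def sum_3)

definition lift' :: "real \<Rightarrow> 3 \<Rightarrow> complex^2 \<Rightarrow> complex^2 \<Rightarrow> complex^3" where
  "lift' \<alpha> k u v =
     (let r = complex_of_real (- (u \<bullet> v) / sqrt (2 * \<alpha> - (norm u)\<^sup>2)) in
      if k = 1 then vector [r, v $ 1, v $ 2]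
      else if k = 2 then vector [v $ 1, r, v $ 2]
      else vector [v $ 1, v $ 2, r])"

lemma norm_lt_sqrt:
  assumes "norm u < sqrt b" shows "(norm u)\<^sup>2 < b"
proof -
  have "0 < sqrt b" using assms norm_ge_zero[of u] by linarith
  then show ?thesis using power_strict_mono[OF assms, of 2] by simp
qed

lemma N_ham_lift: "norm u < sqrt (2 * \<alpha>) \<Longrightarrow> N_ham (affine_lift \<alpha> k u) = \<alpha>"
  using norm_lt_sqrt[of u "2 * \<alpha>"] exhaust_3[of k]
  by (auto simp: N_ham_def affine_lift_def Let_def norm_sq_2)

lemma lift_has_derivative:
  assumes "norm u < sqrt (2 * \<alpha>)"
  shows "(affine_lift \<alpha> k has_derivative lift' \<alpha> k u) (at u)"
proof -
  have pos: "0 < 2 * \<alpha> - (norm u)\<^sup>2" using norm_lt_sqrt[OF assms] by simp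
  have "((\<lambda>u :: complex^2. 2 * \<alpha> - (norm u)\<^sup>2) has_derivative (\<lambda>v. - 2 * (u \<bullet> v))) (at u)"
    unfolding power2_norm_eq_inner by (auto intro!: derivative_eq_intros simp: inner_commute)
  from has_derivative_compose[OF this DERIV_real_sqrt[OF pos, unfolded has_field_derivative_def]]
  have "((\<lambda>u :: complex^2. sqrt (2 * \<alpha> - (norm u)\<^sup>2)) has_derivative (\<lambda>v. - (u \<bullet> v) / sqrt (2 * \<alpha> - (norm u)\<^sup>2))) (at u)"
    by (rule has_derivative_eq_rhs) (simp add: fun_eq_iff field_simps)
  from has_derivative_of_real[OF this]
  have r: "((\<lambda>u :: complex^2. complex_of_real (sqrt (2 * \<alpha> - (norm u)\<^sup>2))) has_derivative
     (\<lambda>v. of_real (- (u \<bullet> v) / sqrt (2 * \<alpha> - (norm u)\<^sup>2)))) (at u)" .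
  have "((\<lambda>u. affine_lift \<alpha> k u $ i) has_derivative (\<lambda>v. lift' \<alpha> k u v $ i)) (at u)" for i
    using exhaust_3[of i] exhaust_3[of k] r nth_has_derivative[of 1 u] nth_has_derivative[of 2 u]
    by (auto simp: affine_lift_def lift'_def Let_def)
  then show ?thesis by (rule has_derivative_vec)
qed

text \<open>The tangent space of the sphere N = \<alpha> is the image of the derivative of the lift
  plus the direction i z of the flow of N. Conditions on differentials in a chart thus become
  conditions on C^3 that no longer depend on the chart.\<close>

lemma lift_onto:
  assumes "norm u < sqrt (2 * \<alpha>)" and "affine_lift \<alpha> k u \<bullet> w = 0"
  obtains v c where "w = lift' \<alpha> k u v + of_real c *s (\<i> *s affine_lift \<alpha> k u)"
proof -
  define z where "z = affine_lift \<alpha> k u"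
  define \<rho> where "\<rho> = sqrt (2 * \<alpha> - (norm u)\<^sup>2)"
  have rho: "0 < \<rho>" using norm_lt_sqrt[OF assms(1)] by (simp add: \<rho>_def)
  have zk: "z $ k = of_real \<rho>" using exhaust_3[of k] by (auto simp: z_def \<rho>_def affine_lift_def Let_def)
  \<comment> \<open>Subtracting this multiple of i z makes the entry k real; orthogonality to z then
    determines it from the other two.\<close>
  define c where "c = Im (w $ k) / \<rho>"
  define w' where "w' = w - of_real c *s (\<i> *s z)"
  define v :: "complex^2" where
    "v = (if k = 1 then vector [w' $ 2, w' $ 3] else if k = 2 then vector [w' $ 1, w' $ 3] else vector [w' $ 1, w' $ 2])"
  have "z \<bullet> (of_real c *s (\<i> *s z)) = 0" by (simp add: inner_3 inner_complex_def algebra_simps)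
  then have zw: "z \<bullet> w' = 0" using assms(2) by (simp add: w'_def inner_diff_right z_def)
  have im: "Im (w' $ k) = 0" using rho by (simp add: w'_def zk c_def)
  have "z \<bullet> w' = \<rho> * Re (w' $ k) + u \<bullet> v"
    using exhaust_3[of k] zk
    by (auto simp: inner_3 inner_2 inner_complex_def v_def z_def affine_lift_def Let_def)
  then have "Re (w' $ k) = - (u \<bullet> v) / \<rho>" using zw rho by (simp add: field_simps)
  then have "w' $ k = of_real (- (u \<bullet> v) / \<rho>)" using im by (simp add: complex_eq_iff)
  then have "w' = lift' \<alpha> k u v"
    using exhaust_3[of k] by (auto simp: lift'_def Let_def \<rho>_def[symmetric] vec_eq_iff forall_3 v_def)
  then have "w = lift' \<alpha> k u v + of_real c *s (\<i> *s z)" by (metis w'_def diff_add_cancel)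
  then show ?thesis using that[of v c] by (simp only: z_def)
qed

definition Zh :: "complex^3 \<Rightarrow> complex" where "Zh z = z $ 1 * z $ 2 * (cnj (z $ 3))\<^sup>2"

definition dJ3 :: "complex^3 \<Rightarrow> complex^3 \<Rightarrow> real" where "dJ3 z w = z $ 1 \<bullet> w $ 1 - z $ 2 \<bullet> w $ 2"
definition dR3 :: "complex^3 \<Rightarrow> complex^3 \<Rightarrow> real" where "dR3 z w = z $ 1 \<bullet> w $ 1 + z $ 2 \<bullet> w $ 2"
definition dZ :: "complex^3 \<Rightarrow> complex^3 \<Rightarrow> complex" where
  "dZ z w = (w $ 1 * z $ 2 + z $ 1 * w $ 2) * (cnj (z $ 3))\<^sup>2 + z $ 1 * z $ 2 * (2 * cnj (z $ 3) * cnj (w $ 3))"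

lemma JRZ_has_derivative:
  "(J_ham has_derivative dJ3 z) (at z)" "(R_ham has_derivative dR3 z) (at z)" "(Zh has_derivative dZ z) (at z)"
proof -
  show "(J_ham has_derivative dJ3 z) (at z)" "(R_ham has_derivative dR3 z) (at z)"
    unfolding J_ham_def[abs_def] R_ham_def[abs_def] dJ3_def[abs_def] dR3_def[abs_def] power2_norm_eq_inner
    by (rule has_derivative_eq_rhs; (auto intro!: derivative_eq_intros nth_has_derivative simp: fun_eq_iff inner_commute)?)+
  have c: "((\<lambda>z. cnj (z $ 3)) has_derivative (\<lambda>w. cnj (w $ 3))) (at z)"
    by (rule bounded_linear.has_derivative[OF bounded_linear_cnj nth_has_derivative])
  show "(Zh has_derivative dZ z) (at z)"
    unfolding Zh_def[abs_def] dZ_def[abs_def] power2_eq_square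
    by (rule has_derivative_eq_rhs)
       (auto intro!: derivative_eq_intros nth_has_derivative c simp: fun_eq_iff algebra_simps)
qed

text \<open>The three functions are invariant under the flow of N, whose velocity is i z.\<close>

lemma d_rotation [simp]:
  "dJ3 z (of_real c *s (\<i> *s z)) = 0" "dR3 z (of_real c *s (\<i> *s z)) = 0" "dZ z (of_real c *s (\<i> *s z)) = 0"
  by (simp_all add: dJ3_def dR3_def dZ_def inner_complex_def power2_eq_square algebra_simps)

lemma d_add:
  "dJ3 z (v + w) = dJ3 z v + dJ3 z w" "dR3 z (v + w) = dR3 z v + dR3 z w" "dZ z (v + w) = dZ z v + dZ z w"
  by (simp_all add: dJ3_def dR3_def dZ_def inner_add_right algebra_simps)

context flap_sys
begin

definition height :: "complex^3 \<Rightarrow> real" where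
  "height z = \<kappa> * R_ham z + Re (Zh z) / 2 - \<delta> * (R_ham z)\<^sup>2 / 2"
definition dh :: "complex^3 \<Rightarrow> complex^3 \<Rightarrow> real" where
  "dh z w = (\<kappa> - \<delta> * R_ham z) * dR3 z w + Re (dZ z w) / 2"

lemma height_has_derivative: "(height has_derivative dh z) (at z)"
  unfolding height_def[abs_def] dh_def[abs_def]
  by (rule has_derivative_eq_rhs)
     (auto intro!: derivative_eq_intros JRZ_has_derivative simp: fun_eq_iff algebra_simps)

lemma level_facts:
  assumes "N_ham z = \<alpha>"
  shows "(cmod (z $ 1))\<^sup>2 = R_ham z + J_ham z" "(cmod (z $ 2))\<^sup>2 = R_ham z - J_ham z"
    "(cmod (z $ 3))\<^sup>2 = 2 * (\<alpha> - R_ham z)" "\<bar>J_ham z\<bar> \<le> R_ham z" "R_ham z \<le> \<alpha>"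
    "(Re (Zh z))\<^sup>2 + (Im (Zh z))\<^sup>2 = 4 * ((R_ham z)\<^sup>2 - (J_ham z)\<^sup>2) * (\<alpha> - R_ham z)\<^sup>2"
proof -
  show a: "(cmod (z $ 1))\<^sup>2 = R_ham z + J_ham z" "(cmod (z $ 2))\<^sup>2 = R_ham z - J_ham z"
    "(cmod (z $ 3))\<^sup>2 = 2 * (\<alpha> - R_ham z)"
    using assms by (auto simp: N_ham_def R_ham_def J_ham_def field_simps)
  show "\<bar>J_ham z\<bar> \<le> R_ham z"
    using a(1,2) zero_le_power2[of "cmod (z $ 1)"] zero_le_power2[of "cmod (z $ 2)"] by linarith
  show "R_ham z \<le> \<alpha>" 
  proof -
    have "0 \<le> 2 * (\<alpha> - R_ham z)" unfolding a(3)[symmetric] by simp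
    then show ?thesis by simp
  qed
  have "(Re (Zh z))\<^sup>2 + (Im (Zh z))\<^sup>2 = (cmod (z $ 1))\<^sup>2 * (cmod (z $ 2))\<^sup>2 * ((cmod (z $ 3))\<^sup>2)\<^sup>2"
    unfolding cmod_power2[symmetric] Zh_def norm_mult norm_power complex_mod_cnj power_mult_distrib ..
  then show "(Re (Zh z))\<^sup>2 + (Im (Zh z))\<^sup>2 = 4 * ((R_ham z)\<^sup>2 - (J_ham z)\<^sup>2) * (\<alpha> - R_ham z)\<^sup>2"
    unfolding a by (simp add: power_mult_distrib algebra_simps power2_eq_square)
qed

lemma Re_Zh_bound:
  assumes "N_ham z = \<alpha>"
  shows "\<bar>Re (Zh z)\<bar> / 2 \<le> sqrt ((R_ham z)\<^sup>2 - (J_ham z)\<^sup>2) * (\<alpha> - R_ham z)"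
proof -
  note l = level_facts[OF assms]
  have "(Re (Zh z))\<^sup>2 \<le> 4 * ((R_ham z)\<^sup>2 - (J_ham z)\<^sup>2) * (\<alpha> - R_ham z)\<^sup>2"
    using l(6) zero_le_power2[of "Im (Zh z)"] by linarith
  then have "\<bar>Re (Zh z)\<bar> \<le> sqrt (4 * ((R_ham z)\<^sup>2 - (J_ham z)\<^sup>2) * (\<alpha> - R_ham z)\<^sup>2)"
    using real_le_rsqrt[of "\<bar>Re (Zh z)\<bar>"] by simp
  also have "\<dots> = 2 * (sqrt ((R_ham z)\<^sup>2 - (J_ham z)\<^sup>2) * (\<alpha> - R_ham z))"
    unfolding real_sqrt_mult using l(5) by simp
  finally show ?thesis by simp
qed

text \<open>The height where z_3 = 0. By \<open>height_ge\<close> it is the minimum, so a point with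
  z_3 = 0 has no value in the interior of the image.\<close>

definition hmin :: real where "hmin = \<kappa> * \<alpha> - \<delta> * \<alpha>\<^sup>2 / 2"

lemma below_pos: "0 \<le> r \<Longrightarrow> 0 < \<delta> * (r + \<alpha>) / 2 - \<kappa> - r"
proof -
  assume "0 \<le> r"
  then have "0 \<le> (\<delta> - 2) * r" using xend(4) by simp
  then show ?thesis using kappa_less by (simp add: algebra_simps)
qed

lemma height_ge:
  assumes "N_ham z = \<alpha>" shows "hmin \<le> height z"
proof -
  note l = level_facts[OF assms]
  have r0: "0 \<le> R_ham z" using l(4) by simp
  have "sqrt ((R_ham z)\<^sup>2 - (J_ham z)\<^sup>2) \<le> R_ham z" using r0 by (intro real_le_lsqrt) auto
  then have "\<bar>Re (Zh z)\<bar> / 2 \<le> R_ham z * (\<alpha> - R_ham z)"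
    using Re_Zh_bound[OF assms] l(5) by (smt (verit) mult_right_mono)
  moreover have "0 \<le> (\<alpha> - R_ham z) * (\<delta> * (R_ham z + \<alpha>) / 2 - \<kappa> - R_ham z)"
    using below_pos[OF r0] l(5) by (intro mult_nonneg_nonneg) auto
  moreover have "height z - hmin = (\<alpha> - R_ham z) * (\<delta> * (R_ham z + \<alpha>) / 2 - \<kappa> - R_ham z) + (R_ham z * (\<alpha> - R_ham z) + Re (Zh z) / 2)"
    by (simp add: height_def hmin_def field_simps power2_eq_square)
  ultimately show ?thesis by linarith
qed

lemma height_min_eq:
  assumes "N_ham z = \<alpha>" "z $ 3 = 0" shows "height z = hmin"
proof -
  have "R_ham z = \<alpha>" using level_facts(3)[OF assms(1)] assms(2) by simp
  then show ?thesis using assms(2) unfolding height_def hmin_def by (simp add: Zh_def)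
qed

text \<open>Since \<open>r \<mapsto> sqrt (r\<^sup>2 - j\<^sup>2)\<close> is concave, replacing it by its tangent leaves a concave quadratic polynomial with the same
  critical point.\<close>

lemma height_le_crit:
  assumes N: "N_ham z = \<alpha>" and s: "0 < s" "s\<^sup>2 = r\<^sup>2 - (J_ham z)\<^sup>2" "0 < r" "r < \<alpha>"
    and crit: "\<kappa> * s = - (\<alpha> - r) * r + s\<^sup>2 + \<delta> * r * s"
  shows "height z \<le> \<kappa> * r + s * (\<alpha> - r) - \<delta> * r\<^sup>2 / 2"
proof -
  note l = level_facts[OF N]
  define j r' where "j = J_ham z" and "r' = R_ham z"
  have rr: "j\<^sup>2 \<le> r * r'"
  proof -
    have "j\<^sup>2 \<le> r\<^sup>2" using s(2) s(1) by (metis j_def diff_ge_0_iff_ge zero_le_power2)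
    then have "\<bar>j\<bar> \<le> r" using s(3) by (simp add: abs_le_square_iff[symmetric])
    moreover have "\<bar>j\<bar> \<le> r'" using l(4) by (simp add: j_def r'_def)
    ultimately have "\<bar>j\<bar> * \<bar>j\<bar> \<le> r * r'" by (intro mult_mono) auto
    then show ?thesis by (simp add: power2_eq_square)
  qed
  \<comment> \<open>A reversed Cauchy-Schwarz inequality for (r, j) and (r', j). It puts the graph
    of sqrt(r'^2 - j^2) below its tangent at r' = r, which is (r r' - j^2) / s.\<close>
  have "(s * sqrt (r'\<^sup>2 - j\<^sup>2))\<^sup>2 \<le> (r * r' - j\<^sup>2)\<^sup>2"
  proof -
    have "j\<^sup>2 \<le> r'\<^sup>2" using l(4) unfolding j_def r'_def by (metis abs_ge_zero power2_abs power_mono)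
    then have "(s * sqrt (r'\<^sup>2 - j\<^sup>2))\<^sup>2 = (r\<^sup>2 - j\<^sup>2) * (r'\<^sup>2 - j\<^sup>2)"
      using s(2) by (simp add: power_mult_distrib j_def)
    also have "\<dots> = (r * r' - j\<^sup>2)\<^sup>2 - j\<^sup>2 * (r - r')\<^sup>2" by algebra
    also have "\<dots> \<le> (r * r' - j\<^sup>2)\<^sup>2" by simp
    finally show ?thesis .
  qed
  then have "s * sqrt (r'\<^sup>2 - j\<^sup>2) \<le> r * r' - j\<^sup>2"
    by (rule power2_le_imp_le) (use rr in simp)
  then have tangent: "s * sqrt (r'\<^sup>2 - j\<^sup>2) * (\<alpha> - r') \<le> (r * r' - j\<^sup>2) * (\<alpha> - r')"
    using l(5) by (intro mult_right_mono) (auto simp: r'_def)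
  have "height z \<le> \<kappa> * r' + sqrt (r'\<^sup>2 - j\<^sup>2) * (\<alpha> - r') - \<delta> * r'\<^sup>2 / 2"
    using Re_Zh_bound[OF N] by (simp add: height_def j_def r'_def)
  then have "s * height z \<le> s * (\<kappa> * r' + sqrt (r'\<^sup>2 - j\<^sup>2) * (\<alpha> - r') - \<delta> * r'\<^sup>2 / 2)"
    using s(1) by simp
  also have "\<dots> \<le> \<kappa> * s * r' + (r * r' - j\<^sup>2) * (\<alpha> - r') - s * \<delta> * r'\<^sup>2 / 2"
    using tangent by (simp add: algebra_simps)
  \<comment> \<open>The equation \<open>crit\<close> cancels the linear term in r' - r, which leaves
    the value at r minus a square.\<close>
  also have "\<dots> = s * (\<kappa> * r + s * (\<alpha> - r) - \<delta> * r\<^sup>2 / 2) - (r + s * \<delta> / 2) * (r' - r)\<^sup>2"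
    using s(2) crit unfolding j_def[symmetric] by algebra
  also have "\<dots> \<le> s * (\<kappa> * r + s * (\<alpha> - r) - \<delta> * r\<^sup>2 / 2)"
    using s xend(4) by simp
  finally show ?thesis using s(1) by simp
qed

text \<open>The multiplier condition is tested on tangent vectors that change one phase or only
  moduli. The phase of z_1 gives Im Z = 0; the moduli with J fixed give the critical equation in R.
  The sign of Re Z, that is, upper or lower profile, stays open.\<close>

lemma crit_C3:
  assumes N: "N_ham z = \<alpha>" and z3: "z $ 3 \<noteq> 0" and ab: "(a, b) \<noteq> (0, 0)"
    and 0: "\<And>w. z \<bullet> w = 0 \<Longrightarrow> a * dJ3 z w + b * dh z w = 0"
  shows "(z $ 1 = 0 \<and> z $ 2 = 0) \<or>
    (b \<noteq> 0 \<and> z $ 1 \<noteq> 0 \<and> z $ 2 \<noteq> 0 \<and> Im (Zh z) = 0 \<and>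
      (\<kappa> - \<delta> * R_ham z) * (4 * ((R_ham z)\<^sup>2 - (J_ham z)\<^sup>2) * (\<alpha> - R_ham z))
        + 2 * Re (Zh z) * (R_ham z * (\<alpha> - R_ham z) - ((R_ham z)\<^sup>2 - (J_ham z)\<^sup>2)) = 0)"
proof -
  note l = level_facts[OF N]
  have in1: "x \<bullet> x = (cmod x)\<^sup>2" for x :: complex by (simp add: power2_norm_eq_inner)
  have in2: "x \<bullet> (\<i> * x) = 0" for x :: complex by (simp add: inner_complex_def)
  have in3: "x \<bullet> (of_real t * y) = t * (x \<bullet> y)" for x y :: complex and t by (simp add: inner_complex_def algebra_simps)
  have n3: "0 < (cmod (z $ 3))\<^sup>2" using z3 by simp
  show ?thesis
  proof (cases "b = 0")
    case True
    then have a: "a \<noteq> 0" using ab by auto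
    \<comment> \<open>These vectors trade the modulus of z_1, respectively z_2, against that of z_3
      within the sphere.\<close>
    define w1 :: "complex^3" where "w1 = vector [of_real ((cmod (z $ 3))\<^sup>2) * z $ 1, 0, of_real (- (cmod (z $ 1))\<^sup>2) * z $ 3]"
    define w2 :: "complex^3" where "w2 = vector [0, of_real ((cmod (z $ 3))\<^sup>2) * z $ 2, of_real (- (cmod (z $ 2))\<^sup>2) * z $ 3]"
    have "z \<bullet> w1 = 0" "z \<bullet> w2 = 0" by (simp_all only: inner_3 w1_def w2_def vector_3 in3 in1) simp_all
    from 0[OF this(1)] 0[OF this(2)] have "dJ3 z w1 = 0" "dJ3 z w2 = 0" using True a by simp_all
    moreover have "dJ3 z w1 = (cmod (z $ 3))\<^sup>2 * (cmod (z $ 1))\<^sup>2" "dJ3 z w2 = - ((cmod (z $ 3))\<^sup>2 * (cmod (z $ 2))\<^sup>2)"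
      by (simp_all only: dJ3_def w1_def w2_def vector_3 in3 in1) simp_all
    ultimately show ?thesis using n3 by simp
  next
    case b: False
    show ?thesis
    proof (cases "z $ 1 = 0 \<or> z $ 2 = 0")
      case True
      have "z $ 1 = 0 \<and> z $ 2 = 0"
      proof (rule ccontr)
        assume n: "\<not> ?thesis"
        show False
        proof (cases "z $ 1 = 0")
          case z1: True
          \<comment> \<open>With z_1 = 0 only the first entry enters dZ, and this choice makes dZ a
            positive squared modulus.\<close>
          define w :: "complex^3" where "w = vector [cnj (z $ 2 * (cnj (z $ 3))\<^sup>2), 0, 0]"
          have "z \<bullet> w = 0" by (simp add: inner_3 w_def z1)
          from 0[OF this] have "b * (Re (dZ z w) / 2) = 0" by (simp add: dJ3_def dh_def dR3_def w_def z1)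
          moreover have "dZ z w = of_real ((cmod (z $ 2 * (cnj (z $ 3))\<^sup>2))\<^sup>2)"
            unfolding complex_norm_square by (simp add: dZ_def w_def z1 mult_ac)
          ultimately show False using b n z1 z3 by simp
        next
          case z1: False
          then have z2: "z $ 2 = 0" using True by simp
          define w :: "complex^3" where "w = vector [0, cnj (z $ 1 * (cnj (z $ 3))\<^sup>2), 0]"
          have "z \<bullet> w = 0" by (simp add: inner_3 w_def z2)
          from 0[OF this] have "b * (Re (dZ z w) / 2) = 0" by (simp add: dJ3_def dh_def dR3_def w_def z2)
          moreover have "dZ z w = of_real ((cmod (z $ 1 * (cnj (z $ 3))\<^sup>2))\<^sup>2)"
            unfolding complex_norm_square by (simp add: dZ_def w_def z2 mult_ac)
          ultimately show False using b z1 z3 by simp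
        qed
      qed
      then show ?thesis by simp
    next
      case False
      define w :: "complex^3" where "w = vector [\<i> * z $ 1, 0, 0]"
      have "z \<bullet> w = 0" by (simp add: inner_3 w_def in2)
      from 0[OF this] have "Re (dZ z w) = 0" using b by (simp add: dJ3_def dh_def dR3_def w_def in2)
      moreover have "dZ z w = \<i> * Zh z" by (simp add: dZ_def w_def Zh_def)
      ultimately have Y: "Im (Zh z) = 0" by simp
      define n1 n2 n3 where "n1 = (cmod (z $ 1))\<^sup>2" and "n2 = (cmod (z $ 2))\<^sup>2" and "n3 = (cmod (z $ 3))\<^sup>2"
      \<comment> \<open>Real scalings of the three entries that leave N and J unchanged to first
        order.\<close>
      define v :: "complex^3" where "v = vector [of_real (n2 * n3) * z $ 1, of_real (n1 * n3) * z $ 2, of_real (- 2 * n1 * n2) * z $ 3]"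
      have "z \<bullet> v = 0"
        by (simp only: inner_3 v_def vector_3 in3 in1 n1_def[symmetric] n2_def[symmetric] n3_def[symmetric]) simp
      moreover have "dJ3 z v = 0" "dR3 z v = 2 * n1 * n2 * n3"
        by (simp_all only: dJ3_def dR3_def v_def vector_3 in3 in1 n1_def[symmetric] n2_def[symmetric] n3_def[symmetric]) simp_all
      moreover have "dZ z v = of_real (n2 * n3 + n1 * n3 - 4 * n1 * n2) * Zh z"
        by (simp add: dZ_def v_def Zh_def power2_eq_square algebra_simps)
      then have "Re (dZ z v) = (n2 * n3 + n1 * n3 - 4 * n1 * n2) * Re (Zh z)" by simp
      ultimately have "(\<kappa> - \<delta> * R_ham z) * (2 * n1 * n2 * n3) + (n2 * n3 + n1 * n3 - 4 * n1 * n2) * Re (Zh z) / 2 = 0"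
        using 0[of v] b by (simp add: dh_def)
      then have "(\<kappa> - \<delta> * R_ham z) * (4 * ((R_ham z)\<^sup>2 - (J_ham z)\<^sup>2) * (\<alpha> - R_ham z))
        + 2 * Re (Zh z) * (R_ham z * (\<alpha> - R_ham z) - ((R_ham z)\<^sup>2 - (J_ham z)\<^sup>2)) = 0"
        unfolding n1_def n2_def n3_def l by algebra
      then show ?thesis using Y False b by blast
    qed
  qed
qed

end

section \<open>Smoothness of the charts and limits of quotients along rays\<close>

lemma lift_Ck: "Ck_on n (ball 0 (sqrt (2 * \<alpha>))) (affine_lift \<alpha> k)"
proof (rule Ck_on_vec)
  fix i
  let ?U = "ball 0 (sqrt (2 * \<alpha>)) :: (complex^2) set"
  have nth: "Ck_on n ?U (\<lambda>u. u $ m)" for m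
    by (intro Ck_on_linear bounded_linear_vec_nth open_ball)
  have "Ck_on n ?U (\<lambda>u. sqrt (2 * \<alpha> - u \<bullet> u))"
  proof (rule Ck_on_real_compose(3))
    show "Ck_on n ?U (\<lambda>u. 2 * \<alpha> - u \<bullet> u)"
      by (intro Ck_on_diff Ck_on_const Ck_on_bilinear[OF _ bounded_bilinear_inner] Ck_on_linear bounded_linear_ident open_ball)
    show "0 < 2 * \<alpha> - u \<bullet> u" if "u \<in> ?U" for u
      using norm_lt_sqrt[of u "2 * \<alpha>"] that by (simp add: power2_norm_eq_inner)
  qed simp
  then have "Ck_on n ?U (\<lambda>u. complex_of_real (sqrt (2 * \<alpha> - (norm u)\<^sup>2)))"
    unfolding power2_norm_eq_inner by (intro Ck_on_linear_compose[OF _ bounded_linear_of_real] open_ball)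
  then show "Ck_on n ?U (\<lambda>u. affine_lift \<alpha> k u $ i)"
    using exhaust_3[of i] exhaust_3[of k] nth[of 1] nth[of 2]
    by (auto simp: affine_lift_def Let_def)
qed simp

lemma JRZ_Ck: "Ck_on n UNIV J_ham" "Ck_on n UNIV R_ham" "Ck_on n UNIV Zh"
proof -
  have nth: "Ck_on n UNIV (\<lambda>z :: complex^3. z $ m)" for m
    by (intro Ck_on_linear bounded_linear_vec_nth open_UNIV)
  have "Ck_on n UNIV (\<lambda>z :: complex^3. (z $ i \<bullet> z $ i + c * (z $ m \<bullet> z $ m)) * (1 / 2))" for i m c
    by (intro Ck_on_add Ck_on_mult Ck_on_const Ck_on_bilinear[OF _ bounded_bilinear_inner] nth open_UNIV)
  from this[of 1 "-1" 2] this[of 1 1 2] show "Ck_on n UNIV J_ham" "Ck_on n UNIV R_ham"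
    by (simp_all add: J_ham_def[abs_def] R_ham_def[abs_def] power2_norm_eq_inner)
  show "Ck_on n UNIV Zh" unfolding Zh_def[abs_def]
    by (intro Ck_on_mult Ck_on_power Ck_on_linear_compose[OF _ bounded_linear_cnj] nth open_UNIV)
qed

lemma Ck_on_Pair:
  fixes f h :: "'a::real_normed_vector \<Rightarrow> real"
  assumes "open U" "Ck_on n U f" "Ck_on n U h" shows "Ck_on n U (\<lambda>x. (f x, h x))"
proof -
  have "Ck_on n U (\<lambda>x. f x *\<^sub>R (1::real, 0::real) + h x *\<^sub>R (0, 1))"
    by (intro Ck_on_add Ck_on_scaleR Ck_on_const assms)
  then show ?thesis by simp
qed

lemma line_quotient_tendsto:
  fixes f :: "'a::real_normed_vector \<Rightarrow> real"
  assumes "(f has_derivative f') (at 0)"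
  shows "((\<lambda>s. (f (s *\<^sub>R v) - f 0) / s) \<longlongrightarrow> f' v) (at_right 0)"
proof -
  have 1: "((\<lambda>s. s *\<^sub>R v) has_derivative (\<lambda>s. s *\<^sub>R v)) (at 0)" by (auto intro!: derivative_eq_intros)
  have "((\<lambda>s. f (s *\<^sub>R v)) has_derivative (\<lambda>s. f' (s *\<^sub>R v))) (at 0)"
    using has_derivative_compose[OF 1, of f f'] assms by simp
  moreover have "(\<lambda>s. f' (s *\<^sub>R v)) = (*) (f' v)"
    using has_derivative_linear[OF assms] by (auto simp: linear_cmul)
  ultimately have "((\<lambda>s. f (s *\<^sub>R v)) has_real_derivative f' v) (at 0)" by (simp add: has_field_derivative_def)
  then have "((\<lambda>s. (f (s *\<^sub>R v) - f 0) / s) \<longlongrightarrow> f' v) (at 0)" by (simp add: DERIV_def)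
  then show ?thesis by (rule tendsto_mono[rotated]) (simp add: at_le)
qed

text \<open>If only the second coordinate moves, by a quantity of order s^2, only the partial
  derivative of h in that coordinate counts. The continuous quotient m of Caratheodory also covers
  those s at which \<tau> s = 0.\<close>

lemma quadratic_quotient_tendsto:
  fixes h :: "real \<times> real \<Rightarrow> real"
  assumes h: "(h has_derivative h') (at (a, b))"
    and \<tau>: "((\<lambda>s. \<tau> s / s\<^sup>2) \<longlongrightarrow> q) (at_right 0)"
  shows "((\<lambda>s. (h (a, b + \<tau> s) - h (a, b)) / s\<^sup>2) \<longlongrightarrow> q * h' (0, 1)) (at_right 0)"
proof -
  have 1: "((\<lambda>t. (a, b + t)) has_derivative (\<lambda>t. (0, t))) (at 0)"
    by (auto intro!: derivative_eq_intros)
  have "((\<lambda>t. h (a, b + t)) has_derivative (\<lambda>t. h' (0, t))) (at 0)"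
    using has_derivative_compose[OF 1, of h h'] h by simp
  moreover have hl: "h' (0, t) = h' (0, 1) * t" for t
    using has_derivative_linear[OF h] linear_cmul[of h' t "(0, 1)"] by simp
  have "(\<lambda>t. h' (0, t)) = (*) (h' (0, 1))" by (rule ext) (rule hl)
  ultimately have "((\<lambda>t. h (a, b + t)) has_real_derivative h' (0, 1)) (at 0)" by (simp add: has_field_derivative_def)
  then obtain m where m: "\<And>t. h (a, b + t) - h (a, b) = m t * t" "isCont m 0" "m 0 = h' (0, 1)"
    by (auto simp: CARAT_DERIV)
  have s2: "((\<lambda>s::real. s\<^sup>2) \<longlongrightarrow> 0) (at_right 0)" by (auto intro!: tendsto_eq_intros)
  have "((\<lambda>s. \<tau> s / s\<^sup>2 * s\<^sup>2) \<longlongrightarrow> q * 0) (at_right 0)" by (intro tendsto_mult \<tau> s2)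
  moreover have "\<forall>\<^sub>F s in at_right 0. \<tau> s / s\<^sup>2 * s\<^sup>2 = \<tau> s"
    using eventually_at_right_less[of "0 :: real"] by eventually_elim simp
  ultimately have "(\<tau> \<longlongrightarrow> 0) (at_right 0)"
    using Lim_transform_eventually by fastforce
  then have "((\<lambda>s. m (\<tau> s)) \<longlongrightarrow> h' (0, 1)) (at_right 0)"
    using isCont_tendsto_compose[OF m(2)] m(3) by simp
  then have "((\<lambda>s. \<tau> s / s\<^sup>2 * m (\<tau> s)) \<longlongrightarrow> q * h' (0, 1)) (at_right 0)" by (intro tendsto_mult \<tau>)
  then show ?thesis by (simp add: m(1) mult.commute)
qed

context flap_data
begin

text \<open>Second-order expansion of the equation \<open>X\<^sup>2 + Y\<^sup>2 = 4 (R\<^sup>2 - J\<^sup>2) (\<alpha> - R)\<^sup>2\<close> of the reduced space, with \<open>X\<close> expressed by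
  \<open>H\<close> and \<open>R\<close>, along a curve on which \<open>J\<close> and \<open>H\<close> are stationary.\<close>

lemma quadratic_relation:
  assumes s: "0 < s0" "s0\<^sup>2 = r0\<^sup>2 - j0\<^sup>2" and e: "e = \<alpha> - r0"
    and crit: "\<kappa> * s0 = e * r0 - s0\<^sup>2 + \<delta> * r0 * s0"
    and h0: "h0 - \<kappa> * r0 + \<delta> * r0\<^sup>2 / 2 = - s0 * e"
    and lim: "((\<lambda>s. (jf s - j0) / s\<^sup>2) \<longlongrightarrow> a) (at_right 0)" "((\<lambda>s. (hf s - h0) / s\<^sup>2) \<longlongrightarrow> b) (at_right 0)"
      "((\<lambda>s. (rf s - r0) / s) \<longlongrightarrow> \<rho>) (at_right 0)" "((\<lambda>s. Yf s / s) \<longlongrightarrow> \<eta>) (at_right 0)"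
    and ident: "\<forall>\<^sub>F s in at_right 0. (hf s - \<kappa> * rf s + \<delta> * (rf s)\<^sup>2 / 2)\<^sup>2 + (Yf s)\<^sup>2 / 4
       = ((rf s)\<^sup>2 - (jf s)\<^sup>2) * (\<alpha> - rf s)\<^sup>2"
  shows "2 * s0 * e * b - 2 * j0 * e\<^sup>2 * a = e * s0 * (2 * r0 / s0 + e * j0\<^sup>2 / s0 ^ 3 - \<delta>) * \<rho>\<^sup>2 + \<eta>\<^sup>2 / 4"
proof -
  define c where "c = \<delta> * r0 - \<kappa>"
  \<comment> \<open>The difference of the two sides of \<open>ident\<close> for rf = r0 + s P, hf =
    h0 + s^2 h, jf = j0 + s^2 j, Yf = s Y, divided by s^2. The terms of order 0 and 1 cancel by
    \<open>h0\<close> and \<open>crit\<close>, so the quotient is a polynomial and s = 0 can be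
    inserted.\<close>
  define Q where "Q s P h j Y = c\<^sup>2 * P\<^sup>2 - 2 * s0 * e * (h + \<delta> * P\<^sup>2 / 2) + s * (2 * c * P * (h + \<delta> * P\<^sup>2 / 2))
     + s\<^sup>2 * (h + \<delta> * P\<^sup>2 / 2)\<^sup>2 + Y\<^sup>2 / 4
     - (e\<^sup>2 * (P\<^sup>2 - 2 * j0 * j) - 4 * r0 * e * P\<^sup>2 + s0\<^sup>2 * P\<^sup>2 + s * (2 * r0 * P ^ 3 - 2 * e * P * (P\<^sup>2 - 2 * j0 * j))
      + s\<^sup>2 * (P\<^sup>2 * (P\<^sup>2 - 2 * j0 * j) - e\<^sup>2 * j\<^sup>2) + s ^ 3 * (2 * e * P * j\<^sup>2) - s ^ 4 * (P\<^sup>2 * j\<^sup>2))"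
    for s P h j Y :: real
  have lin: "s0 * c = s0\<^sup>2 - e * r0" using crit by (simp add: c_def algebra_simps)
  have id: "s\<^sup>2 * Q s P h j Y = ((h0 + s\<^sup>2 * h) - \<kappa> * (r0 + s * P) + \<delta> * (r0 + s * P)\<^sup>2 / 2)\<^sup>2 + (s * Y)\<^sup>2 / 4
     - ((r0 + s * P)\<^sup>2 - (j0 + s\<^sup>2 * j)\<^sup>2) * (\<alpha> - (r0 + s * P))\<^sup>2" for s P h j Y
  proof -
    have 1: "(h0 + s\<^sup>2 * h) - \<kappa> * (r0 + s * P) + \<delta> * (r0 + s * P)\<^sup>2 / 2 = - s0 * e + c * P * s + s\<^sup>2 * (h + \<delta> * P\<^sup>2 / 2)"
      using h0 by (simp add: c_def power2_eq_square field_simps)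
    have 2: "(r0 + s * P)\<^sup>2 - (j0 + s\<^sup>2 * j)\<^sup>2 = s0\<^sup>2 + 2 * r0 * P * s + s\<^sup>2 * (P\<^sup>2 - 2 * j0 * j) - s ^ 4 * j\<^sup>2"
      using s(2) by algebra
    have 3: "\<alpha> - (r0 + s * P) = e - s * P" using e by simp
    have 4: "- 2 * (s0 * c) * e * P * s = 2 * r0 * P * s * e\<^sup>2 - 2 * e * P * s * s0\<^sup>2"
      unfolding lin by (simp add: algebra_simps power2_eq_square)
    define D where "D = h + \<delta> * P\<^sup>2 / 2"
    define T where "T = Y\<^sup>2 / 4"
    have T: "(s * Y)\<^sup>2 / 4 = s\<^sup>2 * T" by (simp add: T_def power_mult_distrib)
    show ?thesis unfolding 1 2 3 T Q_def D_def[symmetric] T_def[symmetric] using 4 by algebra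
  qed
  have s0: "((\<lambda>s::real. s) \<longlongrightarrow> 0) (at_right 0)" by (rule tendsto_ident_at)
  have L: "((\<lambda>s. Q s ((rf s - r0) / s) ((hf s - h0) / s\<^sup>2) ((jf s - j0) / s\<^sup>2) (Yf s / s)) \<longlongrightarrow> Q 0 \<rho> b a \<eta>) (at_right 0)"
    unfolding Q_def by (intro tendsto_intros lim s0) auto
  have "\<forall>\<^sub>F s in at_right 0. Q s ((rf s - r0) / s) ((hf s - h0) / s\<^sup>2) ((jf s - j0) / s\<^sup>2) (Yf s / s) = 0"
  proof -
    have "\<forall>\<^sub>F s :: real in at_right 0. 0 < s" by (rule eventually_at_right_less)
    with ident show ?thesis
    proof eventually_elim
      case (elim s)
      have "s\<^sup>2 * Q s ((rf s - r0) / s) ((hf s - h0) / s\<^sup>2) ((jf s - j0) / s\<^sup>2) (Yf s / s) = 0"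
        unfolding id using elim by simp
      then show ?case using elim by simp
    qed
  qed
  then have "((\<lambda>s. 0) \<longlongrightarrow> Q 0 \<rho> b a \<eta>) (at_right (0::real))"
    using L by (rule Lim_transform_eventually[rotated])
  then have "Q 0 \<rho> b a \<eta> = 0" by (simp add: tendsto_const_iff)
  then have 1: "2 * s0 * e * b - 2 * j0 * e\<^sup>2 * a = (c\<^sup>2 - s0 * e * \<delta> - e\<^sup>2 + 4 * r0 * e - s0\<^sup>2) * \<rho>\<^sup>2 + \<eta>\<^sup>2 / 4"
    by (simp add: Q_def algebra_simps)
  \<comment> \<open>The factor s0^2 clears the denominators and allows c to be eliminated by
    \<open>lin\<close>; the bracket on the right is \<open>psi\<close> in terms of r, s and
    j.\<close>
  have "s0\<^sup>2 * (c\<^sup>2 - s0 * e * \<delta> - e\<^sup>2 + 4 * r0 * e - s0\<^sup>2) = s0\<^sup>2 * (e * s0 * (2 * r0 / s0 + e * j0\<^sup>2 / s0 ^ 3 - \<delta>))"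
  proof -
    have "s0\<^sup>2 * (e * s0 * (2 * r0 / s0 + e * j0\<^sup>2 / s0 ^ 3 - \<delta>)) = e * (2 * r0 * s0\<^sup>2 + e * j0\<^sup>2 - \<delta> * s0 ^ 3)"
      using s(1) by (simp add: field_simps power2_eq_square power3_eq_cube)
    moreover have "s0\<^sup>2 * (c\<^sup>2 - s0 * e * \<delta> - e\<^sup>2 + 4 * r0 * e - s0\<^sup>2) = e * (2 * r0 * s0\<^sup>2 + e * j0\<^sup>2 - \<delta> * s0 ^ 3)"
      using lin s(2) by algebra
    ultimately show ?thesis by metis
  qed
  then show ?thesis using 1 s(1) by simp
qed

end

text \<open>After polarization, the kernel of Q, of dimension 2, lies in the common kernel of \<rho>
  and \<eta>. The vectors v1 and v2 are independent modulo it, which exceeds dimension 3.\<close>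

lemma quadratic_rank_contradiction:
  fixes Q :: "real^3 \<Rightarrow> real^3 \<Rightarrow> real"
  assumes Q: "\<And>v. linear (Q v)" "\<And>v w. Q v w = Q w v" and rk: "form_rank Q = 1"
    and lin: "linear \<rho>" "linear \<eta>"
    and eq: "\<And>v. C * Q v v = A * (\<rho> v)\<^sup>2 + B * (\<eta> v)\<^sup>2"
    and AB: "A \<noteq> 0" "B \<noteq> 0"
    and v1: "\<rho> v1 \<noteq> 0" "\<eta> v1 = 0" and v2: "\<rho> v2 = 0" "\<eta> v2 \<noteq> 0"
  shows False
proof -
  have pol: "C * Q v w = A * (\<rho> v * \<rho> w) + B * (\<eta> v * \<eta> w)" for v w
  proof -
    have "Q (v + w) (v + w) = Q v v + 2 * Q v w + Q w w"
    proof -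
      have "Q (v + w) (v + w) = Q (v + w) v + Q (v + w) w" using Q(1) by (simp add: linear_add)
      also have "\<dots> = Q v (v + w) + Q w (v + w)" by (simp add: Q(2)[of "v + w"])
      also have "\<dots> = Q v v + Q v w + (Q w v + Q w w)" using Q(1) by (simp add: linear_add)
      finally show ?thesis using Q(2)[of w v] by simp
    qed
    then have "C * (2 * Q v w) = C * Q (v + w) (v + w) - C * Q v v - C * Q w w" by (simp add: algebra_simps)
    also have "\<dots> = 2 * (A * (\<rho> v * \<rho> w) + B * (\<eta> v * \<eta> w))"
      unfolding eq using lin by (simp add: linear_add power2_eq_square algebra_simps)
    finally show ?thesis by simp
  qed
  let ?K = "form_kernel Q"
  have K: "\<rho> v = 0" "\<eta> v = 0" if "v \<in> ?K" for v
    using pol[of v v1] pol[of v v2] that AB v1 v2 by (auto simp: form_kernel_def)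
  have sub: "subspace ?K"
    unfolding subspace_def form_kernel_def
    using Q by (auto simp: linear_0 linear_add linear_cmul Q(2)[of _ "_ :: real^3"])
  have spn: "span ?K = ?K" using sub by (simp only: span_eq_iff)
  have "dim ?K = 2" using rk by (simp add: form_rank_def)
  moreover have "v1 \<notin> span ?K" using K(1)[of v1] v1 unfolding spn by auto
  moreover have "v2 \<notin> span (insert v1 ?K)"
  proof
    assume "v2 \<in> span (insert v1 ?K)"
    then obtain c where "v2 - c *\<^sub>R v1 \<in> ?K" by (auto simp: span_insert spn)
    then have "\<eta> (v2 - c *\<^sub>R v1) = 0" by (rule K(2))
    then show False using v1 v2 lin by (simp add: linear_diff linear_cmul)
  qed
  ultimately have "dim (insert v2 (insert v1 ?K)) = 4" by (simp add: dim_insert)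
  moreover have "dim (insert v2 (insert v1 ?K)) \<le> DIM(real^3)" by (rule dim_subset_UNIV)
  ultimately show False by simp
qed

section \<open>Singular values\<close>

lemma lift_onto_d:
  assumes "norm x < sqrt (2 * \<alpha>)" and "affine_lift \<alpha> k x \<bullet> w = 0"
  defines "z \<equiv> affine_lift \<alpha> k x"
  obtains v where "dJ3 z w = dJ3 z (lift' \<alpha> k x v)" "dR3 z w = dR3 z (lift' \<alpha> k x v)"
    "dZ z w = dZ z (lift' \<alpha> k x v)"
proof -
  obtain v c where "w = lift' \<alpha> k x v + of_real c *s (\<i> *s z)"
    using lift_onto[OF assms(1,2)] unfolding z_def by blast
  then show ?thesis using that[of v] by (simp only: d_add d_rotation add_0_right)
qed

locale flap_mfd = flap_sys +
  fixes F :: "(complex^3) set \<Rightarrow> real \<times> real"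
  assumes F: "N_ham z = \<alpha> \<Longrightarrow> F (hopf_class z) = (J_ham z, c0 + g * height z)"
begin

definition F1 :: "3 \<Rightarrow> complex^2 \<Rightarrow> real" where "F1 k y = fst (F (hopf_class (affine_lift \<alpha> k y)))"
definition F2 :: "3 \<Rightarrow> complex^2 \<Rightarrow> real" where "F2 k y = snd (F (hopf_class (affine_lift \<alpha> k y)))"
definition chart_ball :: "(complex^2) set" where "chart_ball = ball 0 (sqrt (2 * \<alpha>))"

lemma chart_ball_norm: "y \<in> chart_ball \<longleftrightarrow> norm y < sqrt (2 * \<alpha>)" by (simp add: chart_ball_def)
lemma open_chart_ball: "open chart_ball" by (simp add: chart_ball_def)

lemma points_of_type_iff:
  "w \<in> F ` points_of_type P (CP2_atlas \<alpha>) F \<longleftrightarrow> (\<exists>k. \<exists>x\<in>chart_ball. w = (F1 k x, F2 k x) \<and> P (F1 k) (F2 k) x)"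
  unfolding points_of_type_def CP2_atlas_def F1_def[abs_def] F2_def[abs_def] chart_ball_def by force

lemma F12:
  assumes "y \<in> chart_ball" shows "F1 k y = J_ham (affine_lift \<alpha> k y)" "F2 k y = c0 + g * height (affine_lift \<alpha> k y)"
  using F[OF N_ham_lift[of y \<alpha> k]] assms by (simp_all add: F1_def F2_def chart_ball_norm)

lemma height_Ck: "Ck_on n UNIV height"
proof -
  have "Ck_on n UNIV (\<lambda>z. \<kappa> * R_ham z + Re (Zh z) * (1 / 2) - \<delta> * ((R_ham z)\<^sup>2 * (1 / 2)))"
    by (intro Ck_on_diff Ck_on_add Ck_on_mult Ck_on_const Ck_on_power JRZ_Ck
        Ck_on_linear_compose[OF _ bounded_linear_Re] open_UNIV)
  then show ?thesis by (simp add: height_def[abs_def])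
qed

lemma F12_Ck: "Ck_on n chart_ball (F1 k)" "Ck_on n chart_ball (F2 k)"
proof -
  have "Ck_on n chart_ball (\<lambda>y. J_ham (affine_lift \<alpha> k y))"
    "Ck_on n chart_ball (\<lambda>y. c0 + g * height (affine_lift \<alpha> k y))"
    unfolding chart_ball_def
    by (intro Ck_on_add Ck_on_mult Ck_on_const open_ball Ck_on_compose[OF _ open_UNIV lift_Ck] JRZ_Ck height_Ck; simp)+
  then show "Ck_on n chart_ball (F1 k)" "Ck_on n chart_ball (F2 k)"
    using Ck_on_cong[OF open_chart_ball, of "F1 k" "\<lambda>y. J_ham (affine_lift \<alpha> k y)" n]
      Ck_on_cong[OF open_chart_ball, of "F2 k" "\<lambda>y. c0 + g * height (affine_lift \<alpha> k y)" n] F12 by simp_all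
qed

lemma F12_has_derivative:
  assumes "x \<in> chart_ball"
  shows "(F1 k has_derivative (\<lambda>v. dJ3 (affine_lift \<alpha> k x) (lift' \<alpha> k x v))) (at x)"
    "(F2 k has_derivative (\<lambda>v. g * dh (affine_lift \<alpha> k x) (lift' \<alpha> k x v))) (at x)"
proof -
  have l: "(affine_lift \<alpha> k has_derivative lift' \<alpha> k x) (at x)"
    using lift_has_derivative assms by (simp add: chart_ball_norm)
  have "((\<lambda>y. J_ham (affine_lift \<alpha> k y)) has_derivative (\<lambda>v. dJ3 (affine_lift \<alpha> k x) (lift' \<alpha> k x v))) (at x)"
    by (rule has_derivative_compose[OF l JRZ_has_derivative(1)])
  then show "(F1 k has_derivative (\<lambda>v. dJ3 (affine_lift \<alpha> k x) (lift' \<alpha> k x v))) (at x)"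
    by (rule has_derivative_transform_within_open[OF _ open_chart_ball assms]) (simp add: F12)
  have "((\<lambda>y. c0 + g * height (affine_lift \<alpha> k y)) has_derivative (\<lambda>v. 0 + g * dh (affine_lift \<alpha> k x) (lift' \<alpha> k x v))) (at x)"
    by (intro has_derivative_add has_derivative_const has_derivative_mult_right has_derivative_compose[OF l height_has_derivative])
  then have "((\<lambda>y. c0 + g * height (affine_lift \<alpha> k y)) has_derivative (\<lambda>v. g * dh (affine_lift \<alpha> k x) (lift' \<alpha> k x v))) (at x)"
    by (simp only: add_0)
  then show "(F2 k has_derivative (\<lambda>v. g * dh (affine_lift \<alpha> k x) (lift' \<alpha> k x v))) (at x)"
    by (rule has_derivative_transform_within_open[OF _ open_chart_ball assms]) (simp add: F12)
qed

lemma differential_F: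
  assumes "x \<in> chart_ball"
  shows "differential (F1 k) x v = dJ3 (affine_lift \<alpha> k x) (lift' \<alpha> k x v)"
    "differential (F2 k) x v = g * dh (affine_lift \<alpha> k x) (lift' \<alpha> k x v)"
  using differential_eq[OF F12_has_derivative(1)[OF assms]] differential_eq[OF F12_has_derivative(2)[OF assms]]
  by metis+

lemma image_F: "F ` CP2 \<alpha> = {(J_ham z, c0 + g * height z) | z. N_ham z = \<alpha>}"
  using F by (force simp: CP2_def)

text \<open>An interior value can be moved a little down and up within the image;
  \<open>singular_C3\<close> uses the two parts to exclude z_3 = 0 and the upper profile.\<close>

lemma interior_image:
  assumes "w \<in> interior (F ` CP2 \<alpha>)"
  shows "c0 + g * hmin < snd w" and "\<exists>z. N_ham z = \<alpha> \<and> J_ham z = fst w \<and> snd w < c0 + g * height z"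
proof -
  obtain e where e: "0 < e" "ball w e \<subseteq> F ` CP2 \<alpha>" using assms by (auto simp: mem_interior)
  have d: "dist w (fst w, snd w + t) = \<bar>t\<bar>" for t
    by (cases w) (simp add: dist_prod_def dist_real_def)
  have "(fst w, snd w - e / 2) \<in> F ` CP2 \<alpha>" "(fst w, snd w + e / 2) \<in> F ` CP2 \<alpha>"
    using e d[of "- e / 2"] d[of "e / 2"] by (auto intro!: subsetD[OF e(2)])
  then obtain z z' where z: "N_ham z = \<alpha>" "snd w - e / 2 = c0 + g * height z"
    and z': "N_ham z' = \<alpha>" "J_ham z' = fst w" "snd w + e / 2 = c0 + g * height z'"
    unfolding image_F by auto
  have "g * hmin \<le> g * height z" using height_ge[OF z(1)] g_pos by simp
  then show "c0 + g * hmin < snd w" using z(2) e(1) by linarith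
  show "\<exists>z. N_ham z = \<alpha> \<and> J_ham z = fst w \<and> snd w < c0 + g * height z"
    using z' e(1) by (intro exI[of _ z']) auto
qed

definition crit_val :: "real \<Rightarrow> real \<times> real" where "crit_val y = (jy y, c0 + g * hy y)"

lemma crit_val_yend: "crit_val yend = (0, c0)" "crit_val (- yend) = (0, c0)"
  by (simp_all add: crit_val_def jy_def hy_def ry_def)

lemma singular_C3:
  assumes x: "x \<in> chart_ball" and z: "z = affine_lift \<alpha> k x"
    and ab: "(a, b) \<noteq> (0, 0)" "\<And>v. a * differential (F1 k) x v + b * differential (F2 k) x v = 0"
    and int: "(F1 k x, F2 k x) \<in> interior (F ` CP2 \<alpha>)"
  obtains (center) "z $ 1 = 0" "z $ 2 = 0"
  | (curve) y where "\<bar>y\<bar> < yend" "J_ham z = jy y" "R_ham z = ry y" "Re (Zh z) = - 2 * sy y * (\<alpha> - ry y)"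
     "Im (Zh z) = 0" "z $ 1 \<noteq> 0" "z $ 2 \<noteq> 0" "z $ 3 \<noteq> 0" "b \<noteq> 0"
proof -
  have N: "N_ham z = \<alpha>" using x z N_ham_lift by (simp add: chart_ball_norm)
  note l = level_facts[OF N]
  have val: "F1 k x = J_ham z" "F2 k x = c0 + g * height z" using F12[OF x] z by simp_all
  have z3: "z $ 3 \<noteq> 0"
    using interior_image(1)[OF int] height_min_eq[OF N] by (auto simp: val)
  have 0: "a * dJ3 z w + (b * g) * dh z w = 0" if w: "z \<bullet> w = 0" for w
  proof -
    obtain v where v: "dJ3 z w = dJ3 z (lift' \<alpha> k x v)" "dR3 z w = dR3 z (lift' \<alpha> k x v)"
      "dZ z w = dZ z (lift' \<alpha> k x v)"
      using lift_onto_d[of x \<alpha> k w] x w z by (auto simp: chart_ball_norm)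
    have "a * dJ3 z (lift' \<alpha> k x v) + b * (g * dh z (lift' \<alpha> k x v)) = 0"
      using ab(2)[of v] differential_F[OF x] z by simp
    then show ?thesis by (simp add: v dh_def)
  qed
  have ab': "(a, b * g) \<noteq> (0, 0)" using ab(1) g_pos by simp
  show ?thesis
  proof (cases "z $ 1 = 0 \<and> z $ 2 = 0")
    case True then show ?thesis using center by simp
  next
    case False
    define j r where "j = J_ham z" and "r = R_ham z"
    from crit_C3[OF N z3 ab' 0] False have c: "b \<noteq> 0" "z $ 1 \<noteq> 0" "z $ 2 \<noteq> 0" "Im (Zh z) = 0"
      "(\<kappa> - \<delta> * r) * (4 * (r\<^sup>2 - j\<^sup>2) * (\<alpha> - r)) + 2 * Re (Zh z) * (r * (\<alpha> - r) - (r\<^sup>2 - j\<^sup>2)) = 0"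
      using g_pos by (auto simp: j_def r_def)
    have "0 < (cmod (z $ 1))\<^sup>2" "0 < (cmod (z $ 2))\<^sup>2" "0 < (cmod (z $ 3))\<^sup>2" using c z3 by simp_all
    then have jr: "0 < r + j" "0 < r - j" "r < \<alpha>" unfolding l j_def r_def by simp_all
    then have r0: "0 < r" by linarith
    have rj2: "0 < r\<^sup>2 - j\<^sup>2" using mult_pos_pos[OF jr(1,2)] by (simp add: algebra_simps power2_eq_square)
    define s where "s = sqrt (r\<^sup>2 - j\<^sup>2)"
    have s: "0 < s" "s\<^sup>2 = r\<^sup>2 - j\<^sup>2" using rj2 by (simp_all add: s_def)
    have "(Re (Zh z))\<^sup>2 = (2 * s * (\<alpha> - r))\<^sup>2"
      using l(6) c(4) s(2) by (simp add: power_mult_distrib j_def r_def)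
    \<comment> \<open>The signs are those of the upper and the lower profile. A critical point of
      the upper profile is a maximum of the height on its level of J
      (\<open>height_le_crit\<close>), which an interior value cannot attain.\<close>
    then consider (pos) "Re (Zh z) = 2 * s * (\<alpha> - r)" | (neg) "Re (Zh z) = - 2 * s * (\<alpha> - r)"
      by (auto simp: power2_eq_iff)
    then show ?thesis
    proof cases
      case pos
      have "4 * s * (\<alpha> - r) * ((\<kappa> - \<delta> * r) * s + (r * (\<alpha> - r) - s\<^sup>2)) = 0"
        using c(5) unfolding pos s(2)[symmetric] by algebra
      then have "(\<kappa> - \<delta> * r) * s + (r * (\<alpha> - r) - s\<^sup>2) = 0" using s(1) jr(3) by simp
      then have cr: "\<kappa> * s = - (\<alpha> - r) * r + s\<^sup>2 + \<delta> * r * s" by algebra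
      obtain z' where z': "N_ham z' = \<alpha>" "J_ham z' = j" "F2 k x < c0 + g * height z'"
        using interior_image(2)[OF int] by (auto simp: val j_def)
      have "height z' \<le> \<kappa> * r + s * (\<alpha> - r) - \<delta> * r\<^sup>2 / 2"
        using height_le_crit[OF z'(1) s(1) _ r0 jr(3) cr] s(2) z'(2) by simp
      also have "\<dots> = height z" using pos by (simp add: height_def r_def)
      finally show ?thesis using z'(3) g_pos val by simp
    next
      case neg
      have "4 * s * (\<alpha> - r) * ((\<kappa> - \<delta> * r) * s - (r * (\<alpha> - r) - s\<^sup>2)) = 0"
        using c(5) unfolding neg s(2)[symmetric] by algebra
      then have "(\<kappa> - \<delta> * r) * s - (r * (\<alpha> - r) - s\<^sup>2) = 0" using s(1) jr(3) by simp
      then have cr: "\<kappa> * s = (\<alpha> - r) * r - s\<^sup>2 + \<delta> * r * s" by algebra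
      obtain y where "\<bar>y\<bar> < yend" "sy y = s" "ry y = r" "jy y = j"
        using crit_yparam[OF s r0 jr(3) cr] by blast
      then show ?thesis using curve[of y] neg c z3 by (simp add: j_def r_def)
    qed
  qed
qed

lemma center_differential:
  assumes "x \<in> chart_ball" "affine_lift \<alpha> k x $ 1 = 0" "affine_lift \<alpha> k x $ 2 = 0"
  shows "differential (F1 k) x v = 0" "differential (F2 k) x v = 0"
  using assms by (simp_all add: differential_F dJ3_def dh_def dR3_def dZ_def)

lemma center_value:
  assumes "x \<in> chart_ball" "affine_lift \<alpha> k x $ 1 = 0" "affine_lift \<alpha> k x $ 2 = 0"
  shows "(F1 k x, F2 k x) = (0, c0)"
  using assms by (simp add: F12 J_ham_def height_def R_ham_def Zh_def)

lemma curve_value: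
  assumes "x \<in> chart_ball" "z = affine_lift \<alpha> k x"
    and "J_ham z = jy y" "R_ham z = ry y" "Re (Zh z) = - 2 * sy y * (\<alpha> - ry y)"
  shows "(F1 k x, F2 k x) = crit_val y"
  using assms by (simp add: F12 crit_val_def height_def hy_def)

lemma singular_value:
  assumes "x \<in> chart_ball" "singular_at (F1 k) (F2 k) x" "(F1 k x, F2 k x) \<in> interior (F ` CP2 \<alpha>)"
  shows "(F1 k x, F2 k x) \<in> crit_val ` {- yend..yend}"
proof -
  obtain a b where ab: "(a, b) \<noteq> (0, 0)" "\<And>v. a * differential (F1 k) x v + b * differential (F2 k) x v = 0"
    using assms(2) by (auto simp: singular_at_def)
  show ?thesis
  proof (rule singular_C3[OF assms(1) refl ab assms(3)])
    assume "affine_lift \<alpha> k x $ 1 = 0" "affine_lift \<alpha> k x $ 2 = 0"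
    then show ?thesis using center_value[OF assms(1)] crit_val_yend ypar by (metis atLeastAtMost_iff imageI less_eq_real_def neg_le_0_iff_le order_trans)
  next
    fix y assume y: "\<bar>y\<bar> < yend" and "J_ham (affine_lift \<alpha> k x) = jy y" "R_ham (affine_lift \<alpha> k x) = ry y"
      "Re (Zh (affine_lift \<alpha> k x)) = - 2 * sy y * (\<alpha> - ry y)"
    then have "(F1 k x, F2 k x) = crit_val y" using curve_value[OF assms(1) refl] by blast
    moreover have "y \<in> {- yend..yend}" using y by auto
    ultimately show ?thesis by blast
  qed
qed

text \<open>With (a, b) = (1, 0) the curve case of \<open>singular_C3\<close> is impossible, since
  it asserts b \<noteq> 0.\<close>

lemma rank_zero_value:
  assumes "x \<in> chart_ball" "rank_zero_at (F1 k) (F2 k) x" "(F1 k x, F2 k x) \<in> interior (F ` CP2 \<alpha>)"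
  shows "(F1 k x, F2 k x) = (0, c0)"
proof (rule singular_C3[OF assms(1) refl _ _ assms(3), of 1 0])
  show "1 * differential (F1 k) x v + 0 * differential (F2 k) x v = 0" for v
    using assms(2) by (simp add: rank_zero_at_def)
qed (use center_value[OF assms(1)] in auto)

text \<open>On the level set of the first component, the pair \<open>(J, H)\<close> varies to second order by a multiple of the form \<open>Q\<close> of rank one,
  whereas off the parabolic values the reduced space forces a form of rank two.\<close>

lemma parabolic_aux:
  assumes x: "x \<in> chart_ball" and z: "z = affine_lift \<alpha> k x"
    and y: "\<bar>y\<bar> < yend" "J_ham z = jy y" "R_ham z = ry y" "Re (Zh z) = - 2 * sy y * (\<alpha> - ry y)" "Im (Zh z) = 0"
    and \<psi>: "(\<psi> has_derivative \<psi>') (at (0 :: real^3))" "\<psi> 0 = x"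
    and tan: "\<And>v. differential (F1 k) x v = 0 \<Longrightarrow> v \<in> range \<psi>'"
    and z12: "z $ 1 \<noteq> 0" "z $ 2 \<noteq> 0" "z $ 3 \<noteq> 0"
    and Q: "\<And>v. linear (Q v)" "\<And>v w. Q v w = Q w v" "form_rank Q = 1"
    and lim: "\<And>v. ((\<lambda>s. (F1 k (\<psi> (s *\<^sub>R v)) - F1 k x) / s\<^sup>2) \<longlongrightarrow> Q v v * m1) (at_right 0)"
      "\<And>v. ((\<lambda>s. (F2 k (\<psi> (s *\<^sub>R v)) - F2 k x) / s\<^sup>2) \<longlongrightarrow> Q v v * m2) (at_right 0)"
  shows "\<bar>y\<bar> = ypar"
proof (rule ccontr)
  assume "\<bar>y\<bar> \<noteq> ypar"
  then have psi: "psi (xq y) \<noteq> 0" using psi_xq(3)[OF y(1)] by simp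
  have N: "N_ham z = \<alpha>" using x z N_ham_lift by (simp add: chart_ball_norm)
  note l = level_facts[OF N]
  define L where "L s = affine_lift \<alpha> k (\<psi> s)" for s
  define L' where "L' v = lift' \<alpha> k x (\<psi>' v)" for v
  have L: "(L has_derivative L') (at 0)"
    unfolding L_def[abs_def] L'_def[abs_def]
    using has_derivative_compose[OF \<psi>(1), of "affine_lift \<alpha> k" "lift' \<alpha> k x"] lift_has_derivative x \<psi>(2)
    by (simp add: chart_ball_norm)
  have L0: "L 0 = z" using z \<psi>(2) by (simp add: L_def)
  define \<rho> where "\<rho> v = dR3 z (L' v)" for v
  define \<eta> where "\<eta> v = Im (dZ z (L' v))" for v
  have dr: "((\<lambda>s. R_ham (L s)) has_derivative \<rho>) (at 0)"
    unfolding \<rho>_def[abs_def] using has_derivative_compose[OF L, of R_ham "dR3 z"] JRZ_has_derivative L0 by simp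
  have "((\<lambda>s. Zh (L s)) has_derivative (\<lambda>v. dZ z (L' v))) (at 0)"
    using has_derivative_compose[OF L, of Zh "dZ z"] JRZ_has_derivative L0 by simp
  then have de: "((\<lambda>s. Im (Zh (L s))) has_derivative \<eta>) (at 0)"
    unfolding \<eta>_def[abs_def] by (rule bounded_linear.has_derivative[OF bounded_linear_Im])
  define s0 r0 j0 e h0 where "s0 = sy y" and "r0 = ry y" and "j0 = jy y" and "e = \<alpha> - ry y" and "h0 = height z"
  have s0: "0 < s0" "s0\<^sup>2 = r0\<^sup>2 - j0\<^sup>2" using sy_pos[OF y(1)] sy_sq[of y] by (simp_all add: s0_def r0_def j0_def)
  have e: "0 < e" "e = \<alpha> - r0" using ry_bounds[OF y(1)] by (simp_all add: e_def r0_def)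
  have crit: "\<kappa> * s0 = e * r0 - s0\<^sup>2 + \<delta> * r0 * s0"
    using sy_crit[OF y(1)] by (simp add: s0_def r0_def e_def)
  have h0: "h0 - \<kappa> * r0 + \<delta> * r0\<^sup>2 / 2 = - s0 * e"
    using y by (simp add: h0_def height_def s0_def r0_def e_def)
  have psieq: "psi (xq y) = 2 * r0 / s0 + e * j0\<^sup>2 / s0 ^ 3 - \<delta>"
    using psi_eq[OF y(1)] by (simp add: s0_def r0_def j0_def e_def)
  \<comment> \<open>To second order J and H both move by \<open>Q v v\<close> times a constant, so
    the left side of \<open>quadratic_relation\<close> is C times \<open>Q v v\<close>.\<close>
  define C where "C = 2 * s0 * e * (m2 / g) - 2 * j0 * e\<^sup>2 * m1"
  have eq: "C * Q v v = (e * s0 * psi (xq y)) * (\<rho> v)\<^sup>2 + (1 / 4) * (\<eta> v)\<^sup>2" for v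
  proof -
    have "isCont \<psi> 0" using \<psi>(1) has_derivative_continuous by blast
    moreover have "((\<lambda>s. s *\<^sub>R v) \<longlongrightarrow> 0) (at_right (0::real))" by (auto intro!: tendsto_eq_intros)
    ultimately have "((\<lambda>s. \<psi> (s *\<^sub>R v)) \<longlongrightarrow> x) (at_right 0)"
      using isCont_tendsto_compose[of 0 \<psi>] \<psi>(2) by simp
    then have ev: "\<forall>\<^sub>F s in at_right 0. \<psi> (s *\<^sub>R v) \<in> chart_ball" using open_chart_ball x topological_tendstoD by blast
    have lH: "((\<lambda>s. (height (L (s *\<^sub>R v)) - h0) / s\<^sup>2) \<longlongrightarrow> Q v v * (m2 / g)) (at_right 0)"
    proof -
      have "((\<lambda>s. (F2 k (\<psi> (s *\<^sub>R v)) - F2 k x) / s\<^sup>2 / g) \<longlongrightarrow> Q v v * m2 / g) (at_right 0)"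
        using g_pos by (intro tendsto_divide lim tendsto_const) simp
      moreover have "\<forall>\<^sub>F s in at_right 0. (F2 k (\<psi> (s *\<^sub>R v)) - F2 k x) / s\<^sup>2 / g = (height (L (s *\<^sub>R v)) - h0) / s\<^sup>2"
        using ev
      proof eventually_elim
        case (elim s)
        have "F2 k (\<psi> (s *\<^sub>R v)) - F2 k x = g * (height (L (s *\<^sub>R v)) - h0)"
          using F12(2)[OF elim] F12(2)[OF x] z by (simp add: L_def h0_def algebra_simps)
        then show ?case using g_pos by simp
      qed
      ultimately show ?thesis using Lim_transform_eventually by fastforce
    qed
    have lJ: "((\<lambda>s. (J_ham (L (s *\<^sub>R v)) - j0) / s\<^sup>2) \<longlongrightarrow> Q v v * m1) (at_right 0)"
    proof -
      have "\<forall>\<^sub>F s in at_right 0. (F1 k (\<psi> (s *\<^sub>R v)) - F1 k x) / s\<^sup>2 = (J_ham (L (s *\<^sub>R v)) - j0) / s\<^sup>2"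
        using ev by eventually_elim (use F12(1) x y z in \<open>simp add: L_def j0_def\<close>)
      then show ?thesis using lim(1)[of v] Lim_transform_eventually by fastforce
    qed
    have lR: "((\<lambda>s. (R_ham (L (s *\<^sub>R v)) - r0) / s) \<longlongrightarrow> \<rho> v) (at_right 0)"
      using line_quotient_tendsto[OF dr, of v] L0 y by (simp add: r0_def)
    have lY: "((\<lambda>s. Im (Zh (L (s *\<^sub>R v))) / s) \<longlongrightarrow> \<eta> v) (at_right 0)"
      using line_quotient_tendsto[OF de, of v] L0 y by simp
    have "\<forall>\<^sub>F s in at_right 0. (height (L (s *\<^sub>R v)) - \<kappa> * R_ham (L (s *\<^sub>R v)) + \<delta> * (R_ham (L (s *\<^sub>R v)))\<^sup>2 / 2)\<^sup>2 + (Im (Zh (L (s *\<^sub>R v))))\<^sup>2 / 4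
       = ((R_ham (L (s *\<^sub>R v)))\<^sup>2 - (J_ham (L (s *\<^sub>R v)))\<^sup>2) * (\<alpha> - R_ham (L (s *\<^sub>R v)))\<^sup>2"
      using ev
    proof eventually_elim
      case (elim s)
      then have "N_ham (L (s *\<^sub>R v)) = \<alpha>" using N_ham_lift by (simp add: L_def chart_ball_norm)
      from level_facts(6)[OF this] show ?case by (simp add: height_def power_divide field_simps)
    qed
    from quadratic_relation[OF s0 e(2) crit h0 lJ lH lR lY this]
    show ?thesis unfolding psieq C_def by (simp add: algebra_simps)
  qed
  have tan': "\<exists>v. dR3 z w = \<rho> v \<and> Im (dZ z w) = \<eta> v" if w: "z \<bullet> w = 0" "dJ3 z w = 0" for w
  proof -
    obtain v where v: "dJ3 z w = dJ3 z (lift' \<alpha> k x v)" "dR3 z w = dR3 z (lift' \<alpha> k x v)"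
      "dZ z w = dZ z (lift' \<alpha> k x v)"
      using lift_onto_d[of x \<alpha> k w] x w z by (auto simp: chart_ball_norm)
    then have "differential (F1 k) x v = 0" using w(2) z by (simp add: differential_F[OF x])
    then obtain v' where "v = \<psi>' v'" using tan by blast
    then show ?thesis by (auto simp: v \<rho>_def \<eta>_def L'_def)
  qed
  have in1: "x \<bullet> x = (cmod x)\<^sup>2" for x :: complex by (simp add: power2_norm_eq_inner)
  have in3: "x \<bullet> (of_real t * y) = t * (x \<bullet> y)" for x y :: complex and t by (simp add: inner_complex_def algebra_simps)
  have in2: "x \<bullet> (\<i> * x) = 0" for x :: complex by (simp add: inner_complex_def)
  obtain v1 where v1: "\<rho> v1 \<noteq> 0" "\<eta> v1 = 0"
  proof -
    \<comment> \<open>This direction changes the moduli with N and J fixed: it moves R but, since Im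
      Z = 0, not Im Z.\<close>
    define n1 n2 n3 where "n1 = (cmod (z $ 1))\<^sup>2" and "n2 = (cmod (z $ 2))\<^sup>2" and "n3 = (cmod (z $ 3))\<^sup>2"
    define w :: "complex^3" where "w = vector [of_real (n2 * n3) * z $ 1, of_real (n1 * n3) * z $ 2, of_real (- 2 * n1 * n2) * z $ 3]"
    have "z \<bullet> w = 0"
      by (simp only: inner_3 w_def vector_3 in3 in1 n1_def[symmetric] n2_def[symmetric] n3_def[symmetric]) simp
    moreover have "dJ3 z w = 0" and R: "dR3 z w = 2 * n1 * n2 * n3"
      by (simp_all only: dJ3_def dR3_def w_def vector_3 in3 in1 n1_def[symmetric] n2_def[symmetric] n3_def[symmetric]) simp_all
    moreover have "dZ z w = of_real (n2 * n3 + n1 * n3 - 4 * n1 * n2) * Zh z"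
      by (simp add: dZ_def w_def Zh_def power2_eq_square algebra_simps)
    then have "Im (dZ z w) = 0" using y(5) by simp
    moreover have "n1 \<noteq> 0" "n2 \<noteq> 0" "n3 \<noteq> 0" using z12 by (simp_all add: n1_def n2_def n3_def)
    ultimately obtain v where "\<rho> v = 2 * n1 * n2 * n3" "\<eta> v = 0" using tan'[of w] by metis
    then show ?thesis using that[of v] \<open>n1 \<noteq> 0\<close> \<open>n2 \<noteq> 0\<close> \<open>n3 \<noteq> 0\<close> by simp
  qed
  obtain v2 where v2: "\<rho> v2 = 0" "\<eta> v2 \<noteq> 0"
  proof -
    \<comment> \<open>This direction turns the phase of z_1: it moves Im Z but neither R nor
      J.\<close>
    define w :: "complex^3" where "w = vector [\<i> * z $ 1, 0, 0]"
    have "z \<bullet> w = 0" "dJ3 z w = 0" "dR3 z w = 0" by (simp_all add: inner_3 dJ3_def dR3_def w_def in2)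
    moreover have "dZ z w = \<i> * Zh z" by (simp add: dZ_def w_def Zh_def)
    moreover have "Re (Zh z) \<noteq> 0" using y(4) s0(1) e(1) by (simp add: s0_def e_def)
    ultimately obtain v where "\<rho> v = 0" "\<eta> v = Re (Zh z)" using tan'[of w] by fastforce
    then show ?thesis using that[of v] \<open>Re (Zh z) \<noteq> 0\<close> by simp
  qed
  show False
  proof (rule quadratic_rank_contradiction[OF Q(1) Q(2) Q(3) _ _ eq _ _ v1 v2])
    show "linear \<rho>" "linear \<eta>" using dr de has_derivative_linear by blast+
    show "e * s0 * psi (xq y) \<noteq> 0" using e s0 psi by simp
  qed simp
qed

end

context flap_mfd
begin

text \<open>In the normalized pair G = h(F) the first component is constant along \<psi> and the
  second varies by half its Hessian Q. Applying the inverse h', the original pair varies to second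
  order by Q times the fixed vector \<open>Dh' (0, 1)\<close> / 2, as \<open>parabolic_aux\<close>
  requires.\<close>

lemma parabolic_value:
  assumes x: "x \<in> chart_ball" and par: "parabolic_at (F1 k) (F2 k) x"
    and int: "(F1 k x, F2 k x) \<in> interior (F ` CP2 \<alpha>)"
  obtains y where "\<bar>y\<bar> = ypar" "(F1 k x, F2 k x) = crit_val y"
proof -
  define Fk where "Fk y = (F1 k y, F2 k y)" for y
  obtain h where "local_diffeo_at (Fk x) h"
    and pn: "parabolic_normal_at (\<lambda>y. fst (h (F1 k y, F2 k y))) (\<lambda>y. snd (h (F1 k y, F2 k y))) x"
    using par by (auto simp: parabolic_at_def Fk_def)
  then obtain V W h' where V: "open V" "Fk x \<in> V" and W: "open W" and hom: "homeomorphism V W h h'"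
    and h: "smooth_on V h" and h': "smooth_on W h'"
    by (auto simp: local_diffeo_at_def)
  define G where "G y = h (Fk y)" for y
  define G1 G2 where "G1 y = fst (G y)" and "G2 y = snd (G y)" for y
  have pn': "parabolic_normal_at G1 G2 x"
    using pn by (simp add: G1_def[abs_def] G2_def[abs_def] G_def Fk_def)
  define U where "U = {y \<in> chart_ball. Fk y \<in> V}"
  have FkC: "Ck_on n chart_ball Fk" for n
    unfolding Fk_def[abs_def] by (intro Ck_on_Pair open_chart_ball F12_Ck)
  have U: "open U" "x \<in> U"
  proof -
    have "continuous_on chart_ball Fk" using FkC[of 0] by simp
    then have "open (chart_ball \<inter> Fk -` V)" using open_chart_ball V(1) by (simp add: continuous_open_preimage)
    then show "open U" by (simp add: U_def Int_def)
    show "x \<in> U" using x V by (simp add: U_def)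
  qed
  have GC: "Ck_on n U G" for n
    unfolding G_def[abs_def]
  proof (rule Ck_on_compose[OF U(1) V(1), where f = Fk and g = h])
    show "Ck_on n U Fk" by (rule Ck_on_subset[OF FkC]) (auto simp: U_def)
    show "Ck_on n V h" using h by (simp only: smooth_on_def)
  qed (auto simp: U_def)
  have G12C: "Ck_on n U G1" "Ck_on n U G2" for n
    unfolding G1_def[abs_def] G2_def[abs_def]
    by (rule Ck_on_linear_compose[OF U(1) bounded_linear_fst GC],
        rule Ck_on_linear_compose[OF U(1) bounded_linear_snd GC])
  have hW: "h w \<in> W" "h' (h w) = w" if "w \<in> V" for w
    using hom that by (auto simp: homeomorphism_def)
  define Dh where "Dh = frechet_derivative h (at (Fk x))"
  have Dh: "(h has_derivative Dh) (at (Fk x))"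
    unfolding Dh_def using h V(2) by (intro Ck_on_Suc_has_derivative[OF V(1), of 0]) (simp_all only: smooth_on_def)
  define Dh' where "Dh' = frechet_derivative h' (at (G x))"
  have Gx: "G x \<in> W" using hW V by (simp add: G_def)
  have Dh': "(h' has_derivative Dh') (at (G x))"
    unfolding Dh'_def using h' Gx by (intro Ck_on_Suc_has_derivative[OF W, of 0]) (simp_all only: smooth_on_def)
  have lin: "linear Dh" "linear Dh'" using Dh Dh' has_derivative_linear by blast+
  have inv: "Dh' (Dh w) = w" for w
  proof -
    have "((\<lambda>w. h' (h w)) has_derivative (\<lambda>w. Dh' (Dh w))) (at (Fk x))"
      using has_derivative_compose[OF Dh, of h' Dh'] Dh' by (simp add: G_def)
    then have "((\<lambda>w. w) has_derivative (\<lambda>w. Dh' (Dh w))) (at (Fk x))"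
      by (rule has_derivative_transform_within_open[OF _ V]) (simp add: hW)
    from has_derivative_unique[OF this has_derivative_ident] show ?thesis by metis
  qed
  define d1 d2 where "d1 = differential (F1 k) x" and "d2 = differential (F2 k) x"
  have Fd: "(F1 k has_derivative d1) (at x)" "(F2 k has_derivative d2) (at x)"
    using F12_has_derivative[OF x, of k] by (simp_all add: d1_def d2_def differential_eq[OF F12_has_derivative(1)[OF x]] differential_eq[OF F12_has_derivative(2)[OF x]])
  have "(Fk has_derivative (\<lambda>v. (d1 v, d2 v))) (at x)"
    unfolding Fk_def[abs_def] by (intro has_derivative_Pair Fd)
  from has_derivative_compose[OF this, of h Dh] Dh
  have Gd: "(G has_derivative (\<lambda>v. Dh (d1 v, d2 v))) (at x)" by (simp add: G_def[abs_def])
  have G12d: "differential G1 x = (\<lambda>v. fst (Dh (d1 v, d2 v)))" "differential G2 x = (\<lambda>v. snd (Dh (d1 v, d2 v)))"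
    unfolding G1_def[abs_def] G2_def[abs_def]
    by (intro differential_eq has_derivative_fst has_derivative_snd Gd)+
  obtain v0 where v0: "differential G1 x v0 \<noteq> 0" using pn' by (auto simp: parabolic_normal_at_def)
  obtain m where m: "\<And>v. differential G2 x v = m * differential G1 x v"
    using pn' by (auto simp: parabolic_normal_at_def)
  define a b where "a = snd (Dh (1, 0)) - m * fst (Dh (1, 0))" and "b = snd (Dh (0, 1)) - m * fst (Dh (0, 1))"
  have split: "Dh (s, t) = s *\<^sub>R Dh (1, 0) + t *\<^sub>R Dh (0, 1)" for s t
  proof -
    have "Dh (s, t) = Dh (s *\<^sub>R (1, 0) + t *\<^sub>R (0, 1))" by simp
    then show ?thesis by (simp only: linear_add[OF lin(1)] linear_cmul[OF lin(1)])
  qed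
  have sing: "a * differential (F1 k) x v + b * differential (F2 k) x v = 0" for v
    using m[of v] unfolding G12d split[of "d1 v" "d2 v"] d1_def[symmetric] d2_def[symmetric]
    by (simp add: a_def b_def algebra_simps)
  \<comment> \<open>Otherwise Dh would map the plane into the line of slope m, although
    \<open>inv\<close> makes it injective.\<close>
  have ab: "(a, b) \<noteq> (0, 0)"
  proof
    assume "(a, b) = (0, 0)"
    then have 0: "snd (Dh (s, t)) = m * fst (Dh (s, t))" for s t
      by (simp add: a_def b_def split[of s t] algebra_simps)
    have inj: "w = 0" if "Dh w = 0" for w using inv[of w] that lin(2) by (simp add: linear_0)
    define p q where "p = fst (Dh (1, 0))" and "q = fst (Dh (0, 1))"
    have "fst (Dh (q, - p)) = 0" unfolding split[of q "- p"] by (simp add: p_def q_def)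
    then have "Dh (q, - p) = 0" using 0[of q "- p"] by (simp add: prod_eq_iff)
    then have "p = 0" "q = 0" using inj[of "(q, - p)"] by (auto simp: zero_prod_def)
    then have "Dh (1, 0) = 0" using 0[of 1 0] by (simp add: prod_eq_iff p_def)
    then show False using inj[of "(1, 0)"] by (auto simp: zero_prod_def)
  qed
  have nz: "\<exists>v. d1 v \<noteq> 0 \<or> d2 v \<noteq> 0"
  proof (rule ccontr)
    assume "\<not> ?thesis"
    then have "Dh (d1 v0, d2 v0) = 0" using linear_0[OF lin(1)] by (simp add: zero_prod_def)
    then show False using v0 by (simp add: G12d)
  qed
  define z where "z = affine_lift \<alpha> k x"
  show thesis
  proof (rule singular_C3[OF x z_def ab sing int])
    assume "z $ 1 = 0" "z $ 2 = 0"
    then show thesis using center_differential[OF x] nz by (auto simp: z_def d1_def d2_def)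
  next
    fix y assume y: "\<bar>y\<bar> < yend" "J_ham z = jy y" "R_ham z = ry y" "Re (Zh z) = - 2 * sy y * (\<alpha> - ry y)" "Im (Zh z) = 0"
      and z12: "z $ 1 \<noteq> 0" "z $ 2 \<noteq> 0" "z $ 3 \<noteq> 0" and b0: "b \<noteq> 0"
    obtain V' and \<psi> :: "real^3 \<Rightarrow> complex^2" where V': "open V'" "0 \<in> V'" and \<psi>: "smooth_on V' \<psi>" "\<psi> 0 = x"
      "inj (frechet_derivative \<psi> (at 0))" "\<And>s. s \<in> V' \<Longrightarrow> G1 (\<psi> s) = G1 x"
      "\<And>v. differential (G2 \<circ> \<psi>) 0 v = 0" "form_rank (hessian (G2 \<circ> \<psi>) 0) = 1"
      using pn' unfolding parabolic_normal_at_def by blast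
    define \<psi>' where "\<psi>' = frechet_derivative \<psi> (at 0)"
    have \<psi>d: "(\<psi> has_derivative \<psi>') (at 0)"
      unfolding \<psi>'_def using \<psi>(1) V'(2) by (intro Ck_on_Suc_has_derivative[OF V'(1), of 0]) (simp_all only: smooth_on_def)
    have \<psi>l: "linear \<psi>'" using \<psi>d has_derivative_linear by blast
    have G1d: "(G1 has_derivative differential G1 x) (at x)"
      unfolding G12d using has_derivative_fst[OF Gd] by (simp only: G1_def[abs_def])
    then have G1l: "linear (differential G1 x)" by (rule has_derivative_linear)
    \<comment> \<open>Since b \<noteq> 0, dF2 is a multiple of dF1, so the kernel of dF1 lies in
      that of dG1. This hyperplane is the range of \<psi>' by a count of dimensions.\<close>
    have tan: "v \<in> range \<psi>'" if "differential (F1 k) x v = 0" for v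
    proof -
      have "d2 v = 0" using sing[of v] that b0 by (simp add: d2_def)
      then have v: "differential G1 x v = 0" using that lin(1) by (simp add: G12d d1_def linear_0 zero_prod_def[symmetric])
      define n where "n = (\<Sum>b\<in>Basis. differential G1 x b *\<^sub>R b)"
      have n: "differential G1 x w = n \<bullet> w" for w
      proof -
        have "differential G1 x w = differential G1 x (\<Sum>b\<in>Basis. (w \<bullet> b) *\<^sub>R b)" by (simp add: euclidean_representation)
        also have "\<dots> = (\<Sum>b\<in>Basis. (w \<bullet> b) * differential G1 x b)"
          by (simp only: linear_sum[OF G1l] linear_cmul[OF G1l] real_scaleR_def)
        also have "\<dots> = n \<bullet> w"
          unfolding n_def inner_sum_left inner_scaleR_left by (simp add: inner_commute mult.commute)
        finally show ?thesis .
      qed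
      have n0: "n \<noteq> 0" using v0 n by auto
      have "range \<psi>' \<subseteq> {w. n \<bullet> w = 0}"
      proof clarify
        fix u
        have "((\<lambda>s. G1 (\<psi> s)) has_derivative (\<lambda>v. differential G1 x (\<psi>' v))) (at 0)"
          by (rule has_derivative_compose[OF \<psi>d]) (simp only: \<psi>(2) G1d)
        then have "((\<lambda>s. G1 x) has_derivative (\<lambda>v. differential G1 x (\<psi>' v))) (at 0)"
          by (rule has_derivative_transform_within_open[OF _ V']) (simp add: \<psi>(4))
        from has_derivative_unique[OF this has_derivative_const] show "n \<bullet> \<psi>' u = 0"
          by (simp add: n[symmetric] fun_eq_iff)
      qed
      moreover have "dim (range \<psi>') = 3"
      proof -
        have "inj \<psi>'" using \<psi>(3) by (simp add: \<psi>'_def)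
        then have "dim (\<psi>' ` UNIV) = dim (UNIV :: (real^3) set)" by (intro dim_image_eq \<psi>l) auto
        then show ?thesis by simp
      qed
      moreover have "dim {w. n \<bullet> w = 0} = 3" using dim_hyperplane[OF n0] by simp
      moreover have "subspace (range \<psi>')" using \<psi>l by (simp add: linear_subspace_image)
      ultimately have "range \<psi>' = {w. n \<bullet> w = 0}"
        by (intro subspace_dim_equal subspace_hyperplane) auto
      then show ?thesis using v n by auto
    qed
    define U1 where "U1 = {s \<in> V'. \<psi> s \<in> U}"
    have U1: "open U1" "0 \<in> U1"
    proof -
      have "Ck_on 0 V' \<psi>" using \<psi>(1) by (simp only: smooth_on_def)
      then have "open (V' \<inter> \<psi> -` U)" using V'(1) U(1) by (simp add: continuous_open_preimage)
      then show "open U1" by (simp add: U1_def Int_def)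
      show "0 \<in> U1" using V' U \<psi>(2) by (simp add: U1_def)
    qed
    have "Ck_on 2 U1 (\<lambda>s. G2 (\<psi> s))"
    proof (rule Ck_on_compose[OF U1(1) U(1) _ G12C(2), where f = \<psi>])
      have "Ck_on 2 V' \<psi>" using \<psi>(1) by (simp only: smooth_on_def)
      then show "Ck_on 2 U1 \<psi>" by (rule Ck_on_subset) (auto simp: U1_def)
    qed (auto simp: U1_def)
    then have C2: "Ck_on 2 U1 (G2 \<circ> \<psi>)" by (simp add: comp_def)
    define Q where "Q = hessian (G2 \<circ> \<psi>) 0"
    have Ql: "linear (Q v)" for v
      using C2_hessian[OF C2 U1, of v] has_derivative_linear unfolding Q_def by blast
    have Qs: "Q v w = Q w v" for v w
      unfolding Q_def by (rule hessian_commute[OF C2 U1])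
    have lim: "((\<lambda>s. (f (Fk (\<psi> (s *\<^sub>R v))) - f (Fk x)) / s\<^sup>2) \<longlongrightarrow> Q v v * (f (Dh' (0, 1)) / 2)) (at_right 0)"
      if f: "bounded_linear f" for f :: "real \<times> real \<Rightarrow> real" and v
    proof -
      have t: "((\<lambda>s. ((G2 \<circ> \<psi>) (0 + s *\<^sub>R v) - (G2 \<circ> \<psi>) 0) / s\<^sup>2) \<longlongrightarrow> hessian (G2 \<circ> \<psi>) 0 v v / 2) (at_right 0)"
        by (rule second_order_tendsto[OF C2 U1 \<psi>(5)])
      have fd: "((\<lambda>w. f (h' w)) has_derivative (\<lambda>w. f (Dh' w))) (at (G1 x, G2 x))"
        using bounded_linear.has_derivative[OF f Dh'] by (simp add: G1_def G2_def)
      have "((\<lambda>s. (f (h' (G1 x, G2 x + (G2 (\<psi> (s *\<^sub>R v)) - G2 x))) - f (h' (G1 x, G2 x))) / s\<^sup>2)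
          \<longlongrightarrow> Q v v / 2 * f (Dh' (0, 1))) (at_right 0)"
        by (rule quadratic_quotient_tendsto[OF fd]) (use t \<psi>(2) in \<open>simp add: Q_def\<close>)
      moreover have "\<forall>\<^sub>F s in at_right 0. (f (h' (G1 x, G2 x + (G2 (\<psi> (s *\<^sub>R v)) - G2 x))) - f (h' (G1 x, G2 x))) / s\<^sup>2
          = (f (Fk (\<psi> (s *\<^sub>R v))) - f (Fk x)) / s\<^sup>2"
      proof -
        have "((\<lambda>s. s *\<^sub>R v) \<longlongrightarrow> 0) (at_right (0::real))" by (auto intro!: tendsto_eq_intros)
        then have "\<forall>\<^sub>F s in at_right 0. s *\<^sub>R v \<in> U1" using U1 topological_tendstoD by blast
        then show ?thesis
        proof eventually_elim
          case (elim s)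
          then have "G1 (\<psi> (s *\<^sub>R v)) = G1 x" "Fk (\<psi> (s *\<^sub>R v)) \<in> V"
            using \<psi>(4) by (auto simp: U1_def U_def)
          then have "h' (G1 x, G2 (\<psi> (s *\<^sub>R v))) = Fk (\<psi> (s *\<^sub>R v))"
            using hW(2) by (metis G1_def G2_def G_def prod.collapse)
          moreover have "h' (G1 x, G2 x) = Fk x" using hW(2) V(2) by (simp add: G1_def G2_def G_def)
          ultimately show ?case by simp
        qed
      qed
      ultimately have "((\<lambda>s. (f (Fk (\<psi> (s *\<^sub>R v))) - f (Fk x)) / s\<^sup>2) \<longlongrightarrow> Q v v / 2 * f (Dh' (0, 1))) (at_right 0)"
        by (rule Lim_transform_eventually)
      then show ?thesis by simp
    qed
    have "\<bar>y\<bar> = ypar"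
    proof (rule parabolic_aux[OF x z_def y \<psi>d \<psi>(2) tan z12 Ql Qs])
      show "form_rank Q = 1" using \<psi>(6) by (simp add: Q_def)
      show "((\<lambda>s. (F1 k (\<psi> (s *\<^sub>R v)) - F1 k x) / s\<^sup>2) \<longlongrightarrow> Q v v * (fst (Dh' (0, 1)) / 2)) (at_right 0)"
        "((\<lambda>s. (F2 k (\<psi> (s *\<^sub>R v)) - F2 k x) / s\<^sup>2) \<longlongrightarrow> Q v v * (snd (Dh' (0, 1)) / 2)) (at_right 0)" for v
        using lim[OF bounded_linear_fst, of v] lim[OF bounded_linear_snd, of v] by (simp_all add: Fk_def)
    qed
    moreover have "(F1 k x, F2 k x) = crit_val y" by (rule curve_value[OF x z_def y(2,3,4)])
    ultimately show thesis by (rule that)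
  qed
qed

end

section \<open>The flap\<close>

context flap_mfd
begin

lemma lift_3: "affine_lift \<alpha> 3 u = vector [u $ 1, u $ 2, complex_of_real (sqrt (2 * \<alpha> - (norm u)\<^sup>2))]"
  by (simp add: affine_lift_def)

lemma chart_ball_inner: "u \<in> chart_ball \<longleftrightarrow> u \<bullet> u < 2 * \<alpha>"
proof -
  have "norm u < sqrt (2 * \<alpha>) \<longleftrightarrow> sqrt (u \<bullet> u) < sqrt (2 * \<alpha>)" by (simp add: norm_eq_sqrt_inner)
  then show ?thesis by (simp add: chart_ball_norm)
qed

lemma chart_3: "flap_chart \<alpha> \<kappa> \<delta> c0 g (F1 3) (F2 3)"
proof unfold_locales
  fix u :: "complex^2" assume "u \<bullet> u < 2 * \<alpha>"
  then have u: "u \<in> chart_ball" by (simp add: chart_ball_inner)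
  show "F1 3 u = Jc u" by (simp add: F12[OF u] J_ham_def Jc_def lift_3)
  have pos: "0 \<le> 2 * \<alpha> - (norm u)\<^sup>2" using norm_lt_sqrt[of u "2 * \<alpha>"] u by (simp add: chart_ball_norm)
  have R: "R_ham (affine_lift \<alpha> 3 u) = Rc u"
    by (simp add: R_ham_def Rc_def lift_3 inner_2 power2_norm_eq_inner)
  have "Zh (affine_lift \<alpha> 3 u) = of_real (2 * \<alpha> - (norm u)\<^sup>2) * (u $ 1 * u $ 2)"
    using pos by (simp add: Zh_def lift_3 flip: of_real_power)
  moreover have "2 * \<alpha> - (norm u)\<^sup>2 = 2 * (\<alpha> - Rc u)" by (simp add: Rc_def power2_norm_eq_inner)
  ultimately have "Re (Zh (affine_lift \<alpha> 3 u)) = 2 * (\<alpha> - Rc u) * Xc u" by (simp add: Xc_def)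
  then show "F2 3 u = Hc u" by (simp add: F12[OF u] height_def R Hc_def)
qed

lemma curve_point:
  assumes y: "\<bar>y\<bar> < yend"
  shows "\<bar>y\<bar> < ypar \<Longrightarrow> crit_val y \<in> hyperbolic_regular_values (CP2_atlas \<alpha>) F"
    "ypar < \<bar>y\<bar> \<Longrightarrow> crit_val y \<in> elliptic_regular_values (CP2_atlas \<alpha>) F"
    "\<bar>y\<bar> = ypar \<Longrightarrow> crit_val y \<in> parabolic_values (CP2_atlas \<alpha>) F"
proof -
  \<comment> \<open>The moduli of z_1 and z_2 at a point with R = \<open>ry y\<close> and J =
    \<open>jy y\<close>.\<close>
  define p q where "p = sqrt (ry y + jy y)" and "q = sqrt (ry y - jy y)"
  have b: "0 < ry y" "ry y < \<alpha>" "\<bar>jy y\<bar> < ry y" using ry_bounds[OF y] by auto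
  have pq: "0 < p" "0 < q" "p\<^sup>2 = ry y + jy y" "q\<^sup>2 = ry y - jy y" using b by (auto simp: p_def q_def)
  have s: "p * q = sy y"
  proof -
    have "p * q = sqrt ((ry y)\<^sup>2 - (jy y)\<^sup>2)"
      unfolding p_def q_def real_sqrt_mult[symmetric] by (simp add: algebra_simps power2_eq_square)
    then show ?thesis unfolding sy_sq[symmetric] using sy_pos[OF y] by simp
  qed
  have r: "(p\<^sup>2 + q\<^sup>2) / 2 = ry y" by (simp add: pq)
  interpret C: flap_chart \<alpha> \<kappa> \<delta> c0 g "F1 3" "F2 3" by (rule chart_3)
  interpret P: flap_point \<alpha> \<kappa> \<delta> c0 g "F1 3" "F2 3" p q
    by unfold_locales (use pq b sy_crit[OF y] in \<open>simp_all add: r s\<close>)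
  have Pr: "P.r = ry y" and Pj: "P.j = jy y" by (simp_all add: P.r_def P.j_def pq)
  have x: "P.x0 \<in> chart_ball" using P.x0_dom by (simp add: chart_ball_inner C.dom_def)
  have val: "crit_val y = (F1 3 P.x0, F2 3 P.x0)"
    using C.f1[of P.x0] C.f2[of P.x0] x
    by (simp add: chart_ball_inner crit_val_def P.Jx0 Pj Hc_def P.Rx0 P.Xx0 Pr s hy_def)
  have ps: "P.psi' = psi (xq y)" by (simp add: P.psi'_def psi_eq[OF y] s Pr Pj P.e_def)
  have jn: "P.j \<noteq> 0" if "\<bar>y\<bar> = ypar" using that ypar sy_pos[OF y] by (auto simp: Pj jy_def)
  show "\<bar>y\<bar> < ypar \<Longrightarrow> crit_val y \<in> hyperbolic_regular_values (CP2_atlas \<alpha>) F"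
    unfolding hyperbolic_regular_values_def points_of_type_iff
    using P.hyperbolic_x0 x val psi_xq[OF y] ps by auto
  show "ypar < \<bar>y\<bar> \<Longrightarrow> crit_val y \<in> elliptic_regular_values (CP2_atlas \<alpha>) F"
    unfolding elliptic_regular_values_def points_of_type_iff
    using P.elliptic_x0 x val psi_xq[OF y] ps by auto
  show "\<bar>y\<bar> = ypar \<Longrightarrow> crit_val y \<in> parabolic_values (CP2_atlas \<alpha>) F"
    unfolding parabolic_values_def points_of_type_iff
    using P.parabolic_x0 x val psi_xq[OF y] ps jn by auto
qed

lemma center_elliptic: "(0, c0) \<in> elliptic_elliptic_values (CP2_atlas \<alpha>) F"
proof -
  interpret C: flap_chart \<alpha> \<kappa> \<delta> c0 g "F1 3" "F2 3" by (rule chart_3)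
  have "0 \<in> chart_ball" using C.zero_dom by (simp add: chart_ball_inner C.dom_def)
  then show ?thesis
    unfolding elliptic_elliptic_values_def points_of_type_iff
    using C.elliptic_elliptic_0 center_value[of 0 3] by (auto simp: lift_3)
qed

section \<open>The Jordan curve of critical values\<close>

definition crit_curve :: "(real \<times> real) set" where "crit_curve = crit_val ` {- yend..yend}"
definition arc_h :: "real \<Rightarrow> real \<times> real" where "arc_h = crit_val \<circ> linepath ypar (- ypar)"
text \<open>The sign t = 1 or t = -1 selects the elliptic side on which J has that sign.\<close>

definition arc_e :: "real \<Rightarrow> real \<Rightarrow> real \<times> real" where "arc_e t = crit_val \<circ> linepath (t * ypar) (t * yend)"

lemma crit_val_continuous: "continuous_on {- yend..yend} crit_val"
  unfolding crit_val_def by (intro continuous_intros jy_continuous hy_continuous)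

lemma arc_h: "arc arc_h" "path_image arc_h = crit_val ` {- ypar..ypar}"
  "pathstart arc_h = crit_val ypar" "pathfinish arc_h = crit_val (- ypar)"
proof -
  have s: "closed_segment ypar (- ypar) = {- ypar..ypar}" using ypar by (simp add: closed_segment_eq_real_ivl)
  have "inj_on crit_val {- ypar..ypar}"
  proof (rule inj_onI)
    fix y y' assume "y \<in> {- ypar..ypar}" "y' \<in> {- ypar..ypar}" "crit_val y = crit_val y'"
    then show "y = y'" using jy_incr[of y y'] jy_incr[of y' y] by (cases y y' rule: linorder_cases) (auto simp: crit_val_def)
  qed
  then show "arc arc_h" "path_image arc_h = crit_val ` {- ypar..ypar}"
    "pathstart arc_h = crit_val ypar" "pathfinish arc_h = crit_val (- ypar)"
    unfolding arc_h_def using ypar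
      arc_reparam[of ypar "- ypar" crit_val, unfolded s] continuous_on_subset[OF crit_val_continuous, of "{- ypar..ypar}"]
    by auto
qed

lemma arc_e:
  assumes "t = 1 \<or> t = - 1"
  shows "arc (arc_e t)" "path_image (arc_e t) = (\<lambda>y. crit_val (t * y)) ` {ypar..yend}"
    "pathstart (arc_e t) = crit_val (t * ypar)" "pathfinish (arc_e t) = (0, c0)"
proof -
  have s: "closed_segment (t * ypar) (t * yend) = (*) t ` {ypar..yend}"
    using assms ypar by (auto simp: closed_segment_eq_real_ivl)
  have "inj_on crit_val ((*) t ` {ypar..yend})"
  proof (rule inj_onI, clarify)
    fix y y' assume a: "y \<in> {ypar..yend}" "y' \<in> {ypar..yend}" "crit_val (t * y) = crit_val (t * y')"
    then have "jy y = jy y'" using assms by (auto simp: crit_val_def)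
    then show "t * y = t * y'"
      using a jy_decr[of y y'] jy_decr[of y' y] by (cases y y' rule: linorder_cases) auto
  qed
  moreover have "continuous_on ((*) t ` {ypar..yend}) crit_val"
    by (rule continuous_on_subset[OF crit_val_continuous]) (use assms ypar in auto)
  moreover have "t * ypar \<noteq> t * yend" using assms ypar by auto
  moreover have "crit_val (t * yend) = (0, c0)" using assms crit_val_yend by auto
  ultimately show "arc (arc_e t)" "path_image (arc_e t) = (\<lambda>y. crit_val (t * y)) ` {ypar..yend}"
    "pathstart (arc_e t) = crit_val (t * ypar)" "pathfinish (arc_e t) = (0, c0)"
    unfolding arc_e_def using arc_reparam[of "t * ypar" "t * yend" crit_val, unfolded s]
    by (simp_all add: image_image)
qed

lemma jy_nonneg: "0 \<le> y \<Longrightarrow> y \<le> yend \<Longrightarrow> 0 \<le> jy y"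
  using jy_pos[of y] by (cases "y = 0 \<or> y = yend") (auto simp: jy_def)

lemma crit_val_meet:
  assumes "\<bar>y\<bar> \<le> ypar" "ypar \<le> y'" "y' \<le> yend" "crit_val y = crit_val y'"
  shows "y = ypar \<and> y' = ypar"
proof (rule ccontr)
  assume n: "\<not> ?thesis"
  have j: "jy y = jy y'" and h: "hy y = hy y'" using assms(4) g_pos by (auto simp: crit_val_def)
  have y0: "0 \<le> y"
  proof (rule ccontr)
    assume "\<not> 0 \<le> y"
    then have "0 < jy (- y)" using jy_pos[of "- y"] assms ypar by simp
    then show False using j jy_nonneg[of y'] assms ypar by simp
  qed
  have "y < y'"
    using n assms y0 by auto
  then show False using hy_less[of y y'] y0 assms j h by auto
qed

lemma triangle: "arc_triangle arc_h (arc_e 1) (arc_e (- 1)) (crit_val ypar) (crit_val (- ypar)) (0, c0)"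
proof -
  have neg: "crit_val (- a) = crit_val (- b) \<longleftrightarrow> crit_val a = crit_val b" for a b by (auto simp: crit_val_def)
  have i1: "crit_val ` {- ypar..ypar} \<inter> crit_val ` {ypar..yend} = {crit_val ypar}"
  proof (intro equalityI subsetI)
    fix w assume "w \<in> crit_val ` {- ypar..ypar} \<inter> crit_val ` {ypar..yend}"
    then obtain y y' where "\<bar>y\<bar> \<le> ypar" "ypar \<le> y'" "y' \<le> yend" "crit_val y = crit_val y'" "w = crit_val y" by force
    then show "w \<in> {crit_val ypar}" using crit_val_meet by auto
  qed (use ypar in auto)
  have i2: "crit_val ` {- ypar..ypar} \<inter> (\<lambda>y. crit_val (- y)) ` {ypar..yend} = {crit_val (- ypar)}"
  proof (intro equalityI subsetI)
    fix w assume "w \<in> crit_val ` {- ypar..ypar} \<inter> (\<lambda>y. crit_val (- y)) ` {ypar..yend}"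
    then obtain y y' where y: "\<bar>y\<bar> \<le> ypar" "ypar \<le> y'" "y' \<le> yend" "crit_val y = crit_val (- y')" "w = crit_val y" by force
    then have "crit_val (- y) = crit_val y'" using neg[of "- y" y'] by simp
    then show "w \<in> {crit_val (- ypar)}" using crit_val_meet[of "- y" y'] y by auto
  qed (use ypar in auto)
  \<comment> \<open>J is nonnegative on one elliptic side and nonpositive on the other, so a common
    value has J = 0, which happens only at \<open>yend\<close>.\<close>
  have i3: "crit_val ` {ypar..yend} \<inter> (\<lambda>y. crit_val (- y)) ` {ypar..yend} = {(0, c0)}"
  proof (intro equalityI subsetI)
    fix w assume "w \<in> crit_val ` {ypar..yend} \<inter> (\<lambda>y. crit_val (- y)) ` {ypar..yend}"
    then obtain y y' where y: "ypar \<le> y" "y \<le> yend" "ypar \<le> y'" "y' \<le> yend" "crit_val y = crit_val (- y')" "w = crit_val y" by auto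
    then have "jy y = - jy y'" by (simp add: crit_val_def)
    then have "jy y = 0" using jy_nonneg[of y] jy_nonneg[of y'] y ypar by auto
    then have "y = yend" using jy_pos[of y] y ypar by force
    then show "w \<in> {(0, c0)}" using y crit_val_yend by simp
  next
    have "crit_val yend \<in> crit_val ` {ypar..yend}" "crit_val (- yend) \<in> (\<lambda>y. crit_val (- y)) ` {ypar..yend}" using ypar by auto
    then show "w \<in> crit_val ` {ypar..yend} \<inter> (\<lambda>y. crit_val (- y)) ` {ypar..yend}" if "w \<in> {(0, c0)}" for w
      using that crit_val_yend by auto
  qed
  show ?thesis
    unfolding arc_triangle_def using arc_h arc_e[of 1] arc_e[of "- 1"] i1 i2 i3 by simp
qed

lemma triangle_image: "path_image arc_h \<union> path_image (arc_e 1) \<union> path_image (arc_e (- 1)) = crit_curve"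
proof -
  have "(\<lambda>y. crit_val (- y)) ` {ypar..yend} = crit_val ` uminus ` {ypar..yend}" by (simp only: image_image)
  moreover have "{- yend..yend} = {- ypar..ypar} \<union> {ypar..yend} \<union> uminus ` {ypar..yend}" using ypar by auto
  ultimately show ?thesis using arc_h(2) arc_e(2)[of 1] arc_e(2)[of "- 1"]
    by (simp only: crit_curve_def image_Un mult_minus1 mult_1 simp_thms)
qed

section \<open>The flap lies in the interior of the image\<close>

definition upper :: "real \<Rightarrow> real \<Rightarrow> real" where
  "upper j r = \<kappa> * r + (\<alpha> - r) * sqrt (r\<^sup>2 - j\<^sup>2) - \<delta> * r\<^sup>2 / 2"

text \<open>An open part of the image, large enough to contain the flap, so that the boundary of the
  image need not be determined. Every point of its complement starts a ray in the complement, which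
  lets \<open>not_inside_ray\<close> handle the inside of the curve.\<close>

definition region :: "(real \<times> real) set" where
  "region = (\<Union>r\<in>{0<..<\<alpha>}. {w. \<bar>fst w\<bar> < r \<and> c0 + g * hmin < snd w \<and> snd w < c0 + g * upper (fst w) r})"

lemma open_region: "open region"
  unfolding region_def upper_def
  by (intro open_UN ballI open_Collect_conj open_Collect_less continuous_intros)

lemma region_image: "region \<subseteq> F ` CP2 \<alpha>"
proof
  fix w assume "w \<in> region"
  then obtain r where r: "0 < r" "r < \<alpha>" "\<bar>fst w\<bar> < r" "c0 + g * hmin < snd w" "snd w < c0 + g * upper (fst w) r"
    by (auto simp: region_def)
  define j where "j = fst w"
  \<comment> \<open>At fixed J the upper profile runs continuously from a value above that of w at r
    down to \<open>hmin\<close> at \<alpha>, so it takes the value of w in between.\<close>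
  have "upper j \<alpha> = hmin" by (simp add: upper_def hmin_def)
  then have "\<exists>\<rho>. r \<le> \<rho> \<and> \<rho> \<le> \<alpha> \<and> c0 + g * upper j \<rho> = snd w"
    using r by (intro IVT2') (auto simp: j_def upper_def intro!: continuous_intros)
  then obtain \<rho> where \<rho>: "r \<le> \<rho>" "\<rho> \<le> \<alpha>" "c0 + g * upper j \<rho> = snd w" by blast
  have jr: "\<bar>j\<bar> < \<rho>" using r \<rho> by (simp add: j_def)
  define z :: "complex^3" where "z = vector [of_real (sqrt (\<rho> + j)), of_real (sqrt (\<rho> - j)), of_real (sqrt (2 * (\<alpha> - \<rho>)))]"
  have n: "(cmod (z $ 1))\<^sup>2 = \<rho> + j" "(cmod (z $ 2))\<^sup>2 = \<rho> - j" "(cmod (z $ 3))\<^sup>2 = 2 * (\<alpha> - \<rho>)"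
    using jr \<rho> by (simp_all add: z_def)
  have N: "N_ham z = \<alpha>" and J: "J_ham z = j" and R: "R_ham z = \<rho>"
    unfolding N_ham_def J_ham_def R_ham_def n by simp_all
  have "Zh z = of_real (sqrt (\<rho> + j) * sqrt (\<rho> - j) * (sqrt (2 * (\<alpha> - \<rho>)))\<^sup>2)"
    by (simp add: Zh_def z_def)
  moreover have "sqrt (\<rho> + j) * sqrt (\<rho> - j) = sqrt (\<rho>\<^sup>2 - j\<^sup>2)"
    by (simp add: real_sqrt_mult[symmetric] algebra_simps power2_eq_square)
  ultimately have "Re (Zh z) = 2 * (\<alpha> - \<rho>) * sqrt (\<rho>\<^sup>2 - j\<^sup>2)" using \<rho>(2) by simp
  then have "height z = upper j \<rho>" by (simp add: height_def R upper_def)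
  then have "w = (J_ham z, c0 + g * height z)" using \<rho>(3) J by (simp add: j_def prod_eq_iff)
  then show "w \<in> F ` CP2 \<alpha>" unfolding image_F using N by blast
qed

lemma crit_curve_region: "crit_curve \<subseteq> region"
proof
  fix w assume "w \<in> crit_curve"
  then obtain y where "y \<in> {- yend..yend}" and w: "w = crit_val y" unfolding crit_curve_def by blast
  then have y: "\<bar>y\<bar> \<le> yend" "w = crit_val y" by auto
  \<comment> \<open>For the value of B, whose own radius 0 is excluded from \<open>region\<close>,
    the radius \<alpha>/\<delta> is taken: \<delta> r^2 = \<alpha> r there, and the upper profile is
    still positive.\<close>
  have ad: "0 < \<alpha> / \<delta>" "\<alpha> / \<delta> < \<alpha>" using alpha_pos xend(4) by (simp_all add: field_simps)
  show "w \<in> region"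
  proof (cases "\<bar>y\<bar> = yend")
    case True
    then have "y = yend \<or> y = - yend" by linarith
    then have w: "w = (0, c0)" using y(2) crit_val_yend by auto
    have "hmin < 0" using below_pos[of 0] alpha_pos
      by (simp add: hmin_def power2_eq_square)
    moreover have "0 < upper 0 (\<alpha> / \<delta>)"
    proof -
      have "upper 0 (\<alpha> / \<delta>) = \<alpha> / \<delta> * (\<kappa> + \<alpha> - \<alpha> / \<delta> - \<alpha> / 2)"
      proof -
        define m where "m = \<alpha> / \<delta>"
        have m: "0 < m" "\<delta> * m\<^sup>2 = \<alpha> * m" using ad xend(4) by (simp_all add: m_def power2_eq_square)
        have "upper 0 m = \<kappa> * m + (\<alpha> - m) * m - \<delta> * m\<^sup>2 / 2" using m(1) by (simp add: upper_def)
        also have "\<dots> = m * (\<kappa> + \<alpha> - m - \<alpha> / 2)" unfolding m(2) by (simp add: field_simps)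
        finally show ?thesis by (simp only: m_def)
      qed
      moreover have "\<alpha> / \<delta> < \<alpha> / 2" using alpha_pos xend(4) by (simp add: field_simps)
      then have "0 < \<kappa> + \<alpha> - \<alpha> / \<delta> - \<alpha> / 2" using alpha_less alpha_pos by linarith
      ultimately show ?thesis using ad(1) mult_pos_pos by metis
    qed
    ultimately show ?thesis using ad g_pos unfolding region_def w
      by (intro UN_I[of "\<alpha> / \<delta>"]) (auto simp: mult_pos_neg)
  next
    case False
    then have y': "\<bar>y\<bar> < yend" using y by simp
    define r s where "r = ry y" and "s = sy y"
    have b: "0 < r" "r < \<alpha>" "\<bar>jy y\<bar> < r" "0 < s" using ry_bounds[OF y'] sy_pos[OF y'] by (auto simp: r_def s_def)
    have s: "s\<^sup>2 = r\<^sup>2 - (jy y)\<^sup>2" using sy_sq[of y] by (simp add: r_def s_def)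
    have sr: "s \<le> r" using s b by (intro power2_le_imp_le[of s r]) auto
    have sq: "sqrt (r\<^sup>2 - (jy y)\<^sup>2) = s" unfolding s[symmetric] using b(4) by simp
    have h: "hy y = \<kappa> * r - (\<alpha> - r) * s - \<delta> * r\<^sup>2 / 2" by (simp add: hy_def r_def s_def)
    have "hmin < hy y"
    proof -
      have "hy y - hmin = (\<alpha> - r) * (\<delta> * (r + \<alpha>) / 2 - \<kappa> - s)"
        by (simp add: h hmin_def field_simps power2_eq_square)
      moreover have "0 < \<delta> * (r + \<alpha>) / 2 - \<kappa> - s" using below_pos[of r] b sr by simp
      then have "0 < (\<alpha> - r) * (\<delta> * (r + \<alpha>) / 2 - \<kappa> - s)" using b by simp
      ultimately show ?thesis by simp
    qed
    moreover have "hy y < upper (jy y) r"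
    proof -
      have "0 < (\<alpha> - r) * s" using b by simp
      then show ?thesis unfolding h upper_def sq by linarith
    qed
    ultimately show ?thesis using b g_pos unfolding region_def y(2) crit_val_def
      by (intro UN_I[of r]) auto
  qed
qed

text \<open>From a point outside \<open>region\<close> a horizontal, a downward or an upward ray
  stays outside it, hence misses the curve.\<close>

lemma inside_region: "inside crit_curve \<subseteq> region"
proof
  fix w assume w: "w \<in> inside crit_curve"
  show "w \<in> region"
  proof (rule ccontr)
    assume n: "w \<notin> region"
    consider "\<bar>fst w\<bar> \<ge> \<alpha>" | "snd w \<le> c0 + g * hmin" | "\<bar>fst w\<bar> < \<alpha>" "c0 + g * hmin < snd w" by linarith
    then show False
    proof cases
      case 1
      define d :: real where "d = (if 0 \<le> fst w then 1 else - 1)"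
      have "w + s *\<^sub>R (d, 0) \<notin> region" if "0 \<le> s" for s
        using 1 that by (auto simp: region_def d_def)
      then have "w \<notin> inside crit_curve" using crit_curve_region by (intro not_inside_ray[of "(d, 0)"]) (auto simp: d_def zero_prod_def)
      then show ?thesis using w by simp
    next
      case 2
      have "w + s *\<^sub>R (0, - 1) \<notin> region" if "0 \<le> s" for s
        using 2 that by (auto simp: region_def)
      then have "w \<notin> inside crit_curve" using crit_curve_region by (intro not_inside_ray[of "(0, - 1)"]) (auto simp: zero_prod_def)
      then show ?thesis using w by simp
    next
      case 3
      have "c0 + g * upper (fst w) r \<le> snd w" if "\<bar>fst w\<bar> < r" "r < \<alpha>" for r
      proof (rule ccontr)
        assume "\<not> ?thesis"
        moreover have "0 < r" using that by linarith
        ultimately have "w \<in> region" using that 3(2) unfolding region_def by (intro UN_I[of r]) auto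
        then show False using n by simp
      qed
      then have "w + s *\<^sub>R (0, 1) \<notin> region" if "0 \<le> s" for s
        using that by (fastforce simp: region_def)
      then have "w \<notin> inside crit_curve" using crit_curve_region by (intro not_inside_ray[of "(0, 1)"]) (auto simp: zero_prod_def)
      then show ?thesis using w by simp
    qed
  qed
qed

section \<open>Existence and uniqueness of the flap\<close>

lemma triangular_flap_iff:
  "triangular_flap (CP2_atlas \<alpha>) F T p q c \<longleftrightarrow>
     p \<in> parabolic_values (CP2_atlas \<alpha>) F \<and> q \<in> parabolic_values (CP2_atlas \<alpha>) F \<and> c \<in> elliptic_elliptic_values (CP2_atlas \<alpha>) F \<and>
     (\<exists>h e1 e2. arc_triangle h e1 e2 p q c \<and>
        path_image h - {p, q} \<subseteq> hyperbolic_regular_values (CP2_atlas \<alpha>) F \<and>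
        path_image e1 - {p, c} \<subseteq> elliptic_regular_values (CP2_atlas \<alpha>) F \<and>
        path_image e2 - {q, c} \<subseteq> elliptic_regular_values (CP2_atlas \<alpha>) F \<and>
        T = (path_image h \<union> path_image e1 \<union> path_image e2) \<union>
            inside (path_image h \<union> path_image e1 \<union> path_image e2)) \<and>
     T \<subseteq> interior (F ` CP2 \<alpha>)"
  unfolding triangular_flap_def arc_triangle_def atlas_space_CP2_atlas[OF alpha_pos]
  by (simp only: conj_assoc)

lemma flap_exists: "triangular_flap (CP2_atlas \<alpha>) F (crit_curve \<union> inside crit_curve) (crit_val ypar) (crit_val (- ypar)) (0, c0)"
  unfolding triangular_flap_iff
proof (intro conjI exI)
  show "arc_triangle arc_h (arc_e 1) (arc_e (- 1)) (crit_val ypar) (crit_val (- ypar)) (0, c0)" by (rule triangle)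
  show "crit_val ypar \<in> parabolic_values (CP2_atlas \<alpha>) F" "crit_val (- ypar) \<in> parabolic_values (CP2_atlas \<alpha>) F"
    using ypar by (auto intro!: curve_point)
  show "(0, c0) \<in> elliptic_elliptic_values (CP2_atlas \<alpha>) F" by (rule center_elliptic)
  show "path_image arc_h - {crit_val ypar, crit_val (- ypar)} \<subseteq> hyperbolic_regular_values (CP2_atlas \<alpha>) F"
  proof
    fix w assume "w \<in> path_image arc_h - {crit_val ypar, crit_val (- ypar)}"
    then obtain y where "w = crit_val y" "\<bar>y\<bar> \<le> ypar" "y \<noteq> ypar" "y \<noteq> - ypar" by (force simp: arc_h(2))
    then show "w \<in> hyperbolic_regular_values (CP2_atlas \<alpha>) F" using curve_point(1)[of y] ypar by auto
  qed
  have e: "crit_val (t * y) \<in> elliptic_regular_values (CP2_atlas \<alpha>) F"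
    if "t = 1 \<or> t = - 1" "y \<in> {ypar..yend}" "crit_val (t * y) \<noteq> crit_val (t * ypar)" "crit_val (t * y) \<noteq> (0, c0)" for t y
  proof -
    have "y \<noteq> ypar" "y \<noteq> yend" using that crit_val_yend by auto
    then show ?thesis using that ypar by (intro curve_point(2)) auto
  qed
  have e': "path_image (arc_e t) - {crit_val (t * ypar), (0, c0)} \<subseteq> elliptic_regular_values (CP2_atlas \<alpha>) F"
    if t: "t = 1 \<or> t = - 1" for t
  proof
    fix w assume w: "w \<in> path_image (arc_e t) - {crit_val (t * ypar), (0, c0)}"
    then obtain y where "y \<in> {ypar..yend}" "w = crit_val (t * y)" unfolding arc_e(2)[OF t] by blast
    then show "w \<in> elliptic_regular_values (CP2_atlas \<alpha>) F" using e[OF t, of y] w by blast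
  qed
  show "path_image (arc_e 1) - {crit_val ypar, (0, c0)} \<subseteq> elliptic_regular_values (CP2_atlas \<alpha>) F"
    "path_image (arc_e (- 1)) - {crit_val (- ypar), (0, c0)} \<subseteq> elliptic_regular_values (CP2_atlas \<alpha>) F"
    using e'[of 1] e'[of "- 1"] by simp_all
  show "crit_curve \<union> inside crit_curve = path_image arc_h \<union> path_image (arc_e 1) \<union> path_image (arc_e (- 1)) \<union>
    inside (path_image arc_h \<union> path_image (arc_e 1) \<union> path_image (arc_e (- 1)))"
    unfolding triangle_image ..
  have "crit_curve \<union> inside crit_curve \<subseteq> region" using crit_curve_region inside_region by simp
  then show "crit_curve \<union> inside crit_curve \<subseteq> interior (F ` CP2 \<alpha>)" using open_region region_image interior_maximal by blast
qed

lemma regular_values_crit_curve: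
  assumes "w \<in> interior (F ` CP2 \<alpha>)"
    and "w \<in> hyperbolic_regular_values (CP2_atlas \<alpha>) F \<or> w \<in> elliptic_regular_values (CP2_atlas \<alpha>) F"
  shows "w \<in> crit_curve"
proof -
  obtain k x where "x \<in> chart_ball" "w = (F1 k x, F2 k x)" "singular_at (F1 k) (F2 k) x"
    using assms(2) unfolding hyperbolic_regular_values_def elliptic_regular_values_def points_of_type_iff
      hyperbolic_regular_at_def elliptic_regular_at_def rank_one_at_def by blast
  then show ?thesis using singular_value assms(1) by (auto simp: crit_curve_def)
qed

lemma parabolic_values_crit_curve:
  assumes "w \<in> interior (F ` CP2 \<alpha>)" "w \<in> parabolic_values (CP2_atlas \<alpha>) F"
  shows "w = crit_val ypar \<or> w = crit_val (- ypar)"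
proof -
  obtain k x where "x \<in> chart_ball" "w = (F1 k x, F2 k x)" "parabolic_at (F1 k) (F2 k) x"
    using assms(2) unfolding parabolic_values_def points_of_type_iff by blast
  then obtain y where "\<bar>y\<bar> = ypar" "w = crit_val y" using parabolic_value assms(1) by metis
  moreover from this have "y = ypar \<or> y = - ypar" by linarith
  ultimately show ?thesis by auto
qed

lemma elliptic_values_center:
  assumes "w \<in> interior (F ` CP2 \<alpha>)" "w \<in> elliptic_elliptic_values (CP2_atlas \<alpha>) F"
  shows "w = (0, c0)"
proof -
  obtain k x where "x \<in> chart_ball" "w = (F1 k x, F2 k x)" "rank_zero_at (F1 k) (F2 k) x"
    using assms(2) unfolding elliptic_elliptic_values_def points_of_type_iff
      elliptic_elliptic_at_def nondegenerate_zero_at_def by blast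
  then show ?thesis using rank_zero_value assms(1) by simp
qed

text \<open>The parabolic corners are determined only as a set, because exchanging p with q and
  reversing the hyperbolic side gives the same flap.\<close>

lemma flap_unique:
  assumes "triangular_flap (CP2_atlas \<alpha>) F T p q c"
  shows "T = crit_curve \<union> inside crit_curve \<and> {p, q} = {crit_val ypar, crit_val (- ypar)} \<and> c = (0, c0)"
proof -
  obtain h e1 e2 where pq: "p \<in> parabolic_values (CP2_atlas \<alpha>) F" "q \<in> parabolic_values (CP2_atlas \<alpha>) F"
    "c \<in> elliptic_elliptic_values (CP2_atlas \<alpha>) F"
    and t: "arc_triangle h e1 e2 p q c"
    and h: "path_image h - {p, q} \<subseteq> hyperbolic_regular_values (CP2_atlas \<alpha>) F"
    and e1: "path_image e1 - {p, c} \<subseteq> elliptic_regular_values (CP2_atlas \<alpha>) F"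
    and e2: "path_image e2 - {q, c} \<subseteq> elliptic_regular_values (CP2_atlas \<alpha>) F"
    and T: "T = (path_image h \<union> path_image e1 \<union> path_image e2) \<union> inside (path_image h \<union> path_image e1 \<union> path_image e2)"
    and int: "T \<subseteq> interior (F ` CP2 \<alpha>)"
    using assms unfolding triangular_flap_iff by blast
  let ?C = "path_image h \<union> path_image e1 \<union> path_image e2"
  have Ci: "?C \<subseteq> interior (F ` CP2 \<alpha>)" using int T by blast
  have mem: "p \<in> ?C" "q \<in> ?C" "c \<in> ?C" using t unfolding arc_triangle_def by blast+
  have p: "p = crit_val ypar \<or> p = crit_val (- ypar)" and q: "q = crit_val ypar \<or> q = crit_val (- ypar)" and c: "c = (0, c0)"
    using parabolic_values_crit_curve elliptic_values_center pq mem Ci by blast+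
  have "p \<noteq> q" using t arc_distinct_ends unfolding arc_triangle_def by blast
  then have "{p, q} = {crit_val ypar, crit_val (- ypar)}" using p q by auto
  moreover have "p \<in> crit_curve" "q \<in> crit_curve" "c \<in> crit_curve"
  proof -
    have "crit_val ypar \<in> crit_curve" "crit_val (- ypar) \<in> crit_curve" "crit_val yend \<in> crit_curve" using ypar by (auto simp: crit_curve_def)
    then show "p \<in> crit_curve" "q \<in> crit_curve" "c \<in> crit_curve" using p q c crit_val_yend by auto
  qed
  then have "?C \<subseteq> crit_curve" using h e1 e2 Ci regular_values_crit_curve by blast
  then have "?C = crit_curve" using arc_triangle_minimal[OF triangle t] unfolding triangle_image by blast
  ultimately show ?thesis using T c by simp
qed

end

text \<open>The condition t > t^+ gives \<alpha> < \<kappa>. The condition t \<le> 1 gives 2\<kappa>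
  \<le> 1/(2\<gamma>), which is below \<alpha>\<delta> by the condition on \<delta>.\<close>

lemma flap_data_kappa:
  fixes \<alpha> \<gamma> \<delta> t :: real
  assumes "0 < \<alpha>" "0 < \<gamma>" "\<gamma> < 1 / (4 * \<alpha>)" "1 / (2 * \<gamma> * \<alpha>) < \<delta>" "t_plus \<alpha> \<gamma> < t" "t \<le> 1"
  shows "flap_data \<alpha> ((2 * t - 1) / (4 * \<gamma> * t)) \<delta>" "0 < t"
proof -
  have ga: "4 * (\<gamma> * \<alpha>) < 1" "0 < \<gamma> * \<alpha>" using assms by (simp_all add: field_simps)
  have u: "0 < 2 * (1 - 2 * \<gamma> * \<alpha>)" 
  proof -
    have "2 * (\<gamma> * \<alpha>) < 1" using ga by linarith
    then show ?thesis by (simp add: ac_simps)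
  qed
  have tp: "1 < t * (2 * (1 - 2 * \<gamma> * \<alpha>))"
    using assms(5) u unfolding t_plus_def by (simp only: pos_divide_less_eq)
  then show t: "0 < t" using u by (metis less_trans zero_less_mult_pos2 zero_less_one)
  show "flap_data \<alpha> ((2 * t - 1) / (4 * \<gamma> * t)) \<delta>"
  proof
    show "\<alpha> < (2 * t - 1) / (4 * \<gamma> * t)" using tp t assms(2) by (simp add: field_simps)
    have "1 < \<delta> * (2 * \<gamma> * \<alpha>)" using assms(1,2,4) by (simp add: pos_divide_less_eq)
    then have d: "1 / (2 * \<gamma>) < \<alpha> * \<delta>" using assms(2) by (simp add: field_simps)
    have "2 * ((2 * t - 1) / (4 * \<gamma> * t)) \<le> 1 / (2 * \<gamma>)" using t assms(2,6) by (simp add: field_simps)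
    then show "2 * ((2 * t - 1) / (4 * \<gamma> * t)) < \<alpha> * \<delta>" using d by linarith
  qed fact
qed

text \<open>Numerator and denominator of \<open>j_bound\<close> are those of \<open>jbd\<close>
  multiplied by 4\<gamma>t; the common factor leaves the root as a square.\<close>

lemma j_bound_jbd:
  fixes \<alpha> \<gamma> \<delta> t :: real
  assumes "0 < \<gamma>" "0 < t" "flap_data \<alpha> ((2 * t - 1) / (4 * \<gamma> * t)) \<delta>"
  shows "j_bound \<alpha> \<gamma> \<delta> t = flap_data.jbd \<alpha> ((2 * t - 1) / (4 * \<gamma> * t)) \<delta>"
proof -
  define \<kappa> where "\<kappa> = (2 * t - 1) / (4 * \<gamma> * t)"
  interpret flap_data \<alpha> \<kappa> \<delta> using assms(3) by (simp add: \<kappa>_def)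
  define c where "c = 4 * \<gamma> * t"
  have c: "0 < c" using assms by (simp add: c_def)
  have k: "2 * t - 1 = c * \<kappa>" using assms by (simp add: \<kappa>_def c_def)
  have 1: "2 * (1 - 4 * \<gamma> * \<alpha>) * t - 1 = c * (\<kappa> - 2 * \<alpha>)" using k by (simp add: c_def algebra_simps)
  have 2: "16 * \<gamma> * \<alpha> * t * (2 * t - 1 + \<gamma> * \<alpha> * t * (\<delta>\<^sup>2 - 4 * \<delta> + 1)) - (2 * t - 1)\<^sup>2
     = c\<^sup>2 * (\<alpha>\<^sup>2 * ((\<delta> - 2)\<^sup>2 + 1) - (\<kappa> - 2 * \<alpha>)\<^sup>2)"
    unfolding k by (simp add: c_def algebra_simps power2_eq_square)
  have 3: "4 * \<gamma> * t * (\<delta>\<^sup>2 - 4 * \<delta> + 5) = c * ((\<delta> - 2)\<^sup>2 + 1)"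
    by (simp add: c_def algebra_simps power2_eq_square)
  have 4: "sqrt (c\<^sup>2 * (\<alpha>\<^sup>2 * ((\<delta> - 2)\<^sup>2 + 1) - (\<kappa> - 2 * \<alpha>)\<^sup>2)) = c * sqrt (\<alpha>\<^sup>2 * ((\<delta> - 2)\<^sup>2 + 1) - (\<kappa> - 2 * \<alpha>)\<^sup>2)"
    using c by (simp add: real_sqrt_mult)
  have "j_bound \<alpha> \<gamma> \<delta> t = (c * ((\<delta> - 2) * (\<kappa> - 2 * \<alpha>) + sqrt (\<alpha>\<^sup>2 * ((\<delta> - 2)\<^sup>2 + 1) - (\<kappa> - 2 * \<alpha>)\<^sup>2))) / (c * ((\<delta> - 2)\<^sup>2 + 1))"
    unfolding j_bound_def 1 2 3 4 by (simp add: algebra_simps)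
  also have "\<dots> = jbd" using c by (simp add: jbd_def)
  finally show ?thesis by (simp add: \<kappa>_def)
qed

lemma F_sys_flap_mfd:
  fixes \<alpha> \<gamma> \<delta> t :: real
  assumes "flap_data \<alpha> ((2 * t - 1) / (4 * \<gamma> * t)) \<delta>" "0 < \<gamma>" "0 < t"
  shows "flap_mfd \<alpha> ((2 * t - 1) / (4 * \<gamma> * t)) \<delta> (2 * \<gamma> * \<delta> * t * \<alpha>\<^sup>2 + (1 - 2 * t) * \<alpha>) (4 * \<gamma> * t) (F_sys \<alpha> \<gamma> \<delta> t)"
proof -
  define \<kappa> c where "\<kappa> = (2 * t - 1) / (4 * \<gamma> * t)" and "c = 4 * \<gamma> * t"
  interpret flap_data \<alpha> \<kappa> \<delta> using assms(1) by (simp add: \<kappa>_def)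
  have c: "0 < c" using assms by (simp add: c_def)
  interpret S: flap_sys \<alpha> \<kappa> \<delta> "2 * \<gamma> * \<delta> * t * \<alpha>\<^sup>2 + (1 - 2 * t) * \<alpha>" c by unfold_locales (rule c)
  have k: "2 * t - 1 = c * \<kappa>" using assms by (simp add: \<kappa>_def c_def)
  have "flap_mfd \<alpha> \<kappa> \<delta> (2 * \<gamma> * \<delta> * t * \<alpha>\<^sup>2 + (1 - 2 * t) * \<alpha>) c (F_sys \<alpha> \<gamma> \<delta> t)"
  proof unfold_locales
    fix z assume N: "N_ham z = \<alpha>"
    have z3: "(cmod (z $ 3))\<^sup>2 / 2 = \<alpha> - R_ham z" using S.level_facts(3)[OF N] by simp
    have "H_ham \<alpha> \<gamma> \<delta> t z = 2 * \<gamma> * \<delta> * t * \<alpha>\<^sup>2 - (2 * t - 1) * (\<alpha> - R_ham z) + c / 2 * (Re (Zh z) - \<delta> * (R_ham z)\<^sup>2)"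
      unfolding H_ham_def z3 Zh_def by (simp add: c_def algebra_simps)
    also have "\<dots> = 2 * \<gamma> * \<delta> * t * \<alpha>\<^sup>2 - (2 * t - 1) * \<alpha> + c * S.height z"
      unfolding S.height_def k by (simp add: algebra_simps)
    finally show "F_sys \<alpha> \<gamma> \<delta> t (hopf_class z) = (J_ham z, 2 * \<gamma> * \<delta> * t * \<alpha>\<^sup>2 + (1 - 2 * t) * \<alpha> + c * S.height z)"
      by (simp add: F_sys_hopf_class algebra_simps)
  qed
  then show ?thesis by (simp add: \<kappa>_def c_def)
qed

lemma F_sys_B:
  assumes "0 < \<alpha>"
  shows "F_sys \<alpha> \<gamma> \<delta> t (B_pt \<alpha>) = (0, 2 * \<gamma> * \<delta> * t * \<alpha>\<^sup>2 + (1 - 2 * t) * \<alpha>)"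
  using assms by (simp add: B_pt_def F_sys_hopf_class J_ham_def H_ham_def R_ham_def)

theorem proposition8p21:
  fixes \<alpha> \<gamma> :: real
  assumes "0 < \<alpha>" and "0 < \<gamma>" and "\<gamma> < 1 / (4 * \<alpha>)"
  shows "\<exists>x1 :: real \<Rightarrow> real \<Rightarrow> real.
    (\<forall>\<delta> t. 1 / (2 * \<gamma> * \<alpha>) < \<delta> \<and> t_plus \<alpha> \<gamma> < t \<and> t \<le> 1 \<longrightarrow>
       (\<exists>T p q.
          triangular_flap (CP2_atlas \<alpha>) (F_sys \<alpha> \<gamma> \<delta> t) T p q (F_sys \<alpha> \<gamma> \<delta> t (B_pt \<alpha>)) \<and>
          fst p = x1 \<delta> t \<and> fst q = - x1 \<delta> t \<and>
          (\<forall>T' p' q' c'. triangular_flap (CP2_atlas \<alpha>) (F_sys \<alpha> \<gamma> \<delta> t) T' p' q' c' \<longrightarrow>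
             T' = T \<and> {p', q'} = {p, q} \<and> c' = F_sys \<alpha> \<gamma> \<delta> t (B_pt \<alpha>))) \<and>
       F_sys \<alpha> \<gamma> \<delta> t (B_pt \<alpha>) = (0, 2 * \<gamma> * \<delta> * t * \<alpha>\<^sup>2 + (1 - 2 * t) * \<alpha>) \<and>
       0 < x1 \<delta> t \<and>
       x1 \<delta> t \<le> j_bound \<alpha> \<gamma> \<delta> t \<and>
       j_bound \<alpha> \<gamma> \<delta> t \<le> j_bound \<alpha> \<gamma> \<delta> 1 \<and>
       j_bound \<alpha> \<gamma> \<delta> 1 =
         ((\<delta> - 2) * (1 - 8 * \<gamma> * \<alpha>)
          + sqrt (16 * \<gamma> * \<alpha> * (1 + \<gamma> * \<alpha> * (\<delta>\<^sup>2 - 4 * \<delta> + 1)) - 1))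
         / (4 * \<gamma> * (\<delta>\<^sup>2 - 4 * \<delta> + 5))) \<and>
    (\<forall>t. t_plus \<alpha> \<gamma> < t \<and> t \<le> 1 \<longrightarrow> ((\<lambda>\<delta>. x1 \<delta> t) \<longlongrightarrow> 0) at_top)"
proof -
  define K where "K t = (2 * t - 1) / (4 * \<gamma> * t)" for t
  \<comment> \<open>A single function of both parameters, so that the limit in \<delta> at fixed t
    refers to the corners of the same flaps.\<close>
  define x1 where "x1 \<delta> t = flap_data.jy \<alpha> (K t) \<delta> (flap_data.ypar \<alpha> (K t) \<delta>)" for \<delta> t
  have fd: "flap_data \<alpha> (K t) \<delta>" "0 < t"
    if "1 / (2 * \<gamma> * \<alpha>) < \<delta>" "t_plus \<alpha> \<gamma> < t" "t \<le> 1" for \<delta> t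
    using flap_data_kappa[OF assms that] by (simp_all add: K_def)
  have x1: "0 < x1 \<delta> t" "x1 \<delta> t \<le> flap_data.jbd \<alpha> (K t) \<delta>" "(\<delta> - 2) * x1 \<delta> t \<le> K t - \<alpha>"
    if "flap_data \<alpha> (K t) \<delta>" for \<delta> t
  proof -
    interpret flap_data \<alpha> "K t" \<delta> by (fact that)
    have j: "x1 \<delta> t = jx xpar" using ypar by (simp add: x1_def jy_jx xq_ypar)
    show "0 < x1 \<delta> t" using jy_pos[of ypar] ypar by (simp add: x1_def)
    have b: "(\<delta> - 2) * x1 \<delta> t - (K t - 2 * \<alpha>) \<le> sqrt (\<alpha>\<^sup>2 - (x1 \<delta> t)\<^sup>2)" "0 \<le> x1 \<delta> t" "x1 \<delta> t < \<alpha>"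
      using jx_bound_aux[of xpar] xpar by (simp_all add: j)
    show "x1 \<delta> t \<le> jbd" by (rule le_jbd[OF b])
    \<comment> \<open>For the limit, \<alpha> in place of the square root suffices: x1 is then of
      order 1 / (\<delta> - 2).\<close>
    have "sqrt (\<alpha>\<^sup>2 - (x1 \<delta> t)\<^sup>2) \<le> \<alpha>" using alpha_pos by (intro real_le_lsqrt) auto
    then show "(\<delta> - 2) * x1 \<delta> t \<le> K t - \<alpha>" using b(1) by linarith
  qed
  show ?thesis
  proof (intro exI[of _ x1] conjI allI impI)
    fix \<delta> t assume a: "1 / (2 * \<gamma> * \<alpha>) < \<delta> \<and> t_plus \<alpha> \<gamma> < t \<and> t \<le> 1"
    then have f: "flap_data \<alpha> (K t) \<delta>" and t0: "0 < t" using fd by auto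
    have f1: "flap_data \<alpha> (K 1) \<delta>" using fd[of \<delta> 1] a by auto
    interpret flap_mfd \<alpha> "K t" \<delta> "2 * \<gamma> * \<delta> * t * \<alpha>\<^sup>2 + (1 - 2 * t) * \<alpha>" "4 * \<gamma> * t" "F_sys \<alpha> \<gamma> \<delta> t"
      using F_sys_flap_mfd[of \<alpha> t \<gamma> \<delta>] f t0 assms(2) by (simp add: K_def)
    show B: "F_sys \<alpha> \<gamma> \<delta> t (B_pt \<alpha>) = (0, 2 * \<gamma> * \<delta> * t * \<alpha>\<^sup>2 + (1 - 2 * t) * \<alpha>)" by (rule F_sys_B[OF assms(1)])
    show "\<exists>T p q.
          triangular_flap (CP2_atlas \<alpha>) (F_sys \<alpha> \<gamma> \<delta> t) T p q (F_sys \<alpha> \<gamma> \<delta> t (B_pt \<alpha>)) \<and>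
          fst p = x1 \<delta> t \<and> fst q = - x1 \<delta> t \<and>
          (\<forall>T' p' q' c'. triangular_flap (CP2_atlas \<alpha>) (F_sys \<alpha> \<gamma> \<delta> t) T' p' q' c' \<longrightarrow>
             T' = T \<and> {p', q'} = {p, q} \<and> c' = F_sys \<alpha> \<gamma> \<delta> t (B_pt \<alpha>))"
      unfolding B
      by (intro exI[of _ "crit_curve \<union> inside crit_curve"] exI[of _ "crit_val ypar"] exI[of _ "crit_val (- ypar)"] conjI allI impI
          flap_exists flap_unique) (simp_all add: crit_val_def x1_def)
    show "0 < x1 \<delta> t" by (rule x1(1)[OF f])
    have jb: "j_bound \<alpha> \<gamma> \<delta> t = flap_data.jbd \<alpha> (K t) \<delta>" "j_bound \<alpha> \<gamma> \<delta> 1 = flap_data.jbd \<alpha> (K 1) \<delta>"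
      using j_bound_jbd[OF assms(2) t0, of \<alpha> \<delta>] j_bound_jbd[OF assms(2) zero_less_one, of \<alpha> \<delta>] f f1
      unfolding K_def by simp_all
    show "x1 \<delta> t \<le> j_bound \<alpha> \<gamma> \<delta> t" unfolding jb by (rule x1(2)[OF f])
    \<comment> \<open>K t equals (1 - 1/(2t)) / (2\<gamma>), which increases with t.\<close>
    have "K t \<le> K 1" using a t0 assms(2) by (simp add: K_def field_simps)
    then show "j_bound \<alpha> \<gamma> \<delta> t \<le> j_bound \<alpha> \<gamma> \<delta> 1" unfolding jb by (rule jbd_mono[OF f f1])
    show "j_bound \<alpha> \<gamma> \<delta> 1 =
         ((\<delta> - 2) * (1 - 8 * \<gamma> * \<alpha>)
          + sqrt (16 * \<gamma> * \<alpha> * (1 + \<gamma> * \<alpha> * (\<delta>\<^sup>2 - 4 * \<delta> + 1)) - 1))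
         / (4 * \<gamma> * (\<delta>\<^sup>2 - 4 * \<delta> + 5))"
      by (simp add: j_bound_def algebra_simps)
  next
    fix t assume t: "t_plus \<alpha> \<gamma> < t \<and> t \<le> 1"
    define d0 where "d0 = max (1 / (2 * \<gamma> * \<alpha>)) 2"
    have ev: "\<forall>\<^sub>F \<delta> in at_top. d0 < \<delta>" by (rule eventually_gt_at_top)
    have bd: "0 < x1 \<delta> t \<and> x1 \<delta> t \<le> (K t - \<alpha>) / (\<delta> - 2)" if "d0 < \<delta>" for \<delta>
    proof -
      have f: "flap_data \<alpha> (K t) \<delta>" using fd that t by (simp add: d0_def)
      then show ?thesis using x1(1)[OF f] x1(3)[OF f] that by (simp add: d0_def pos_le_divide_eq mult.commute)
    qed
    have L: "((\<lambda>\<delta>. (K t - \<alpha>) / (\<delta> - 2)) \<longlongrightarrow> 0) at_top"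
    proof (rule tendsto_divide_0[OF tendsto_const])
      show "filterlim (\<lambda>\<delta>::real. \<delta> - 2) at_infinity at_top"
        by (rule filterlim_at_top_imp_at_infinity)
           (rule filterlim_at_top_mono[OF filterlim_tendsto_add_at_top[OF tendsto_const[of "- 2"] filterlim_ident]], simp)
    qed
    have e: "\<forall>\<^sub>F \<delta> in at_top. 0 \<le> x1 \<delta> t" "\<forall>\<^sub>F \<delta> in at_top. x1 \<delta> t \<le> (K t - \<alpha>) / (\<delta> - 2)"
      using ev by (eventually_elim, use bd in force)+
    show "((\<lambda>\<delta>. x1 \<delta> t) \<longlongrightarrow> 0) at_top"
      by (rule tendsto_sandwich[OF e tendsto_const L])
  qed
qed

end
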